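(* Let $(\Sigma,D)$ be an affine surface equipped with a $D$-parallel (nonzero) nilpotent $(1,1)$-tensor field $T$ and a $D$-parallel symmetric $(0,2)$-tensor field $\Phi$. If $\rho^D$ is symmetric, then $(T^*\Sigma,g_{D,\Phi,T})$ is anti-self-dual if and only if $\widehat\omega=0$ and $\widehat\Phi=0$, where $\omega$ is the recurrence one-form of the Ricci tensor, $D\rho^D=\omega\otimes\rho^D$.
   Context: An affine surface $(\Sigma,D)$ is a smooth connected surface with a torsion free affine connection $D$, with Christoffel symbols ${}^D\Gamma_{ij}{}^k$. Its Ricci tensor is $\rho^D(X,Y)=\operatorname{tr}\{Z\mapsto R^D(Z,X)Y\}$ with $R^D(X,Y)=[D_X,D_Y]-D_{[X,Y]}$. Nilpotent means $T^2=0$, $T\neq0$. When a parallel nilpotent $T$ exists and $\rho^D$ is symmetric, $\rho^D$ has rank one and is recurrent on the open set where it is nonzero, i.e. there is a unique one-form $\omega$ on that set with $D\rho^D=\omega\otimes\rho^D$; in local coordinates $(u^1,u^2)$ in which the only non-zero Christoffel symbol is ${}^u\Gamma_{11}{}^2$, $\omega=\partial_{u^1}(\ln|\partial_{u^2}{}^u\Gamma_{11}{}^2|)\,du^1+\partial_{u^2}(\ln|\partial_{u^2}{}^u\Gamma_{11}{}^2|)\,du^2$. The condition $\widehat\omega=0$ refers to that open set (it is vacuous if $D$ is flat). Notation: $\widehat\omega(X)=\omega(TX)$, $\widehat\Phi(X,Y)=\Phi(TX,TY)$. Let $\pi\colon T^*\Sigma\to\Sigma$ be the cotangent bundle. Local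 coordinates $(x^i)$ on $\Sigma$ induce coordinates $(x^i,x_{i'})$ on $T^*\Sigma$ by writing a covector as $\sum x_{i'}dx^i$. For a vector field $X$ on $\Sigma$, $\iota X(p,\alpha)=\alpha(X_p)$, and the complete lift $X^C$ is determined by $X^C(\iota Z)=\iota[X,Z]$ for all $Z$; $\iota T$ is the one-form with $\iota T(X^C)=\iota(TX)$; $g_D$ is the metric with $g_D(X^C,Y^C)=-\iota(D_XY+D_YX)$. Then $g_{D,\Phi,T}=\iota T\circ\iota T+g_D+\pi^*\Phi$, where $\omega_1\circ\omega_2=\frac12(\omega_1\otimes\omega_2+\omega_2\otimes\omega_1)$; it has neutral signature. In induced coordinates, with $T\partial_i=T_i^k\partial_k$, $$g_{D,\Phi,T}=2\,dx^i\circ dx_{i'}+\{\tfrac12x_{r'}x_{s'}(T_i^rT_j^s+T_j^rT_i^s)-2x_{k'}{}^D\Gamma_{ij}{}^k+\Phi_{ij}\}\,dx^i\circ dx^j .$$ $T^*\Sigma$ carries the orientation for which, for any basis $u,v$ of the null distribution $\ker\pi_*$, the bivector $u\wedge v$ is self-dual. A metric is anti-self-dual if the self-dual Weyl curvature operator $W^+$ vanishes. *)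

theory Defs
  imports "HOL-Analysis.Analysis"
begin

section \<open>Smooth functions of several real variables\<close>

definition pd :: "'n \<Rightarrow> (real^'n \<Rightarrow> real) \<Rightarrow> real^'n \<Rightarrow> real" where
  "pd i f x = frechet_derivative f (at x) (axis i 1)"

primrec Ck_on :: "nat \<Rightarrow> (real^'n) set \<Rightarrow> (real^'n \<Rightarrow> real) \<Rightarrow> bool" where
  "Ck_on 0 S f \<longleftrightarrow> continuous_on S f"
| "Ck_on (Suc k) S f \<longleftrightarrow> f differentiable_on S \<and> (\<forall>i. Ck_on k S (pd i f))"

text \<open>Only meant for open \<open>S\<close>, where it is membership in \<open>C\<^sup>\<infinity>(S)\<close>.\<close>

definition smooth_on :: "(real^'n) set \<Rightarrow> (real^'n \<Rightarrow> real) \<Rightarrow> bool" where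
  "smooth_on S f \<longleftrightarrow> (\<forall>k. Ck_on k S f)"

section \<open>Smooth manifolds\<close>

text \<open>
  An atlas is an indexed family of charts \<open>(chart_dom A a, coord A a)\<close>.  The underlying set is the
  union of the chart domains, and the topology is the one induced by the charts.  All fields on
  a manifold are given by their components in the charts, as functions of the coordinates,
  together with the transformation law between any two charts.
\<close>

record ('i, 'p, 'n::finite) atlas =
  charts :: "'i set"
  chart_dom :: "'i \<Rightarrow> 'p set"
  coord :: "'i \<Rightarrow> 'p \<Rightarrow> real^'n"

definition points :: "('i, 'p, 'n::finite) atlas \<Rightarrow> 'p set" where
  "points A = (\<Union>a\<in>charts A. chart_dom A a)"

definition region :: "('i, 'p, 'n::finite) atlas \<Rightarrow> 'i \<Rightarrow> (real^'n) set" where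
  "region A a = coord A a ` chart_dom A a"

definition overlap :: "('i, 'p, 'n::finite) atlas \<Rightarrow> 'i \<Rightarrow> 'i \<Rightarrow> (real^'n) set" where
  "overlap A a b = coord A a ` (chart_dom A a \<inter> chart_dom A b)"

definition transition :: "('i, 'p, 'n::finite) atlas \<Rightarrow> 'i \<Rightarrow> 'i \<Rightarrow> real^'n \<Rightarrow> real^'n" where
  "transition A a b = coord A b \<circ> inv_into (chart_dom A a) (coord A a)"

definition Jac :: "('i, 'p, 'n::finite) atlas \<Rightarrow> 'i \<Rightarrow> 'i \<Rightarrow> real^'n \<Rightarrow> real^'n^'n" where
  "Jac A a b x = jacobian (transition A a b) (at x)"

definition smooth_atlas :: "('i, 'p, 'n::finite) atlas \<Rightarrow> bool" where
  "smooth_atlas A \<longleftrightarrow>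
     (\<forall>a\<in>charts A. inj_on (coord A a) (chart_dom A a) \<and> open (region A a)) \<and>
     (\<forall>a\<in>charts A. \<forall>b\<in>charts A. open (overlap A a b) \<and>
        (\<forall>k. smooth_on (overlap A a b) (\<lambda>x. transition A a b x $ k)))"

definition atlas_topology :: "('i, 'p, 'n::finite) atlas \<Rightarrow> 'p topology" where
  "atlas_topology A = topology (\<lambda>W. W \<subseteq> points A \<and>
     (\<forall>a\<in>charts A. open (coord A a ` (W \<inter> chart_dom A a))))"

definition smooth_manifold :: "('i, 'p, 'n::finite) atlas \<Rightarrow> bool" where
  "smooth_manifold A \<longleftrightarrow> smooth_atlas A \<and>
     Hausdorff_space (atlas_topology A) \<and> second_countable (atlas_topology A)"

lemma openin_atlas_topology:
  fixes A :: "('i, 'p, 'n::finite) atlas"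
  assumes "smooth_atlas A"
  shows "openin (atlas_topology A) W \<longleftrightarrow>
    W \<subseteq> points A \<and> (\<forall>a\<in>charts A. open (coord A a ` (W \<inter> chart_dom A a)))"
proof -
  let ?L = "\<lambda>W. W \<subseteq> points A \<and> (\<forall>a\<in>charts A. open (coord A a ` (W \<inter> chart_dom A a)))"
  have "istopology ?L"
    unfolding istopology_def
  proof (intro conjI allI impI ballI)
    fix S T assume S: "?L S" and T: "?L T"
    then show "S \<inter> T \<subseteq> points A" by blast
    fix a assume a: "a \<in> charts A"
    then have inj: "inj_on (coord A a) (chart_dom A a)"
      using assms by (auto simp: smooth_atlas_def)
    have "coord A a ` ((S \<inter> T) \<inter> chart_dom A a) =
        coord A a ` (S \<inter> chart_dom A a) \<inter> coord A a ` (T \<inter> chart_dom A a)"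
      using inj by (auto simp: inj_on_def)
    then show "open (coord A a ` ((S \<inter> T) \<inter> chart_dom A a))"
      using S T a by (simp add: open_Int)
  next
    fix K assume K: "\<forall>S\<in>K. ?L S"
    then show "\<Union>K \<subseteq> points A" by blast
    fix a assume a: "a \<in> charts A"
    have "coord A a ` (\<Union>K \<inter> chart_dom A a) = (\<Union>S\<in>K. coord A a ` (S \<inter> chart_dom A a))"
      by blast
    then show "open (coord A a ` (\<Union>K \<inter> chart_dom A a))"
      using K a by auto
  qed
  then show ?thesis
    by (simp add: atlas_topology_def)
qed

section \<open>Connections and their curvature in coordinates\<close>

text \<open>\<open>\<Gamma> x i j k\<close> is the Christoffel symbol \<open>\<Gamma>\<^sub>i\<^sub>j\<^sup>k\<close> at the point with coordinates \<open>x\<close>.\<close>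

type_synonym 'n christoffel = "real^'n \<Rightarrow> 'n \<Rightarrow> 'n \<Rightarrow> 'n \<Rightarrow> real"

text \<open>\<open>R(\<partial>\<^sub>i,\<partial>\<^sub>j)\<partial>\<^sub>k = \<Sum>\<^sub>l curv \<Gamma> x i j k l \<partial>\<^sub>l\<close> for \<open>R(X,Y) = [D\<^sub>X,D\<^sub>Y] - D\<^bsub>[X,Y]\<^esub>\<close>.\<close>

definition curv :: "'n::finite christoffel \<Rightarrow> real^'n \<Rightarrow> 'n \<Rightarrow> 'n \<Rightarrow> 'n \<Rightarrow> 'n \<Rightarrow> real" where
  "curv \<Gamma> x i j k l =
     pd i (\<lambda>y. \<Gamma> y j k l) x - pd j (\<lambda>y. \<Gamma> y i k l) x
     + (\<Sum>m\<in>UNIV. \<Gamma> x j k m * \<Gamma> x i m l - \<Gamma> x i k m * \<Gamma> x j m l)"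

text \<open>\<open>\<rho>(X,Y) = tr (Z \<mapsto> R(Z,X)Y)\<close>.\<close>

definition ricci :: "'n::finite christoffel \<Rightarrow> real^'n \<Rightarrow> real^'n^'n" where
  "ricci \<Gamma> x = (\<chi> j k. \<Sum>i\<in>UNIV. curv \<Gamma> x i j k i)"

text \<open>A \<open>(1,1)\<close>-tensor \<open>T\<close> with \<open>T \<partial>\<^sub>i = \<Sum>\<^sub>k T\<^sub>i\<^sup>k \<partial>\<^sub>k\<close> is the matrix with \<open>T $ k $ i = T\<^sub>i\<^sup>k\<close>,
  acting on tangent vectors by \<open>T *v X\<close>.
  \<open>cov11 \<Gamma> T x i j k\<close> and \<open>cov02 \<Gamma> B x i j k\<close> stand for \<open>(D\<^sub>i T)\<^sub>j\<^sup>k\<close> and \<open>(D\<^sub>i B)\<^sub>j\<^sub>k\<close>.\<close>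

definition cov11 ::
  "'n::finite christoffel \<Rightarrow> (real^'n \<Rightarrow> real^'n^'n) \<Rightarrow> real^'n \<Rightarrow> 'n \<Rightarrow> 'n \<Rightarrow> 'n \<Rightarrow> real" where
  "cov11 \<Gamma> T x i j k = pd i (\<lambda>y. T y $ k $ j) x
     + (\<Sum>m\<in>UNIV. \<Gamma> x i m k * T x $ m $ j) - (\<Sum>m\<in>UNIV. \<Gamma> x i j m * T x $ k $ m)"

definition cov02 ::
  "'n::finite christoffel \<Rightarrow> (real^'n \<Rightarrow> real^'n^'n) \<Rightarrow> real^'n \<Rightarrow> 'n \<Rightarrow> 'n \<Rightarrow> 'n \<Rightarrow> real" where
  "cov02 \<Gamma> B x i j k = pd i (\<lambda>y. B y $ j $ k) x
     - (\<Sum>m\<in>UNIV. \<Gamma> x i j m * B x $ m $ k) - (\<Sum>m\<in>UNIV. \<Gamma> x i k m * B x $ j $ m)"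

text \<open>The value at \<open>x\<close> of the one-form \<open>\<omega>\<close> with \<open>D\<rho> = \<omega> \<otimes> \<rho>\<close>; meaningful only where \<open>\<rho> \<noteq> 0\<close>
  and \<open>\<rho>\<close> is recurrent, in which case \<open>\<omega>\<close> is unique.\<close>

definition recurrence_form :: "'n::finite christoffel \<Rightarrow> real^'n \<Rightarrow> real^'n" where
  "recurrence_form \<Gamma> x =
     (THE w. \<forall>i j k. cov02 \<Gamma> (ricci \<Gamma>) x i j k = w $ i * ricci \<Gamma> x $ j $ k)"

section \<open>Affine surfaces and tensor fields\<close>

text \<open>The equation below expresses \<open>D\<^bsub>\<partial>\<^sub>i\<^esub> \<partial>\<^sub>j\<close> of chart \<open>a\<close> in the frame of chart \<open>b\<close>, using
  \<open>\<partial>\<^sub>j = \<Sum>\<^sub>s J\<^sup>s\<^sub>j \<partial>'\<^sub>s\<close> with \<open>J = Jac A a b x\<close>.\<close>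

definition affine_connection ::
  "('i, 'p, 'n::finite) atlas \<Rightarrow> ('i \<Rightarrow> 'n christoffel) \<Rightarrow> bool" where
  "affine_connection A \<Gamma> \<longleftrightarrow>
     (\<forall>a\<in>charts A. \<forall>i j k. smooth_on (region A a) (\<lambda>x. \<Gamma> a x i j k)) \<and>
     (\<forall>a\<in>charts A. \<forall>b\<in>charts A. \<forall>x\<in>overlap A a b. \<forall>i j m.
        (\<Sum>k\<in>UNIV. \<Gamma> a x i j k * Jac A a b x $ m $ k) =
          pd i (\<lambda>y. Jac A a b y $ m $ j) x
          + (\<Sum>r\<in>UNIV. \<Sum>s\<in>UNIV.
               \<Gamma> b (transition A a b x) r s m * Jac A a b x $ r $ i * Jac A a b x $ s $ j))"

definition torsion_free ::
  "('i, 'p, 'n::finite) atlas \<Rightarrow> ('i \<Rightarrow> 'n christoffel) \<Rightarrow> bool" where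
  "torsion_free A \<Gamma> \<longleftrightarrow> (\<forall>a\<in>charts A. \<forall>x\<in>region A a. \<forall>i j k. \<Gamma> a x i j k = \<Gamma> a x j i k)"

definition affine_surface :: "('i, 'p, 2) atlas \<Rightarrow> ('i \<Rightarrow> 2 christoffel) \<Rightarrow> bool" where
  "affine_surface A \<Gamma> \<longleftrightarrow> smooth_manifold A \<and> connected_space (atlas_topology A) \<and>
     affine_connection A \<Gamma> \<and> torsion_free A \<Gamma>"

definition tensor11_field ::
  "('i, 'p, 'n::finite) atlas \<Rightarrow> ('i \<Rightarrow> real^'n \<Rightarrow> real^'n^'n) \<Rightarrow> bool" where
  "tensor11_field A T \<longleftrightarrow>
     (\<forall>a\<in>charts A. \<forall>i k. smooth_on (region A a) (\<lambda>x. T a x $ k $ i)) \<and>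
     (\<forall>a\<in>charts A. \<forall>b\<in>charts A. \<forall>x\<in>overlap A a b.
        T b (transition A a b x) ** Jac A a b x = Jac A a b x ** T a x)"

definition tensor02_field ::
  "('i, 'p, 'n::finite) atlas \<Rightarrow> ('i \<Rightarrow> real^'n \<Rightarrow> real^'n^'n) \<Rightarrow> bool" where
  "tensor02_field A \<Phi> \<longleftrightarrow>
     (\<forall>a\<in>charts A. \<forall>i j. smooth_on (region A a) (\<lambda>x. \<Phi> a x $ i $ j)) \<and>
     (\<forall>a\<in>charts A. \<forall>b\<in>charts A. \<forall>x\<in>overlap A a b.
        \<Phi> a x = transpose (Jac A a b x) ** \<Phi> b (transition A a b x) ** Jac A a b x)"

definition symmetric02 ::
  "('i, 'p, 'n::finite) atlas \<Rightarrow> ('i \<Rightarrow> real^'n \<Rightarrow> real^'n^'n) \<Rightarrow> bool" where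
  "symmetric02 A \<Phi> \<longleftrightarrow> (\<forall>a\<in>charts A. \<forall>x\<in>region A a. transpose (\<Phi> a x) = \<Phi> a x)"

definition parallel11 ::
  "('i, 'p, 'n::finite) atlas \<Rightarrow> ('i \<Rightarrow> 'n christoffel) \<Rightarrow> ('i \<Rightarrow> real^'n \<Rightarrow> real^'n^'n) \<Rightarrow> bool" where
  "parallel11 A \<Gamma> T \<longleftrightarrow> (\<forall>a\<in>charts A. \<forall>x\<in>region A a. \<forall>i j k. cov11 (\<Gamma> a) (T a) x i j k = 0)"

definition parallel02 ::
  "('i, 'p, 'n::finite) atlas \<Rightarrow> ('i \<Rightarrow> 'n christoffel) \<Rightarrow> ('i \<Rightarrow> real^'n \<Rightarrow> real^'n^'n) \<Rightarrow> bool" where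
  "parallel02 A \<Gamma> \<Phi> \<longleftrightarrow> (\<forall>a\<in>charts A. \<forall>x\<in>region A a. \<forall>i j k. cov02 (\<Gamma> a) (\<Phi> a) x i j k = 0)"

text \<open>\<open>T\<^sup>2 = 0\<close> and \<open>T \<noteq> 0\<close> as a tensor field, i.e. \<open>T\<close> does not vanish identically.\<close>

definition nilpotent11 ::
  "('i, 'p, 'n::finite) atlas \<Rightarrow> ('i \<Rightarrow> real^'n \<Rightarrow> real^'n^'n) \<Rightarrow> bool" where
  "nilpotent11 A T \<longleftrightarrow>
     (\<forall>a\<in>charts A. \<forall>x\<in>region A a. T a x ** T a x = 0) \<and>
     (\<exists>a\<in>charts A. \<exists>x\<in>region A a. T a x \<noteq> 0)"

definition hat1 :: "real^'n::finite \<Rightarrow> real^'n^'n \<Rightarrow> real^'n \<Rightarrow> real" where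
  "hat1 w T X = w \<bullet> (T *v X)"

definition hat2 :: "real^'n^'n::finite \<Rightarrow> real^'n^'n \<Rightarrow> real^'n \<Rightarrow> real^'n \<Rightarrow> real" where
  "hat2 B T X Y = (T *v X) \<bullet> (B *v (T *v Y))"

section \<open>The cotangent bundle\<close>

text \<open>A covector at \<open>p\<close> is given by its components \<open>\<alpha> a\<close> in every chart \<open>a\<close> around \<open>p\<close>; the
  value at all other indices is set to \<open>0\<close> to make the representation unique.\<close>

definition cotangent_space :: "('i, 'p, 'n::finite) atlas \<Rightarrow> 'p \<Rightarrow> ('i \<Rightarrow> real^'n) set" where
  "cotangent_space A p = {\<alpha>.
     (\<forall>a\<in>charts A. \<forall>b\<in>charts A. p \<in> chart_dom A a \<longrightarrow> p \<in> chart_dom A b \<longrightarrow>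
        \<alpha> a = transpose (Jac A a b (coord A a p)) *v \<alpha> b) \<and>
     (\<forall>a. \<not> (a \<in> charts A \<and> p \<in> chart_dom A a) \<longrightarrow> \<alpha> a = 0)}"

text \<open>Induced coordinates: the index \<open>Inl i\<close> belongs to \<open>x\<^sup>i\<close> and \<open>Inr i\<close> to the fibre
  coordinate \<open>x\<^bsub>i'\<^esub>\<close>.\<close>

definition induced :: "real^'n \<Rightarrow> real^'n \<Rightarrow> real^('n::finite + 'n)" where
  "induced x \<xi> = (\<chi> s. case s of Inl i \<Rightarrow> x $ i | Inr i \<Rightarrow> \<xi> $ i)"

definition base :: "real^('n::finite + 'n) \<Rightarrow> real^'n" where
  "base z = (\<chi> i. z $ Inl i)"

definition fibre :: "real^('n::finite + 'n) \<Rightarrow> real^'n" where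
  "fibre z = (\<chi> i. z $ Inr i)"

lemma base_induced [simp]: "base (induced x \<xi>) = x" and fibre_induced [simp]: "fibre (induced x \<xi>) = \<xi>"
  by (simp_all add: base_def fibre_def induced_def vec_eq_iff)

lemma base_nth: "base z $ i = z $ Inl i" and fibre_nth: "fibre z $ i = z $ Inr i"
  by (simp_all add: base_def fibre_def)

lemma induced_base_fibre [simp]: "induced (base z) (fibre z) = z"
  by (simp add: base_def fibre_def induced_def vec_eq_iff split: sum.splits)

definition cotangent_bundle ::
  "('i, 'p, 'n::finite) atlas \<Rightarrow> ('i, 'p \<times> ('i \<Rightarrow> real^'n), 'n + 'n) atlas" where
  "cotangent_bundle A =
     \<lparr>charts = charts A,
      chart_dom = (\<lambda>a. {(p, \<alpha>). p \<in> chart_dom A a \<and> \<alpha> \<in> cotangent_space A p}),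
      coord = (\<lambda>a (p, \<alpha>). induced (coord A a p) (\<alpha> a))\<rparr>"

lemma region_cotangent_bundle:
  fixes A :: "('i, 'p, 'n::finite) atlas"
  assumes "smooth_atlas A" "a \<in> charts A"
  shows "region (cotangent_bundle A) a = {z. base z \<in> region A a}"
proof -
  have op: "open (overlap A b c)" and inj: "inj_on (coord A b) (chart_dom A b)"
    and sm: "\<And>k. smooth_on (overlap A b c) (\<lambda>x. transition A b c x $ k)"
    if "b \<in> charts A" "c \<in> charts A" for b c
    using assms(1) that by (auto simp: smooth_atlas_def)
  have tr: "transition A b c (coord A b p) = coord A c p"
    if "b \<in> charts A" "p \<in> chart_dom A b" for b c p
    using inj[OF that(1) that(1)] that(2) by (simp add: transition_def)
  have der: "(transition A b c has_derivative (\<lambda>h. Jac A b c (coord A b p) *v h)) (at (coord A b p))"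
    if bc: "b \<in> charts A" "c \<in> charts A" and p: "p \<in> chart_dom A b" "p \<in> chart_dom A c" for b c p
  proof -
    have mem: "coord A b p \<in> overlap A b c"
      using p by (auto simp: overlap_def)
    have "(\<lambda>x. transition A b c x $ k) differentiable (at (coord A b p))" for k
    proof -
      have "Ck_on (Suc 0) (overlap A b c) (\<lambda>x. transition A b c x $ k)"
        using sm[OF bc, of k] unfolding smooth_on_def by (rule spec)
      then show ?thesis
        using mem by (auto simp: differentiable_on_def simp flip: at_within_open[OF mem op[OF bc]])
    qed
    then have "transition A b c differentiable (at (coord A b p))"
      by (subst differentiable_componentwise_within) (auto simp: Basis_vec_def inner_axis)
    then show ?thesis
      by (simp add: Jac_def jacobian_works)
  qed
  have cocycle: "Jac A b d (coord A b p) = Jac A c d (coord A c p) ** Jac A b c (coord A b p)"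
    if bcd: "b \<in> charts A" "c \<in> charts A" "d \<in> charts A"
      and p: "p \<in> chart_dom A b" "p \<in> chart_dom A c" "p \<in> chart_dom A d" for b c d p
  proof -
    let ?x = "coord A b p"
    define N where "N = overlap A b c \<inter> overlap A b d"
    have N: "open N" "?x \<in> N"
      using op bcd p by (auto simp: N_def overlap_def)
    have "(transition A c d has_derivative (\<lambda>h. Jac A c d (coord A c p) *v h)) (at (transition A b c ?x))"
      using der[OF bcd(2,3) p(2,3)] tr bcd p by simp
    note D = has_derivative_compose[OF der[OF bcd(1,2) p(1,2)] this]
    have eq: "transition A c d (transition A b c x) = transition A b d x" if x: "x \<in> N" for x
    proof -
      obtain q where q: "q \<in> chart_dom A b" "q \<in> chart_dom A c" "x = coord A b q"
        using x by (auto simp: N_def overlap_def)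
      then show ?thesis
        using tr bcd by simp
    qed
    have "(transition A b d has_derivative
        (\<lambda>h. Jac A c d (coord A c p) *v (Jac A b c ?x *v h))) (at ?x)"
      by (rule has_derivative_transform_within_open[OF D N eq])
    then have "(\<lambda>h. Jac A c d (coord A c p) *v (Jac A b c ?x *v h)) = (\<lambda>h. Jac A b d ?x *v h)"
      using der[OF bcd(1,3) p(1,3)] has_derivative_unique by blast
    then show ?thesis
      by (metis (no_types, lifting) matrix_eq matrix_vector_mul_assoc)
  qed
  have id: "Jac A a a (coord A a p) = mat 1" if p: "p \<in> chart_dom A a" for p
  proof -
    let ?x = "coord A a p"
    have N: "open (overlap A a a)" "?x \<in> overlap A a a"
      using op[OF assms(2) assms(2)] p by (auto simp: overlap_def)
    have "(transition A a a has_derivative (\<lambda>h. h)) (at ?x)"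
    proof (rule has_derivative_transform_within_open[OF has_derivative_ident N])
      fix x assume "x \<in> overlap A a a"
      then show "x = transition A a a x"
        using tr assms(2) by (auto simp: overlap_def)
    qed
    then have "(\<lambda>h. h) = (\<lambda>h. Jac A a a ?x *v h)"
      using der[OF assms(2,2) p p] has_derivative_unique by blast
    then show ?thesis
      by (metis matrix_eq matrix_vector_mul_lid)
  qed
  show ?thesis
  proof (intro equalityI subsetI CollectI)
    fix z assume "z \<in> region (cotangent_bundle A) a"
    then show "base z \<in> region A a"
      by (auto simp: region_def cotangent_bundle_def)
  next
    fix z assume "z \<in> {z. base z \<in> region A a}"
    then obtain p where p: "p \<in> chart_dom A a" "base z = coord A a p"
      by (auto simp: region_def)
    define \<alpha> where "\<alpha> = (\<lambda>b. if b \<in> charts A \<and> p \<in> chart_dom A b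
       then transpose (Jac A b a (coord A b p)) *v fibre z else 0)"
    have "\<alpha> \<in> cotangent_space A p"
      unfolding cotangent_space_def
    proof (intro CollectI conjI ballI allI impI)
      fix b c assume bc: "b \<in> charts A" "c \<in> charts A" "p \<in> chart_dom A b" "p \<in> chart_dom A c"
      show "\<alpha> b = transpose (Jac A b c (coord A b p)) *v \<alpha> c"
        using cocycle[of b c a p] bc p assms(2)
        by (simp add: \<alpha>_def matrix_transpose_mul matrix_vector_mul_assoc del: transpose_matrix_vector)
    qed (auto simp: \<alpha>_def)
    moreover have "\<alpha> a = fibre z"
      using p assms(2) id by (simp add: \<alpha>_def transpose_mat)
    ultimately show "z \<in> region (cotangent_bundle A) a"
      unfolding region_def cotangent_bundle_def
      using p by (auto intro!: image_eqI[of _ _ "(p, \<alpha>)"] simp flip: p(2))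
  qed
qed

subsection \<open>The metric \<open>g\<^bsub>D,\<Phi>,T\<^esub>\<close>\<close>

text \<open>In induced coordinates
  \<open>\<iota>T = \<Sum> x\<^bsub>k'\<^esub> T\<^sub>i\<^sup>k dx\<^sup>i\<close> and \<open>g\<^sub>D = 2 dx\<^sup>i \<circ> dx\<^bsub>i'\<^esub> - 2 x\<^bsub>k'\<^esub> \<Gamma>\<^sub>i\<^sub>j\<^sup>k dx\<^sup>i \<circ> dx\<^sup>j\<close>.  The lemmas
  \<open>complete_lift_iota\<close>, \<open>iota_tensor_complete_lift\<close> and \<open>riemann_extension_complete_lift\<close> below
  are the defining properties of \<open>X\<^sup>C\<close>, \<open>\<iota>T\<close> and \<open>g\<^sub>D\<close>.\<close>

definition iota_tensor ::
  "(real^'n \<Rightarrow> real^'n^'n) \<Rightarrow> real^('n::finite + 'n) \<Rightarrow> real^('n + 'n)" where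
  "iota_tensor T z = (\<chi> s. case s of
     Inl i \<Rightarrow> (\<Sum>k\<in>UNIV. fibre z $ k * T (base z) $ k $ i) | Inr i \<Rightarrow> 0)"

definition riemann_extension ::
  "'n::finite christoffel \<Rightarrow> real^('n + 'n) \<Rightarrow> real^('n + 'n)^('n + 'n)" where
  "riemann_extension \<Gamma> z = (\<chi> s t. case s of
     Inl i \<Rightarrow> (case t of Inl j \<Rightarrow> - 2 * (\<Sum>k\<in>UNIV. fibre z $ k * \<Gamma> (base z) i j k)
                     | Inr j \<Rightarrow> if i = j then 1 else 0)
   | Inr i \<Rightarrow> (case t of Inl j \<Rightarrow> if i = j then 1 else 0 | Inr j \<Rightarrow> 0))"

definition pullback02 ::
  "(real^'n \<Rightarrow> real^'n^'n) \<Rightarrow> real^('n::finite + 'n) \<Rightarrow> real^('n + 'n)^('n + 'n)" where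
  "pullback02 \<Phi> z = (\<chi> s t. case s of
     Inl i \<Rightarrow> (case t of Inl j \<Rightarrow> \<Phi> (base z) $ i $ j | Inr j \<Rightarrow> 0) | Inr i \<Rightarrow> 0)"

definition sym_prod :: "real^'m::finite \<Rightarrow> real^'m \<Rightarrow> real^'m^'m" where
  "sym_prod v w = (\<chi> s t. (v $ s * w $ t + w $ s * v $ t) / 2)"

definition modified_riemann_extension ::
  "('i \<Rightarrow> 'n::finite christoffel) \<Rightarrow> ('i \<Rightarrow> real^'n \<Rightarrow> real^'n^'n) \<Rightarrow> ('i \<Rightarrow> real^'n \<Rightarrow> real^'n^'n)
     \<Rightarrow> 'i \<Rightarrow> real^('n + 'n) \<Rightarrow> real^('n + 'n)^('n + 'n)" where
  "modified_riemann_extension \<Gamma> \<Phi> T a z =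
     sym_prod (iota_tensor (T a) z) (iota_tensor (T a) z)
     + riemann_extension (\<Gamma> a) z + pullback02 (\<Phi> a) z"

lemma modified_riemann_extension_components:
  fixes \<Gamma> :: "'i \<Rightarrow> 'n::finite christoffel"
  shows
  "modified_riemann_extension \<Gamma> \<Phi> T a z $ Inl i $ Inl j =
     1/2 * (\<Sum>r\<in>UNIV. \<Sum>s\<in>UNIV. fibre z $ r * fibre z $ s *
        (T a (base z) $ r $ i * T a (base z) $ s $ j + T a (base z) $ r $ j * T a (base z) $ s $ i))
     - 2 * (\<Sum>k\<in>UNIV. fibre z $ k * \<Gamma> a (base z) i j k) + \<Phi> a (base z) $ i $ j"
  "modified_riemann_extension \<Gamma> \<Phi> T a z $ Inl i $ Inr j = (if i = j then 1 else 0)"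
  "modified_riemann_extension \<Gamma> \<Phi> T a z $ Inr i $ Inl j = (if i = j then 1 else 0)"
  "modified_riemann_extension \<Gamma> \<Phi> T a z $ Inr i $ Inr j = 0"
proof -
  let ?t = "\<lambda>i. \<Sum>k\<in>UNIV. fibre z $ k * T a (base z) $ k $ i"
  let ?S = "\<lambda>i j. \<Sum>r\<in>UNIV. \<Sum>s\<in>UNIV.
    fibre z $ r * fibre z $ s * (T a (base z) $ r $ i * T a (base z) $ s $ j)"
  have 1: "?S i j = ?t i * ?t j" for i j
    by (simp add: sum_product mult_ac)
  have "(\<Sum>r\<in>UNIV. \<Sum>s\<in>UNIV. fibre z $ r * fibre z $ s *
        (T a (base z) $ r $ i * T a (base z) $ s $ j + T a (base z) $ r $ j * T a (base z) $ s $ i))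
     = ?S i j + ?S j i"
    by (simp only: distrib_left sum.distrib)
  then show "modified_riemann_extension \<Gamma> \<Phi> T a z $ Inl i $ Inl j =
     1/2 * (\<Sum>r\<in>UNIV. \<Sum>s\<in>UNIV. fibre z $ r * fibre z $ s *
        (T a (base z) $ r $ i * T a (base z) $ s $ j + T a (base z) $ r $ j * T a (base z) $ s $ i))
     - 2 * (\<Sum>k\<in>UNIV. fibre z $ k * \<Gamma> a (base z) i j k) + \<Phi> a (base z) $ i $ j"
    unfolding 1 by (simp add: modified_riemann_extension_def sym_prod_def iota_tensor_def
      riemann_extension_def pullback02_def)
qed (simp_all add: modified_riemann_extension_def sym_prod_def iota_tensor_def
      riemann_extension_def pullback02_def)

definition iota :: "(real^'n \<Rightarrow> real^'n) \<Rightarrow> real^('n::finite + 'n) \<Rightarrow> real" where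
  "iota X z = fibre z \<bullet> X (base z)"

definition lie_bracket :: "(real^'n \<Rightarrow> real^'n) \<Rightarrow> (real^'n \<Rightarrow> real^'n) \<Rightarrow> real^'n \<Rightarrow> real^'n" where
  "lie_bracket X Y x = frechet_derivative Y (at x) (X x) - frechet_derivative X (at x) (Y x)"

definition cov_vec ::
  "'n::finite christoffel \<Rightarrow> (real^'n \<Rightarrow> real^'n) \<Rightarrow> (real^'n \<Rightarrow> real^'n) \<Rightarrow> real^'n \<Rightarrow> real^'n" where
  "cov_vec \<Gamma> X Y x = frechet_derivative Y (at x) (X x)
     + (\<chi> k. \<Sum>i\<in>UNIV. \<Sum>j\<in>UNIV. \<Gamma> x i j k * X x $ i * Y x $ j)"

definition complete_lift :: "(real^'n \<Rightarrow> real^'n) \<Rightarrow> real^('n::finite + 'n) \<Rightarrow> real^('n + 'n)" where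
  "complete_lift X z =
     induced (X (base z)) (\<chi> i. - (fibre z \<bullet> frechet_derivative X (at (base z)) (axis i 1)))"

lemma sum_UNIV_Plus:
  fixes f :: "'n::finite + 'n \<Rightarrow> real"
  shows "(\<Sum>s\<in>UNIV. f s) = (\<Sum>i\<in>UNIV. f (Inl i)) + (\<Sum>i\<in>UNIV. f (Inr i))"
  by (simp flip: UNIV_Plus_UNIV add: sum.Plus)

lemma inner_Plus:
  fixes v w :: "real^('n::finite + 'n)"
  shows "v \<bullet> w = base v \<bullet> base w + fibre v \<bullet> fibre w"
  unfolding inner_vec_def sum_UNIV_Plus by (simp add: base_def fibre_def)

lemma inner_lambda:
  fixes v :: "real^'n::finite"
  shows "v \<bullet> (\<chi> i. c i) = (\<Sum>i\<in>UNIV. v $ i * c i)" "(\<chi> i. c i) \<bullet> v = (\<Sum>i\<in>UNIV. v $ i * c i)"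
  by (simp_all add: inner_vec_def mult.commute)

lemma frechet_expand:
  fixes X :: "real^'n \<Rightarrow> real^'n::finite"
  assumes "X differentiable at x"
  shows "\<xi> \<bullet> frechet_derivative X (at x) v = 
     (\<Sum>i\<in>UNIV. v $ i * (\<xi> \<bullet> frechet_derivative X (at x) (axis i 1)))"
proof -
  let ?X' = "frechet_derivative X (at x)"
  have lin: "linear ?X'"
    using assms(1) by (simp add: linear_frechet_derivative)
  have "?X' v = (\<Sum>i\<in>UNIV. (v $ i) *\<^sub>R ?X' (axis i 1))"
    by (subst basis_expansion[symmetric]) 
       (simp add: linear_sum[OF lin] linear_scale[OF lin] scalar_mult_eq_scaleR)
  then show ?thesis
    by (simp add: inner_sum_right)
qed

lemma complete_lift_iota:
  fixes X Z :: "real^'n \<Rightarrow> real^'n::finite"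
  assumes "X differentiable at (base z)" "Z differentiable at (base z)"
  shows "(iota Z has_derivative frechet_derivative (iota Z) (at z)) (at z)"
    and "frechet_derivative (iota Z) (at z) (complete_lift X z) = iota (lie_bracket X Z) z"
proof -
  let ?Z' = "frechet_derivative Z (at (base z))"
  have bl: "bounded_linear (base :: real^('n + 'n) \<Rightarrow> _)" "bounded_linear (fibre :: real^('n + 'n) \<Rightarrow> _)"
    by (simp_all add: linear_iff vec_eq_iff base_nth fibre_nth flip: linear_conv_bounded_linear)
  have 1: "(Z has_derivative ?Z') (at (base z))"
    using assms(2) by (simp add: frechet_derivative_works)
  have Zb: "((\<lambda>z. Z (base z)) has_derivative (\<lambda>h. ?Z' (base h))) (at z)"
    using has_derivative_compose[OF bounded_linear_imp_has_derivative[OF bl(1)] 1] .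
  have D: "(iota Z has_derivative (\<lambda>h. fibre z \<bullet> ?Z' (base h) + fibre h \<bullet> Z (base z))) (at z)"
  proof -
    have "iota Z = (\<lambda>z. fibre z \<bullet> Z (base z))"
      by (simp add: fun_eq_iff iota_def)
    then show ?thesis
      using has_derivative_inner[OF bounded_linear_imp_has_derivative[OF bl(2)] Zb] by simp
  qed
  then show "(iota Z has_derivative frechet_derivative (iota Z) (at z)) (at z)"
    unfolding frechet_derivative_at[OF D, symmetric] .
  have "frechet_derivative (iota Z) (at z) (complete_lift X z) =
      fibre z \<bullet> ?Z' (X (base z))
      + (\<chi> i. - (fibre z \<bullet> frechet_derivative X (at (base z)) (axis i 1))) \<bullet> Z (base z)"
    unfolding frechet_derivative_at[OF D, symmetric] complete_lift_def base_induced fibre_induced ..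
  also have "\<dots> = fibre z \<bullet> ?Z' (X (base z)) - fibre z \<bullet> frechet_derivative X (at (base z)) (Z (base z))"
    using frechet_expand[OF assms(1), of "fibre z" "Z (base z)"]
    unfolding inner_lambda mult_minus_right sum_negf by linarith
  finally show "frechet_derivative (iota Z) (at z) (complete_lift X z) = iota (lie_bracket X Z) z"
    unfolding iota_def lie_bracket_def inner_diff_right .
qed

lemma iota_tensor_complete_lift:
  "iota_tensor T z \<bullet> complete_lift X z = iota (\<lambda>x. T x *v X x) z"
proof -
  have "base (iota_tensor T z) = fibre z v* T (base z)" "fibre (iota_tensor T z) = 0"
    by (simp_all add: vec_eq_iff base_nth fibre_nth iota_tensor_def vector_matrix_mult_def mult.commute)
  then show ?thesis
    by (simp add: inner_Plus complete_lift_def iota_def dot_lmul_matrix)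
qed

lemma riemann_extension_complete_lift:
  fixes X Y :: "real^'n \<Rightarrow> real^'n::finite"
  assumes "X differentiable at (base z)" "Y differentiable at (base z)"
    and tf: "\<And>i j k. \<Gamma> (base z) i j k = \<Gamma> (base z) j i k"
  shows "complete_lift X z \<bullet> (riemann_extension \<Gamma> z *v complete_lift Y z) =
    - iota (\<lambda>x. cov_vec \<Gamma> X Y x + cov_vec \<Gamma> Y X x) z"
proof -
  let ?x = "base z" and ?\<xi> = "fibre z"
  let ?q = "\<lambda>X Y. \<Sum>i\<in>UNIV. \<Sum>j\<in>UNIV. \<Sum>k\<in>UNIV. ?\<xi> $ k * \<Gamma> ?x i j k * X ?x $ i * Y ?x $ j"
  have q: "?\<xi> \<bullet> (\<chi> k. \<Sum>i\<in>UNIV. \<Sum>j\<in>UNIV. \<Gamma> ?x i j k * X ?x $ i * Y ?x $ j) = ?q X Y" for X Y :: "real^'n \<Rightarrow> real^'n"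
  proof -
    have "?\<xi> \<bullet> (\<chi> k. \<Sum>i\<in>UNIV. \<Sum>j\<in>UNIV. \<Gamma> ?x i j k * X ?x $ i * Y ?x $ j) =
       (\<Sum>k\<in>UNIV. \<Sum>i\<in>UNIV. \<Sum>j\<in>UNIV. ?\<xi> $ k * \<Gamma> ?x i j k * X ?x $ i * Y ?x $ j)"
      by (simp add: inner_vec_def sum_distrib_left mult.assoc)
    also have "\<dots> = (\<Sum>i\<in>UNIV. \<Sum>k\<in>UNIV. \<Sum>j\<in>UNIV. ?\<xi> $ k * \<Gamma> ?x i j k * X ?x $ i * Y ?x $ j)"
      by (rule sum.swap)
    also have "\<dots> = ?q X Y"
      by (intro sum.cong refl sum.swap)
    finally show ?thesis .
  qed
  have qs: "?q Y X = ?q X Y"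
    by (subst sum.swap) (simp add: tf mult_ac)
  define S where "S i j = (\<Sum>k\<in>UNIV. ?\<xi> $ k * \<Gamma> ?x i j k)" for i j
  have r: "riemann_extension \<Gamma> z $ Inl i $ Inl j = - 2 * S i j"
      "riemann_extension \<Gamma> z $ Inl i $ Inr j = (if i = j then 1 else 0)"
      "riemann_extension \<Gamma> z $ Inr i $ Inl j = (if i = j then 1 else 0)"
      "riemann_extension \<Gamma> z $ Inr i $ Inr j = 0" for i j
    by (simp_all add: riemann_extension_def S_def)
  have R: "base (riemann_extension \<Gamma> z *v w) = (\<chi> i. - 2 * (\<Sum>j\<in>UNIV. S i j * base w $ j)) + fibre w"
      "fibre (riemann_extension \<Gamma> z *v w) = base w" for w
    by (simp_all add: vec_eq_iff base_def fibre_def matrix_vector_mult_def sum_UNIV_Plus r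
        if_distrib[of "\<lambda>c. c * _"] sum_distrib_left mult.assoc sum_negf cong: if_cong)
  have q': "X ?x \<bullet> (\<chi> i. - 2 * (\<Sum>j\<in>UNIV. S i j * Y ?x $ j)) = - 2 * ?q X Y"
    by (simp add: S_def inner_vec_def sum_distrib_left sum_distrib_right mult_ac sum_negf)
  have "complete_lift X z \<bullet> (riemann_extension \<Gamma> z *v complete_lift Y z) =
     - 2 * ?q X Y
     + (\<Sum>i\<in>UNIV. X ?x $ i * - (?\<xi> \<bullet> frechet_derivative Y (at ?x) (axis i 1)))
     + (\<Sum>i\<in>UNIV. Y ?x $ i * - (?\<xi> \<bullet> frechet_derivative X (at ?x) (axis i 1)))"
    unfolding inner_Plus R complete_lift_def base_induced fibre_induced inner_add_right inner_lambda
    by (intro arg_cong2[where f = "(+)"] refl q'[unfolded inner_lambda])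
  also have "\<dots> = - 2 * ?q X Y - ?\<xi> \<bullet> frechet_derivative Y (at ?x) (X ?x) - ?\<xi> \<bullet> frechet_derivative X (at ?x) (Y ?x)"
    using frechet_expand[OF assms(1), of ?\<xi> "Y ?x"] frechet_expand[OF assms(2), of ?\<xi> "X ?x"]
    unfolding mult_minus_right sum_negf by linarith
  also have "\<dots> = - iota (\<lambda>x. cov_vec \<Gamma> X Y x + cov_vec \<Gamma> Y X x) z"
    unfolding iota_def cov_vec_def inner_add_right q[of X Y] q[of Y X] using qs by linarith
  finally show ?thesis .
qed

section \<open>Anti-self-dual metrics\<close>

text \<open>The Levi-Civita connection of a metric \<open>g\<close> given by its matrix in coordinates.\<close>

definition levi_civita :: "(real^'m \<Rightarrow> real^'m^'m) \<Rightarrow> 'm::finite christoffel" where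
  "levi_civita g x i j k = 1/2 * (\<Sum>l\<in>UNIV. matrix_inv (g x) $ k $ l *
     (pd i (\<lambda>y. g y $ j $ l) x + pd j (\<lambda>y. g y $ i $ l) x - pd l (\<lambda>y. g y $ i $ j) x))"

definition scalar_curv :: "(real^'m \<Rightarrow> real^'m^'m) \<Rightarrow> real^'m::finite \<Rightarrow> real" where
  "scalar_curv g x =
     (\<Sum>i\<in>UNIV. \<Sum>j\<in>UNIV. matrix_inv (g x) $ i $ j * ricci (levi_civita g) x $ i $ j)"

text \<open>\<open>riemann g x i j k l = g(R(\<partial>\<^sub>i,\<partial>\<^sub>j)\<partial>\<^sub>k, \<partial>\<^sub>l)\<close>, and \<open>weyl\<close> is its totally trace-free part.\<close>

definition riemann ::
  "(real^'m \<Rightarrow> real^'m^'m) \<Rightarrow> real^'m::finite \<Rightarrow> 'm \<Rightarrow> 'm \<Rightarrow> 'm \<Rightarrow> 'm \<Rightarrow> real" where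
  "riemann g x i j k l = (\<Sum>m\<in>UNIV. curv (levi_civita g) x i j k m * g x $ m $ l)"

definition weyl ::
  "(real^'m \<Rightarrow> real^'m^'m) \<Rightarrow> real^'m::finite \<Rightarrow> 'm \<Rightarrow> 'm \<Rightarrow> 'm \<Rightarrow> 'm \<Rightarrow> real" where
  "weyl g x i j k l =
     (let n = real CARD('m); G = g x; \<rho> = ricci (levi_civita g) x in
      riemann g x i j k l
      - (\<rho> $ j $ k * G $ i $ l - \<rho> $ i $ k * G $ j $ l
         + \<rho> $ i $ l * G $ j $ k - \<rho> $ j $ l * G $ i $ k) / (n - 2)
      + scalar_curv g x * (G $ j $ k * G $ i $ l - G $ i $ k * G $ j $ l) / ((n - 1) * (n - 2)))"

text \<open>Bivectors are skew-symmetric matrices \<open>B\<^sup>i\<^sup>j\<close>.  The Weyl curvature operator is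
  \<open>(W B)\<^sup>k\<^sup>l = 1/2 W\<^sub>i\<^sub>j\<^sup>k\<^sup>l B\<^sup>i\<^sup>j\<close> and the Hodge star is \<open>(* B)\<^sup>k\<^sup>l = 1/2 vol\<^sub>i\<^sub>j\<^sup>k\<^sup>l B\<^sup>i\<^sup>j\<close>, where
  the volume form \<open>vol\<close> stands for the orientation.\<close>

definition bivector :: "real^'m^'m::finite \<Rightarrow> bool" where
  "bivector B \<longleftrightarrow> transpose B = - B"

definition wedge :: "real^'m::finite \<Rightarrow> real^'m \<Rightarrow> real^'m^'m" where
  "wedge u v = (\<chi> i j. u $ i * v $ j - u $ j * v $ i)"

type_synonym 'm fourform = "'m \<Rightarrow> 'm \<Rightarrow> 'm \<Rightarrow> 'm \<Rightarrow> real"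

definition raise_last2 :: "real^'m^'m::finite \<Rightarrow> 'm fourform \<Rightarrow> 'm fourform" where
  "raise_last2 G F i j k l =
     (\<Sum>p\<in>UNIV. \<Sum>q\<in>UNIV. matrix_inv G $ k $ p * matrix_inv G $ l $ q * F i j p q)"

definition bivector_op :: "real^'m^'m::finite \<Rightarrow> 'm fourform \<Rightarrow> real^'m^'m \<Rightarrow> real^'m^'m" where
  "bivector_op G F B =
     (\<chi> k l. 1/2 * (\<Sum>i\<in>UNIV. \<Sum>j\<in>UNIV. raise_last2 G F i j k l * B $ i $ j))"

definition alternating4 :: "'m fourform \<Rightarrow> bool" where
  "alternating4 vol \<longleftrightarrow> (\<forall>i j k l. vol j i k l = - vol i j k l \<and>
     vol i k j l = - vol i j k l \<and> vol i j l k = - vol i j k l)"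

definition volume_form :: "real^'m^'m::finite \<Rightarrow> 'm fourform \<Rightarrow> bool" where
  "volume_form G vol \<longleftrightarrow> alternating4 vol \<and>
     (\<forall>i j k l. distinct [i, j, k, l] \<longrightarrow> (vol i j k l)\<^sup>2 = \<bar>det G\<bar>)"

definition self_dual :: "real^'m^'m::finite \<Rightarrow> 'm fourform \<Rightarrow> real^'m^'m \<Rightarrow> bool" where
  "self_dual G vol B \<longleftrightarrow> bivector B \<and> bivector_op G vol B = B"

text \<open>\<open>W\<^sup>+\<close> is the restriction of the Weyl curvature operator to the self-dual bivectors.\<close>

definition anti_self_dual ::
  "('i, 'p, 'm::finite) atlas \<Rightarrow> ('i \<Rightarrow> real^'m \<Rightarrow> real^'m^'m) \<Rightarrow> ('i \<Rightarrow> real^'m \<Rightarrow> 'm fourform) \<Rightarrow> bool"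
  where
  "anti_self_dual A g vol \<longleftrightarrow>
     (\<forall>a\<in>charts A. \<forall>z\<in>region A a. \<forall>B. self_dual (g a z) (vol a z) B \<longrightarrow>
        bivector_op (g a z) (weyl (g a) z) B = 0)"

text \<open>The orientation of the cotangent bundle of a surface, for a metric with matrix \<open>G\<close> at the
  point under consideration: \<open>u \<and> v\<close> is self-dual for every basis \<open>u, v\<close> of the tangent space of
  the fibre.\<close>

definition vertical :: "real^('n::finite + 'n) \<Rightarrow> bool" where
  "vertical u \<longleftrightarrow> base u = 0"

definition cotangent_vol :: "real^(2 + 2)^(2 + 2) \<Rightarrow> (2 + 2) fourform" where
  "cotangent_vol G = (THE vol. volume_form G vol \<and>
     (\<forall>u v. vertical u \<longrightarrow> vertical v \<longrightarrow> u \<noteq> v \<longrightarrow> independent {u, v} \<longrightarrow>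
        self_dual G vol (wedge u v)))"

lemma cotangent_vol_unique:
  fixes G :: "real^(2 + 2)^(2 + 2)"
  assumes G: "\<And>i j. G $ Inl i $ Inr j = (if i = j then 1 else 0)"
    "\<And>i j. G $ Inr i $ Inl j = (if i = j then 1 else 0)" "\<And>i j. G $ Inr i $ Inr j = 0"
  shows "\<exists>!vol. volume_form G vol \<and>
     (\<forall>u v. vertical u \<longrightarrow> vertical v \<longrightarrow> u \<noteq> v \<longrightarrow> independent {u, v} \<longrightarrow>
        self_dual G vol (wedge u v))"
proof -
  define A where "A i j = G $ Inl i $ Inl j" for i j
  define H :: "real^(2 + 2)^(2 + 2)" where "H = (\<chi> s t. case s of
      Inl i \<Rightarrow> (case t of Inl j \<Rightarrow> 0 | Inr j \<Rightarrow> if i = j then 1 else 0)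
    | Inr i \<Rightarrow> (case t of Inl j \<Rightarrow> if i = j then 1 else 0 | Inr j \<Rightarrow> - A i j))"
  have all_Plus: "(\<forall>s. P s) \<longleftrightarrow> (\<forall>i. P (Inl i)) \<and> (\<forall>i. P (Inr i))" for P :: "2 + 2 \<Rightarrow> bool"
    by (metis sum.exhaust)
  note mats = vec_eq_iff all_Plus matrix_matrix_mult_def sum_UNIV_Plus G mat_def H_def
      A_def[symmetric] sum_2 forall_2
  have GH: "G ** H = mat 1" "H ** G = mat 1"
    by (auto simp: mats)
  have inv: "matrix_inv G = H"
  proof -
    have "matrix_inv G ** G = mat 1"
      unfolding matrix_inv_def by (rule someI2[of _ H]) (use GH in auto)
    then have "(matrix_inv G ** G) ** H = H"
      by (simp only: matrix_mul_lid)
    then show ?thesis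
      by (simp only: matrix_mul_assoc[symmetric] GH(1) matrix_mul_rid)
  qed
  define Q :: "real^(2 + 2)^(2 + 2)" where "Q = (\<chi> s t. case s of
      Inl i \<Rightarrow> (case t of Inl j \<Rightarrow> 0 | Inr j \<Rightarrow> if i = j then 1 else 0)
    | Inr i \<Rightarrow> (case t of Inl j \<Rightarrow> if i = j then - 1 else 0 | Inr j \<Rightarrow> 0))"
  define Q' :: "real^(2 + 2)^(2 + 2)" where "Q' = (\<chi> s t. case s of
      Inl i \<Rightarrow> (case t of Inl j \<Rightarrow> 0 | Inr j \<Rightarrow> if i = j then -1 else 0)
    | Inr i \<Rightarrow> (case t of Inl j \<Rightarrow> if i = j then 1 else 0 | Inr j \<Rightarrow> 0))"
  have "Q ** H ** Q = G" "Q ** Q' = mat 1"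
    by (auto simp: mats Q_def Q'_def)
  then have *: "det Q * det H * det Q = det G" "det Q * det Q' = 1" "det G * det H = 1"
    using GH by (metis det_mul, metis det_mul det_I, metis det_mul det_I)
  have "Q' = transpose Q"
    by (auto simp: mats Q_def Q'_def transpose_def)
  then have "det Q * det Q = 1"
    using *(2) by (simp add: det_transpose)
  then have "det G * det G = 1"
    using * by algebra
  then have detG: "\<bar>det G\<bar> = 1"
    by (metis abs_mult_self_eq abs_one abs_mult power2_eq_1_iff power2_eq_square abs_minus_cancel)
  let ?r1 = "Inr 1 :: 2 + 2" and ?r2 = "Inr 2 :: 2 + 2" and ?l1 = "Inl 1 :: 2 + 2" and ?l2 = "Inl 2 :: 2 + 2"
  have op: "bivector_op G vol (wedge u v) = vol ?r1 ?r2 ?l1 ?l2 *\<^sub>R wedge u v"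
    if vol: "alternating4 vol" and uv: "vertical u" "vertical v" for vol u v
  proof -
    have zero: "vol i i k l = 0" "vol i j j l = 0" "vol i j k k = 0" for i j k l
      using vol unfolding alternating4_def by (smt (verit))+
    have swap: "vol j i k l = - vol i j k l" "vol i k j l = - vol i j k l" "vol i j l k = - vol i j k l" for i j k l
      using vol unfolding alternating4_def by blast+
    have zero': "vol i j i l = 0" "vol i j k i = 0" "vol i j k j = 0" for i j k l
      by (metis swap zero neg_equal_0_iff_equal)+
    have 0: "u $ Inl i = 0" "v $ Inl i = 0" for i
      using uv by (auto simp: vertical_def base_def vec_eq_iff)
    have sw: "vol (Inr 2) (Inr 1) k l = - vol (Inr 1) (Inr 2) k l" "vol i j (Inl 2) (Inl 1) = - vol i j (Inl 1) (Inl 2)" for i j k l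
      by (rule swap)+
    show ?thesis
      by (simp add: vec_eq_iff all_Plus bivector_op_def raise_last2_def inv wedge_def sum_UNIV_Plus
          sum_2 forall_2 H_def 0 zero zero' sw algebra_simps)
  qed
  have sd: "self_dual G vol (wedge u v)"
    if "alternating4 vol" "vol ?r1 ?r2 ?l1 ?l2 = 1" "vertical u" "vertical v" for vol u v
    using op[OF that(1,3,4)] that(2)
    by (simp add: self_dual_def bivector_def wedge_def transpose_def vec_eq_iff)
  have one: "vol ?r1 ?r2 ?l1 ?l2 = 1"
    if alt: "alternating4 vol" and sdv: "\<forall>u v. vertical u \<longrightarrow> vertical v \<longrightarrow> u \<noteq> v \<longrightarrow> independent {u, v} \<longrightarrow>
        self_dual G vol (wedge u v)" for vol
  proof -
    let ?u = "axis ?r1 (1::real)" and ?v = "axis ?r2 (1::real)"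
    have ver: "vertical ?u" "vertical ?v"
      by (auto simp: vertical_def base_def vec_eq_iff axis_def)
    have "?u \<noteq> ?v"
      by (simp add: axis_eq_axis)
    moreover have "independent {?u, ?v}"
      by (rule independent_mono[OF independent_Basis]) auto
    ultimately have "self_dual G vol (wedge ?u ?v)"
      using sdv ver by blast
    then have "vol ?r1 ?r2 ?l1 ?l2 *\<^sub>R wedge ?u ?v = wedge ?u ?v"
      using op[OF alt ver] by (simp add: self_dual_def)
    then have "(vol ?r1 ?r2 ?l1 ?l2 *\<^sub>R wedge ?u ?v) $ ?r1 $ ?r2 = wedge ?u ?v $ ?r1 $ ?r2"
      by simp
    then show ?thesis
      by (simp add: wedge_def axis_def)
  qed
  have uniq: "vol = vol'"
    if alt: "alternating4 vol" "alternating4 vol'" and eq: "vol ?r1 ?r2 ?l1 ?l2 = 1" "vol' ?r1 ?r2 ?l1 ?l2 = 1"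
    for vol vol'
  proof -
    define D where "D i j k l = vol i j k l - vol' i j k l" for i j k l
    have swap: "D j i k l = - D i j k l" "D i k j l = - D i j k l" "D i j l k = - D i j k l" for i j k l
      using alt unfolding alternating4_def D_def by (metis minus_diff_eq diff_minus_eq_add uminus_add_conv_diff minus_diff_minus)+
    have zero: "D i i k l = 0" "D i j j l = 0" "D i j k k = 0" for i j k l
      using swap(1)[of i i k l] swap(2)[of i j j l] swap(3)[of i j k k] by linarith+
    have D0: "D ?r1 ?r2 ?l1 ?l2 = 0"
      using eq by (simp add: D_def)
    have zero': "D i j i l = 0" "D i j k i = 0" "D i j k j = 0" for i j k l
      by (metis swap zero neg_equal_0_iff_equal)+
    have sw: "D ?r2 ?r1 k l = - D ?r1 ?r2 k l" "D ?l1 ?r1 k l = - D ?r1 ?l1 k l" "D ?l2 ?r1 k l = - D ?r1 ?l2 k l"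
       "D ?l1 ?r2 k l = - D ?r2 ?l1 k l" "D ?l2 ?r2 k l = - D ?r2 ?l2 k l" "D ?l2 ?l1 k l = - D ?l1 ?l2 k l"
       "D i ?r2 ?r1 l = - D i ?r1 ?r2 l" "D i ?l1 ?r1 l = - D i ?r1 ?l1 l" "D i ?l2 ?r1 l = - D i ?r1 ?l2 l"
       "D i ?l1 ?r2 l = - D i ?r2 ?l1 l" "D i ?l2 ?r2 l = - D i ?r2 ?l2 l" "D i ?l2 ?l1 l = - D i ?l1 ?l2 l"
       "D i j ?r2 ?r1 = - D i j ?r1 ?r2" "D i j ?l1 ?r1 = - D i j ?r1 ?l1" "D i j ?l2 ?r1 = - D i j ?r1 ?l2"
       "D i j ?l1 ?r2 = - D i j ?r2 ?l1" "D i j ?l2 ?r2 = - D i j ?r2 ?l2" "D i j ?l2 ?l1 = - D i j ?l1 ?l2" for i j k l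
      by (rule swap)+
    have "\<forall>i j k l. D i j k l = 0"
      by (simp only: all_Plus forall_2) (simp add: zero zero' sw D0)
    then show ?thesis
      by (auto simp: D_def fun_eq_iff)
  qed
  define e :: "2 + 2 \<Rightarrow> real" where
    "e s = (case s of Inl i \<Rightarrow> if i = 1 then 3 else 4 | Inr i \<Rightarrow> if i = 1 then 1 else 2)" for s
  define vol0 where "vol0 i j k l =
    sgn (e j - e i) * sgn (e k - e i) * sgn (e l - e i) * sgn (e k - e j) * sgn (e l - e j) * sgn (e l - e k)" for i j k l
  have sgn_swap: "sgn (a - b) = - sgn (b - a)" for a b :: real
    by (metis minus_diff_eq sgn_minus)
  have alt0: "alternating4 vol0"
    unfolding alternating4_def vol0_def
  proof (intro allI conjI, goal_cases)
    case (1 i j k l) show ?case by (subst sgn_swap[of "e i" "e j"]) simp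
  next
    case (2 i j k l) show ?case by (subst sgn_swap[of "e j" "e k"]) simp
  next
    case (3 i j k l) show ?case by (subst sgn_swap[of "e k" "e l"]) simp
  qed
  have "e s \<noteq> e t" if "s \<noteq> t" for s t
  proof -
    have "\<forall>s t. s \<noteq> t \<longrightarrow> e s \<noteq> e t"
      by (simp add: all_Plus forall_2 e_def)
    then show ?thesis using that by blast
  qed
  then have "(sgn (e s - e t))\<^sup>2 = 1" if "s \<noteq> t" for s t
    using that by (simp add: sgn_if)
  then have vol0: "volume_form G vol0"
    using alt0 by (auto simp: volume_form_def vol0_def power_mult_distrib detG)
  have v1: "vol0 ?r1 ?r2 ?l1 ?l2 = 1"
    by (simp add: vol0_def e_def)
  show ?thesis
  proof (rule ex1I[of _ vol0])
    show "volume_form G vol0 \<and> (\<forall>u v. vertical u \<longrightarrow> vertical v \<longrightarrow> u \<noteq> v \<longrightarrow> independent {u, v} \<longrightarrow>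
        self_dual G vol0 (wedge u v))"
      using vol0 sd[OF alt0 v1] by blast
  next
    fix vol assume "volume_form G vol \<and> (\<forall>u v. vertical u \<longrightarrow> vertical v \<longrightarrow> u \<noteq> v \<longrightarrow> independent {u, v} \<longrightarrow>
        self_dual G vol (wedge u v))"
    then show "vol = vol0"
      using uniq one alt0 v1 by (metis volume_form_def)
  qed
qed

corollary cotangent_vol_modified_riemann_extension:
  fixes \<Gamma> :: "'i \<Rightarrow> 2 christoffel" and \<Phi> T :: "'i \<Rightarrow> real^2 \<Rightarrow> real^2^2" and z :: "real^(2 + 2)" and a :: 'i
  defines "g \<equiv> modified_riemann_extension \<Gamma> \<Phi> T a z"
  shows "volume_form g (cotangent_vol g)"
    and "\<lbrakk>vertical u; vertical v; u \<noteq> v; independent {u, v}\<rbrakk>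
      \<Longrightarrow> self_dual g (cotangent_vol g) (wedge u v)"
  using theI'[OF cotangent_vol_unique[of g]]
  unfolding cotangent_vol_def[symmetric] g_def
  by (simp_all add: modified_riemann_extension_components)

end

theory Submission
  imports Defs
begin

text \<open>
  Over a chart of \<open>\<Sigma>\<close> the metric has Walker form: its only block that is not constant is the base block
  \<open>A = \<tau> \<otimes> \<tau> - 2\<gamma> + \<Phi>\<close>, where \<open>\<tau> = \<iota>T\<close> and \<open>\<gamma>\<^sub>i\<^sub>j = x\<^bsub>k'\<^esub> \<Gamma>\<^sub>i\<^sub>j\<^sup>k\<close>.  With the null vectors
  \<open>e\<^sub>i = \<partial>\<^sub>i - 1/2 A\<^sub>i\<^sub>j \<partial>\<^bsub>j'\<^esub>\<close> the self-dual bivectors are spanned by \<open>\<partial>\<^bsub>1'\<^esub> \<and> \<partial>\<^bsub>2'\<^esub>\<close>,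
  \<open>\<partial>\<^sub>1 \<and> \<partial>\<^bsub>1'\<^esub> + \<partial>\<^sub>2 \<and> \<partial>\<^bsub>2'\<^esub>\<close> and \<open>e\<^sub>1 \<and> e\<^sub>2\<close> (\<open>self_dual_iff\<close>).  Since \<open>T\<^sup>2 = 0\<close> and \<open>\<rho>\<close> is symmetric, all
  entries of \<open>W\<^sup>+\<close> in this basis vanish except the one at \<open>(e\<^sub>1 \<and> e\<^sub>2, e\<^sub>1 \<and> e\<^sub>2)\<close> (\<open>weyl_contraction\<close>).

  This last entry is computed in \<open>self_dual_block_eq\<close>.  At a point \<open>x\<close> of \<open>\<Sigma>\<close> write \<open>T = c v \<otimes> \<theta>\<close> with
  \<open>\<theta>(v) = 0\<close>.  As a function on the fibre over \<open>x\<close> the entry is affine: its linear part is the covector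
  applied to the failure of \<open>D\<rho>\<close> to be totally symmetric, and its constant is \<open>1/4 c\<^sup>2 \<Phi>(v,v)\<^sup>2\<close>.  So it
  vanishes on the whole fibre if and only if the Codazzi equation for \<open>\<rho>\<close> holds at \<open>x\<close> and \<open>\<Phi>(v,v) = 0\<close>,
  and the latter is \<open>\<Phi>(TX,TY) = 0\<close>.

  It remains to compare the Codazzi equation with \<open>\<omega> \<circ> T = 0\<close>.  The curvature of \<open>D\<close> commutes with the
  parallel field \<open>T\<close> and is trace-free because \<open>\<rho>\<close> is symmetric, so it is a multiple of \<open>T\<close>.  Hence
  \<open>\<rho> = N \<theta> \<otimes> \<theta>\<close> and \<open>D\<^sub>i\<rho> = s\<^sub>i \<theta> \<otimes> \<theta>\<close>; where \<open>N \<noteq> 0\<close> this gives \<open>\<omega> = s/N\<close>, and the Codazzi equation says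
  that \<open>\<omega>\<close> is a multiple of \<open>\<theta>\<close>, that is \<open>\<omega>(v) = 0\<close> (\<open>hat1_zero_iff\<close>).  From the set where \<open>\<rho> \<noteq> 0\<close> the
  Codazzi equation extends to its closure by continuity, and in the interior of the complement it is
  trivial (\<open>codazzi_ricci_extends\<close>).

  All this needs \<open>T \<noteq> 0\<close> at the point considered.  A parallel field solves a linear ordinary differential
  equation along every curve, so on the connected surface \<open>\<Sigma>\<close> it vanishes nowhere unless it vanishes
  identically (\<open>parallel11_nowhere_zero\<close>).
\<close>

section \<open>Partial derivatives of smooth functions\<close>

lemma pd_eqI:
  assumes "(f has_derivative f') (at x)"
  shows "pd i f x = f' (axis i 1)"
  using frechet_derivative_at[OF assms] by (simp add: pd_def)

lemma pd_cong:
  assumes "open S" "x \<in> S" "\<And>y. y \<in> S \<Longrightarrow> f y = g y"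
  shows "pd i f x = pd i g x"
proof -
  have "(f has_derivative D) (at x) \<longleftrightarrow> (g has_derivative D) (at x)" for D
    using has_derivative_transform_within_open[of f D x UNIV S g]
      has_derivative_transform_within_open[of g D x UNIV S f] assms by auto
  then show ?thesis
    by (simp add: pd_def frechet_derivative_def)
qed

lemma pd_const: "pd i (\<lambda>y. c) x = 0"
  by (simp add: pd_def)

lemma pd_component: "pd i (\<lambda>y. y $ r) x = (if i = r then 1 else 0)"
proof -
  have "((\<lambda>y. y $ r) has_derivative (\<lambda>h. h $ r)) (at x)"
    by (simp add: bounded_linear_imp_has_derivative bounded_linear_vec_nth)
  from pd_eqI[OF this] show ?thesis
    by (simp add: axis_def)
qed

lemma pd_add:
  assumes "f differentiable at x" "g differentiable at x"
  shows "pd i (\<lambda>y. f y + g y) x = pd i f x + pd i g x"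
  using pd_eqI[OF has_derivative_add[OF assms[unfolded frechet_derivative_works]]]
  by (simp add: pd_def)

lemma pd_diff:
  assumes "f differentiable at x" "g differentiable at x"
  shows "pd i (\<lambda>y. f y - g y) x = pd i f x - pd i g x"
  using pd_eqI[OF has_derivative_diff[OF assms[unfolded frechet_derivative_works]]]
  by (simp add: pd_def)

lemma pd_mult:
  fixes f g :: "real^'n \<Rightarrow> real"
  assumes "f differentiable at x" "g differentiable at x"
  shows "pd i (\<lambda>y. f y * g y) x = pd i f x * g x + f x * pd i g x"
  using pd_eqI[OF has_derivative_mult[OF assms[unfolded frechet_derivative_works]]]
  by (simp add: pd_def)

lemma pd_minus:
  assumes "f differentiable at x"
  shows "pd i (\<lambda>y. - f y) x = - pd i f x"
  using pd_diff[of "\<lambda>y. 0" x f i] assms by (simp add: pd_const)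

lemma pd_sum:
  assumes "\<And>i. i \<in> I \<Longrightarrow> f i differentiable at x"
  shows "pd s (\<lambda>y. \<Sum>i\<in>I. f i y) x = (\<Sum>i\<in>I. pd s (f i) x)"
  using assms
  by (induction I rule: infinite_finite_induct) (simp_all add: pd_const pd_add differentiable_sum)

lemma pd_cmult:
  assumes "f differentiable at x"
  shows "pd i (\<lambda>y. c * f y) x = c * pd i f x"
  using assms by (simp add: pd_mult pd_const)

lemma Ck_on_Suc_imp: "Ck_on (Suc k) S f \<Longrightarrow> Ck_on k S f"
  by (induction k arbitrary: f) (auto intro: differentiable_imp_continuous_on)

lemma Ck_on_cong:
  assumes "open S" "\<And>y. y \<in> S \<Longrightarrow> f y = g y" "Ck_on k S f"
  shows "Ck_on k S g"
  using assms(2,3)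
proof (induction k arbitrary: f g)
  case 0
  then show ?case using continuous_on_cong by auto
next
  case (Suc k)
  have "g differentiable_on S"
    unfolding differentiable_on_def
  proof
    fix x assume "x \<in> S"
    then show "g differentiable at x within S"
      using Suc.prems differentiable_transform_within[of f x S 1 g] by (simp add: differentiable_on_def)
  qed
  moreover have "Ck_on k S (pd i g)" for i
  proof (rule Suc.IH)
    show "pd i f y = pd i g y" if "y \<in> S" for y
      by (rule pd_cong[OF assms(1) that Suc.prems(1)])
    show "Ck_on k S (pd i f)"
      using Suc.prems(2) by simp
  qed
  ultimately show ?case by simp
qed

lemma Ck_on_const: "Ck_on k S (\<lambda>y. c)"
proof (induction k arbitrary: c)
  case (Suc k)
  then show ?case by (simp add: pd_const[abs_def])
qed auto

lemma Ck_on_add: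
  assumes "open S" "Ck_on k S f" "Ck_on k S g"
  shows "Ck_on k S (\<lambda>y. f y + g y)"
  using assms(2,3)
proof (induction k arbitrary: f g)
  case 0
  then show ?case by (auto intro: continuous_intros)
next
  case (Suc k)
  have "Ck_on k S (pd i (\<lambda>y. f y + g y))" for i
  proof (rule Ck_on_cong[OF assms(1)])
    show "Ck_on k S (\<lambda>y. pd i f y + pd i g y)"
      using Suc by auto
    show "pd i f y + pd i g y = pd i (\<lambda>y. f y + g y) y" if "y \<in> S" for y
      using Suc.prems that assms(1) by (simp add: pd_add differentiable_on_eq_differentiable_at)
  qed
  then show ?case using Suc.prems by auto
qed

lemma Ck_on_mult:
  assumes "open S" "Ck_on k S f" "Ck_on k S g"
  shows "Ck_on k S (\<lambda>y. f y * g y)"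
  using assms(2,3)
proof (induction k arbitrary: f g)
  case 0
  then show ?case by (auto intro: continuous_intros)
next
  case (Suc k)
  have "Ck_on k S (pd i (\<lambda>y. f y * g y))" for i
  proof (rule Ck_on_cong[OF assms(1)])
    show "Ck_on k S (\<lambda>y. pd i f y * g y + f y * pd i g y)"
      using Suc.prems Suc.prems[THEN Ck_on_Suc_imp] by (intro Ck_on_add[OF assms(1)] Suc.IH) simp_all
    show "pd i f y * g y + f y * pd i g y = pd i (\<lambda>y. f y * g y) y" if "y \<in> S" for y
      using Suc.prems that assms(1) by (simp add: pd_mult differentiable_on_eq_differentiable_at)
  qed
  moreover have "(\<lambda>y. f y * g y) differentiable_on S"
    using Suc.prems by (auto simp: differentiable_on_def intro: differentiable_mult)
  ultimately show ?case by auto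
qed

lemma smooth_on_const: "smooth_on S (\<lambda>y. c)"
  by (simp add: smooth_on_def Ck_on_const)

lemma smooth_on_add: "\<lbrakk>open S; smooth_on S f; smooth_on S g\<rbrakk> \<Longrightarrow> smooth_on S (\<lambda>y. f y + g y)"
  by (simp add: smooth_on_def Ck_on_add)

lemma smooth_on_mult: "\<lbrakk>open S; smooth_on S f; smooth_on S g\<rbrakk> \<Longrightarrow> smooth_on S (\<lambda>y. f y * g y)"
  by (simp add: smooth_on_def Ck_on_mult)

lemma smooth_on_minus: "\<lbrakk>open S; smooth_on S f\<rbrakk> \<Longrightarrow> smooth_on S (\<lambda>y. - f y)"
  using smooth_on_mult[of S "\<lambda>y. -1" f] smooth_on_const[of S "-1"] by simp

lemma smooth_on_diff: "\<lbrakk>open S; smooth_on S f; smooth_on S g\<rbrakk> \<Longrightarrow> smooth_on S (\<lambda>y. f y - g y)"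
  using smooth_on_add[of S f "\<lambda>y. - g y"] smooth_on_minus[of S g] by simp

lemma smooth_on_sum:
  assumes "open S" "\<And>i. i \<in> I \<Longrightarrow> smooth_on S (f i)"
  shows "smooth_on S (\<lambda>y. \<Sum>i\<in>I. f i y)"
  using assms(2)
  by (induction I rule: infinite_finite_induct)
     (auto intro!: smooth_on_const smooth_on_add assms(1))

lemma smooth_on_pd: "smooth_on S f \<Longrightarrow> smooth_on S (pd i f)"
  unfolding smooth_on_def using Ck_on.simps(2) by blast

lemma smooth_on_component: "smooth_on S (\<lambda>y. y $ r)"
  unfolding smooth_on_def
proof
  fix k
  have "(\<lambda>y. y $ r) differentiable_on S"
    by (auto simp: differentiable_on_def intro!: bounded_linear_imp_differentiable bounded_linear_vec_nth)
  then show "Ck_on k S (\<lambda>y. y $ r)"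
    by (cases k) (simp_all add: pd_component Ck_on_const continuous_on_component continuous_on_id pd_component[abs_def])
qed

lemma smooth_on_imp_differentiable:
  assumes "open S" "smooth_on S f" "x \<in> S"
  shows "f differentiable at x"
proof -
  have "Ck_on (Suc 0) S f"
    using assms(2) unfolding smooth_on_def by blast
  then show ?thesis
    using assms by (simp add: differentiable_on_eq_differentiable_at)
qed

lemma smooth_on_imp_continuous_on: "smooth_on S f \<Longrightarrow> continuous_on S f"
  unfolding smooth_on_def using Ck_on.simps(1) by blast

lemma has_real_derivative_segment:
  fixes f :: "real^'n::finite \<Rightarrow> real"
  assumes "f differentiable at (p + t *\<^sub>R d)"
  shows "((\<lambda>t. f (p + t *\<^sub>R d)) has_real_derivative (\<Sum>m\<in>UNIV. d $ m * pd m f (p + t *\<^sub>R d))) (at t)"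
proof -
  let ?D = "frechet_derivative f (at (p + t *\<^sub>R d))"
  note lin = linear_frechet_derivative[OF assms]
  have "(f has_derivative ?D) (at (p + t *\<^sub>R d))"
    using assms by (simp add: frechet_derivative_works)
  moreover have "((\<lambda>t. p + t *\<^sub>R d) has_derivative (\<lambda>h. h *\<^sub>R d)) (at t)"
    by (auto intro!: derivative_eq_intros)
  ultimately have "((\<lambda>t. f (p + t *\<^sub>R d)) has_derivative (\<lambda>h. ?D (h *\<^sub>R d))) (at t)"
    using has_derivative_compose by blast
  moreover have "?D d = (\<Sum>m\<in>UNIV. d $ m * pd m f (p + t *\<^sub>R d))"
  proof -
    have "?D d = ?D (\<Sum>m\<in>UNIV. d $ m *\<^sub>R axis m 1)"
      by (simp add: basis_expansion flip: scalar_mult_eq_scaleR)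
    then show ?thesis
      by (simp add: linear_sum[OF lin] linear_scale[OF lin] pd_def)
  qed
  then have "(\<lambda>h. ?D (h *\<^sub>R d)) = (*) (\<Sum>m\<in>UNIV. d $ m * pd m f (p + t *\<^sub>R d))"
    by (simp add: fun_eq_iff linear_scale[OF lin] mult.commute)
  ultimately show ?thesis
    by (simp add: has_field_derivative_def)
qed

corollary has_real_derivative_line:
  fixes f :: "real^'n::finite \<Rightarrow> real"
  assumes "f differentiable at (p + s *\<^sub>R axis i 1)"
  shows "((\<lambda>s. f (p + s *\<^sub>R axis i 1)) has_real_derivative pd i f (p + s *\<^sub>R axis i 1)) (at s)"
proof -
  have "(\<Sum>m\<in>UNIV. axis i (1::real) $ m * pd m f q) = pd i f q" for q
    by (simp add: axis_def if_distrib[of "\<lambda>c. c * _"] cong: if_cong)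
  then show ?thesis
    using has_real_derivative_segment[OF assms] by simp
qed

text \<open>The mean value theorem, applied first in direction \<open>i\<close> and then in direction \<open>j\<close>.\<close>

lemma second_difference:
  fixes f :: "real^'n \<Rightarrow> real"
  assumes "open S" "smooth_on S f" "h > 0"
    and box: "\<forall>s\<in>{0..h}. \<forall>t\<in>{0..h}. x + s *\<^sub>R axis i 1 + t *\<^sub>R axis j 1 \<in> S"
  obtains s t where "0 < s" "s < h" "0 < t" "t < h"
    "f (x + h *\<^sub>R axis i 1 + h *\<^sub>R axis j 1) - f (x + h *\<^sub>R axis i 1) - f (x + h *\<^sub>R axis j 1) + f x
       = h\<^sup>2 * pd j (pd i f) (x + s *\<^sub>R axis i 1 + t *\<^sub>R axis j 1)"
proof -
  let ?p = "\<lambda>s t. x + s *\<^sub>R axis i 1 + t *\<^sub>R axis j (1::real) :: real^'n"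
  note diff = smooth_on_imp_differentiable[OF assms(1)]
  have S: "?p s t \<in> S" if "0 \<le> s" "s \<le> h" "0 \<le> t" "t \<le> h" for s t
    using box that by simp
  have swap: "?p s t = (x + t *\<^sub>R axis j 1) + s *\<^sub>R axis i 1" for s t
    by (simp add: algebra_simps)
  have d1: "((\<lambda>s. f (?p s t)) has_real_derivative pd i f (?p s t)) (at s)"
    if "0 \<le> s" "s \<le> h" "0 \<le> t" "t \<le> h" for s t
    unfolding swap using diff[OF assms(2) S[OF that]]
    by (intro has_real_derivative_line) (simp add: swap)
  have d2: "((\<lambda>t. pd i f (?p s t)) has_real_derivative pd j (pd i f) (?p s t)) (at t)"
    if "0 \<le> s" "s \<le> h" "0 \<le> t" "t \<le> h" for s t
    using diff[OF smooth_on_pd[OF assms(2)] S[OF that]] by (intro has_real_derivative_line)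
  have "((\<lambda>s. f (?p s h) - f (?p s 0)) has_real_derivative pd i f (?p s h) - pd i f (?p s 0)) (at s)"
    if "0 \<le> s" "s \<le> h" for s
    using that assms(3) by (intro DERIV_diff d1) auto
  from MVT2[OF assms(3) this]
  obtain s where s: "0 < s" "s < h"
    "(f (?p h h) - f (?p h 0)) - (f (?p 0 h) - f (?p 0 0)) = (h - 0) * (pd i f (?p s h) - pd i f (?p s 0))"
    by blast
  from s have "((\<lambda>t. pd i f (?p s t)) has_real_derivative pd j (pd i f) (?p s t)) (at t)"
    if "0 \<le> t" "t \<le> h" for t
    using that by (intro d2) auto
  from MVT2[OF assms(3) this]
  obtain t where t: "0 < t" "t < h" "pd i f (?p s h) - pd i f (?p s 0) = (h - 0) * pd j (pd i f) (?p s t)"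
    by blast
  show thesis
    using that[OF s(1,2) t(1,2)] s(3) t(3) by (simp add: power2_eq_square algebra_simps)
qed

text \<open>Both mixed partial derivatives are limits of the same symmetric second difference quotient.\<close>

lemma pd_commute:
  fixes f :: "real^'n \<Rightarrow> real"
  assumes "open S" "smooth_on S f" "x \<in> S"
  shows "pd i (pd j f) x = pd j (pd i f) x"
proof (rule ccontr)
  assume ne: "pd i (pd j f) x \<noteq> pd j (pd i f) x"
  define e where "e = \<bar>pd i (pd j f) x - pd j (pd i f) x\<bar> / 2"
  have e: "e > 0" using ne by (simp add: e_def)
  have "isCont (pd i (pd j f)) x" "isCont (pd j (pd i f)) x"
    using assms by (meson smooth_on_pd smooth_on_imp_continuous_on continuous_on_eq_continuous_at)+
  then obtain d1 d2 where d: "d1 > 0" "\<And>y. dist y x < d1 \<Longrightarrow> dist (pd i (pd j f) y) (pd i (pd j f) x) < e"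
     "d2 > 0" "\<And>y. dist y x < d2 \<Longrightarrow> dist (pd j (pd i f) y) (pd j (pd i f) x) < e"
    using e unfolding continuous_at_eps_delta by metis
  obtain d3 where d3: "d3 > 0" "ball x d3 \<subseteq> S"
    using assms openE by blast
  define h where "h = min d1 (min d2 d3) / 3"
  have h: "h > 0" "2 * h < d1" "2 * h < d2" "2 * h < d3"
    using d d3 by (auto simp: h_def)
  have near: "dist (x + s *\<^sub>R axis k 1 + t *\<^sub>R axis l 1) x \<le> 2 * h"
    if "0 \<le> s" "s \<le> h" "0 \<le> t" "t \<le> h" for s t and k l :: 'n
  proof -
    have "dist (x + s *\<^sub>R axis k 1 + t *\<^sub>R axis l 1) x = norm (s *\<^sub>R axis k (1::real) + t *\<^sub>R axis l 1)"
      by (simp add: dist_norm algebra_simps)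
    also have "\<dots> \<le> norm (s *\<^sub>R axis k (1::real) :: real^'n) + norm (t *\<^sub>R axis l (1::real) :: real^'n)"
      by (rule norm_triangle_ineq)
    finally show ?thesis using that by simp
  qed
  have S: "\<forall>s\<in>{0..h}. \<forall>t\<in>{0..h}. x + s *\<^sub>R axis k 1 + t *\<^sub>R axis l 1 \<in> S" for k l :: 'n
  proof (intro ballI)
    fix s t assume "s \<in> {0..h}" "t \<in> {0..h}"
    then have "x + s *\<^sub>R axis k 1 + t *\<^sub>R axis l 1 \<in> ball x d3"
      using near[of s t k l] h by (simp add: dist_commute)
    then show "x + s *\<^sub>R axis k 1 + t *\<^sub>R axis l 1 \<in> S"
      using d3 by blast
  qed
  obtain s t where st: "0 < s" "s < h" "0 < t" "t < h"
    "f (x + h *\<^sub>R axis i 1 + h *\<^sub>R axis j 1) - f (x + h *\<^sub>R axis i 1) - f (x + h *\<^sub>R axis j 1) + f x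
       = h\<^sup>2 * pd j (pd i f) (x + s *\<^sub>R axis i 1 + t *\<^sub>R axis j 1)"
    by (rule second_difference[OF assms(1,2) h(1) S])
  obtain s' t' where st': "0 < s'" "s' < h" "0 < t'" "t' < h"
    "f (x + h *\<^sub>R axis j 1 + h *\<^sub>R axis i 1) - f (x + h *\<^sub>R axis j 1) - f (x + h *\<^sub>R axis i 1) + f x
       = h\<^sup>2 * pd i (pd j f) (x + s' *\<^sub>R axis j 1 + t' *\<^sub>R axis i 1)"
    by (rule second_difference[OF assms(1,2) h(1) S])
  let ?p = "x + s *\<^sub>R axis i 1 + t *\<^sub>R axis j 1" and ?q = "x + s' *\<^sub>R axis j 1 + t' *\<^sub>R axis i 1"
  have "h\<^sup>2 * pd j (pd i f) ?p = h\<^sup>2 * pd i (pd j f) ?q"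
    using st(5) st'(5) by (simp add: algebra_simps)
  then have "pd j (pd i f) ?p = pd i (pd j f) ?q"
    using h by simp
  moreover have "dist (pd j (pd i f) ?p) (pd j (pd i f) x) < e"
    using near[of s t i j] st h by (intro d(4)) linarith
  moreover have "dist (pd i (pd j f) ?q) (pd i (pd j f) x) < e"
    using near[of s' t' j i] st' h by (intro d(2)) linarith
  ultimately show False
    by (simp add: dist_real_def e_def) argo
qed

subsection \<open>Functions on the base, pulled back to the cotangent bundle\<close>

lemma bounded_linear_base: "bounded_linear (base :: real^('n::finite + 'n) \<Rightarrow> real^'n)"
  by (simp add: linear_iff vec_eq_iff base_nth flip: linear_conv_bounded_linear)

lemma open_base_vimage:
  assumes "open X"
  shows "open {z :: real^('n::finite + 'n). base z \<in> X}"
  using open_vimage[OF assms linear_continuous_on[OF bounded_linear_base]]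
  by (simp add: vimage_def)

lemma pd_base:
  assumes "f differentiable at (base z)"
  shows "pd s (\<lambda>z. f (base z)) z = (case s of Inl i \<Rightarrow> pd i f (base z) | Inr i \<Rightarrow> 0)"
proof -
  let ?D = "frechet_derivative f (at (base z))"
  have D: "(f has_derivative ?D) (at (base z))"
    using assms by (simp add: frechet_derivative_works)
  have "((\<lambda>z. f (base z)) has_derivative (\<lambda>h. ?D (base h))) (at z)"
    using has_derivative_compose[OF bounded_linear_imp_has_derivative[OF bounded_linear_base] D] .
  from pd_eqI[OF this] have "pd s (\<lambda>z. f (base z)) z = ?D (base (axis s 1))" .
  moreover have "base (axis (Inl i) 1) = axis i (1::real)" "base (axis (Inr i) 1) = (0 :: real^'a)" for i :: 'a
    by (auto simp: vec_eq_iff base_nth axis_def)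
  ultimately show ?thesis
    using linear_0[OF linear_frechet_derivative[OF assms]] by (cases s) (auto simp: pd_def)
qed

lemma Ck_on_base:
  assumes "open X" "Ck_on k X f"
  shows "Ck_on k {z. base z \<in> X} (\<lambda>z. f (base z))"
  using assms(2)
proof (induction k arbitrary: f)
  case 0
  then show ?case
    using continuous_on_compose2[of X f _ base] linear_continuous_on[OF bounded_linear_base] by force
next
  case (Suc k)
  have d: "f differentiable at (base z)" if "base z \<in> X" for z
    using Suc.prems that assms(1) by (simp add: differentiable_on_eq_differentiable_at)
  have "(\<lambda>z. f (base z)) differentiable at z" if "base z \<in> X" for z
    using differentiable_chain_at[OF bounded_linear_imp_differentiable[OF bounded_linear_base] d[OF that]]
    by (simp add: o_def)
  then have "(\<lambda>z. f (base z)) differentiable_on {z. base z \<in> X}"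
    by (simp add: differentiable_on_eq_differentiable_at open_base_vimage assms(1))
  moreover have "Ck_on k {z. base z \<in> X} (pd s (\<lambda>z. f (base z)))" for s
  proof (rule Ck_on_cong[OF open_base_vimage[OF assms(1)]])
    show "Ck_on k {z. base z \<in> X} (\<lambda>z. case s of Inl i \<Rightarrow> pd i f (base z) | Inr i \<Rightarrow> 0)"
      using Suc by (cases s) (auto simp: Ck_on_const)
  qed (auto simp: pd_base d)
  ultimately show ?case by simp
qed

lemma smooth_on_base: "\<lbrakk>open X; smooth_on X f\<rbrakk> \<Longrightarrow> smooth_on {z. base z \<in> X} (\<lambda>z. f (base z))"
  by (simp add: smooth_on_def Ck_on_base)

section \<open>Curvature in terms of Christoffel symbols of the first kind\<close>

definition christoffel1 :: "(real^'m \<Rightarrow> real^'m^'m) \<Rightarrow> real^'m::finite \<Rightarrow> 'm \<Rightarrow> 'm \<Rightarrow> 'm \<Rightarrow> real" where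
  "christoffel1 g x i j l =
     1/2 * (pd i (\<lambda>y. g y $ j $ l) x + pd j (\<lambda>y. g y $ i $ l) x - pd l (\<lambda>y. g y $ i $ j) x)"

lemma matrix_inv_right:
  assumes "invertible (M :: real^'m^'m)"
  shows "M ** matrix_inv M = mat 1"
  using assms unfolding invertible_def matrix_inv_def by (rule someI2_ex) blast

lemma levi_civita_christoffel1:
  "levi_civita g x i j k = (\<Sum>l\<in>UNIV. matrix_inv (g x) $ k $ l * christoffel1 g x i j l)"
  by (simp add: levi_civita_def christoffel1_def sum_distrib_left algebra_simps)

lemma lower_levi_civita:
  assumes "invertible (g x)" and sym: "\<And>i j. g x $ i $ j = g x $ j $ i"
  shows "(\<Sum>m\<in>UNIV. levi_civita g x i j m * g x $ m $ l) = christoffel1 g x i j l"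
proof -
  have inv: "(g x ** matrix_inv (g x)) $ l $ p = (if l = p then 1 else 0)" for p
    using matrix_inv_right[OF assms(1)] by (simp add: mat_def)
  have "(\<Sum>m\<in>UNIV. levi_civita g x i j m * g x $ m $ l) =
     (\<Sum>m\<in>UNIV. \<Sum>p\<in>UNIV. g x $ l $ m * matrix_inv (g x) $ m $ p * christoffel1 g x i j p)"
    by (simp add: levi_civita_christoffel1 sum_distrib_right sum_distrib_left sym[of l] mult_ac)
  also have "\<dots> = (\<Sum>p\<in>UNIV. \<Sum>m\<in>UNIV. g x $ l $ m * matrix_inv (g x) $ m $ p * christoffel1 g x i j p)"
    by (rule sum.swap)
  also have "\<dots> = (\<Sum>p\<in>UNIV. (g x ** matrix_inv (g x)) $ l $ p * christoffel1 g x i j p)"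
    by (simp add: matrix_matrix_mult_def sum_distrib_right)
  also have "\<dots> = christoffel1 g x i j l"
    by (simp add: inv if_distrib[of "\<lambda>c. c * _"] cong: if_cong)
  finally show ?thesis .
qed

text \<open>In this form only the metric, its first and its second derivatives occur: lowering the index
  before differentiating absorbs the derivatives of the inverse metric.\<close>

lemma riemann_christoffel1:
  assumes U: "open U" "x \<in> U"
    and inv: "\<And>y. y \<in> U \<Longrightarrow> invertible (g y)"
    and sym: "\<And>y i j. y \<in> U \<Longrightarrow> g y $ i $ j = g y $ j $ i"
    and dg: "\<And>i j. (\<lambda>y. g y $ i $ j) differentiable at x"
    and dL: "\<And>i j k. (\<lambda>y. levi_civita g y i j k) differentiable at x"
  shows "riemann g x i j k l =
     pd i (\<lambda>y. christoffel1 g y j k l) x - pd j (\<lambda>y. christoffel1 g y i k l) x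
     - (\<Sum>m\<in>UNIV. levi_civita g x j k m * christoffel1 g x i l m)
     + (\<Sum>m\<in>UNIV. levi_civita g x i k m * christoffel1 g x j l m)"
proof -
  let ?L = "\<lambda>i j k. levi_civita g x i j k" and ?c = "\<lambda>i j k. christoffel1 g x i j k"
  have low: "(\<Sum>m\<in>UNIV. ?L i j m * g x $ m $ l) = ?c i j l" for i j l
    by (rule lower_levi_civita) (use U inv sym in auto)
  have pdg: "pd i (\<lambda>y. g y $ m $ l) x = ?c i m l + ?c i l m" for i m l
  proof -
    have "pd n (\<lambda>y. g y $ p $ q) x = pd n (\<lambda>y. g y $ q $ p) x" for n p q
      by (rule pd_cong[OF U]) (rule sym)
    from this[of m i l] this[of i l m] this[of l i m] show ?thesis
      by (simp add: christoffel1_def field_simps)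
  qed
  have *: "(\<Sum>m\<in>UNIV. pd i (\<lambda>y. levi_civita g y j k m) x * g x $ m $ l) =
     pd i (\<lambda>y. christoffel1 g y j k l) x - (\<Sum>m\<in>UNIV. ?L j k m * ?c i m l) - (\<Sum>m\<in>UNIV. ?L j k m * ?c i l m)"
    for i j k
  proof -
    have "pd i (\<lambda>y. christoffel1 g y j k l) x =
        pd i (\<lambda>y. \<Sum>m\<in>UNIV. levi_civita g y j k m * g y $ m $ l) x"
      by (rule pd_cong[OF U], rule lower_levi_civita[symmetric]) (use inv sym in auto)
    also have "\<dots> = (\<Sum>m\<in>UNIV. pd i (\<lambda>y. levi_civita g y j k m) x * g x $ m $ l
         + ?L j k m * (?c i m l + ?c i l m))"
      by (simp add: pd_sum pd_mult dg dL differentiable_mult pdg)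
    finally show ?thesis
      by (simp add: sum.distrib distrib_left)
  qed
  have **: "(\<Sum>m\<in>UNIV. (\<Sum>p\<in>UNIV. ?L j k p * ?L i p m) * g x $ m $ l) = (\<Sum>p\<in>UNIV. ?L j k p * ?c i p l)" for i j k
  proof -
    have "(\<Sum>m\<in>UNIV. (\<Sum>p\<in>UNIV. ?L j k p * ?L i p m) * g x $ m $ l) =
       (\<Sum>m\<in>UNIV. \<Sum>p\<in>UNIV. ?L j k p * (?L i p m * g x $ m $ l))"
      by (simp add: sum_distrib_right mult.assoc)
    also have "\<dots> = (\<Sum>p\<in>UNIV. \<Sum>m\<in>UNIV. ?L j k p * (?L i p m * g x $ m $ l))"
      by (rule sum.swap)
    finally show ?thesis
      by (simp add: low flip: sum_distrib_left)
  qed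
  have "riemann g x i j k l = (\<Sum>m\<in>UNIV. pd i (\<lambda>y. levi_civita g y j k m) x * g x $ m $ l)
      - (\<Sum>m\<in>UNIV. pd j (\<lambda>y. levi_civita g y i k m) x * g x $ m $ l)
      + (\<Sum>m\<in>UNIV. (\<Sum>p\<in>UNIV. ?L j k p * ?L i p m) * g x $ m $ l)
      - (\<Sum>m\<in>UNIV. (\<Sum>p\<in>UNIV. ?L i k p * ?L j p m) * g x $ m $ l)"
    by (simp add: riemann_def curv_def sum.distrib sum_subtractf distrib_right left_diff_distrib)
  then show ?thesis
    by (simp add: * **)
qed

lemma ricci_riemann:
  assumes "invertible (g x)"
  shows "ricci (levi_civita g) x $ j $ k =
     (\<Sum>i\<in>UNIV. \<Sum>l\<in>UNIV. riemann g x i j k l * matrix_inv (g x) $ l $ i)"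
proof -
  have inv: "(g x ** matrix_inv (g x)) $ m $ i = (if m = i then 1 else 0)" for m i
    using matrix_inv_right[OF assms(1)] by (simp add: mat_def)
  have "curv (levi_civita g) x i j k i = (\<Sum>l\<in>UNIV. riemann g x i j k l * matrix_inv (g x) $ l $ i)" for i
  proof -
    have "(\<Sum>l\<in>UNIV. riemann g x i j k l * matrix_inv (g x) $ l $ i) =
        (\<Sum>l\<in>UNIV. \<Sum>m\<in>UNIV. curv (levi_civita g) x i j k m * (g x $ m $ l * matrix_inv (g x) $ l $ i))"
      by (simp add: riemann_def sum_distrib_right mult.assoc)
    also have "\<dots> = (\<Sum>m\<in>UNIV. \<Sum>l\<in>UNIV. curv (levi_civita g) x i j k m * (g x $ m $ l * matrix_inv (g x) $ l $ i))"
      by (rule sum.swap)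
    also have "\<dots> = (\<Sum>m\<in>UNIV. curv (levi_civita g) x i j k m * (g x ** matrix_inv (g x)) $ m $ i)"
      by (simp add: matrix_matrix_mult_def sum_distrib_left)
    finally show ?thesis
      by (simp add: inv if_distrib[of "\<lambda>c. _ * c"] cong: if_cong)
  qed
  then show ?thesis
    by (simp add: ricci_def)
qed

text \<open>Raising two indices is the injective map \<open>N \<mapsto> G\<^sup>-\<^sup>1 N G\<^sup>-\<^sup>T\<close>.\<close>

lemma bivector_op_eq_0_iff:
  assumes "invertible G"
  shows "bivector_op G F B = 0 \<longleftrightarrow> (\<forall>p q. (\<Sum>i\<in>UNIV. \<Sum>j\<in>UNIV. F i j p q * B $ i $ j) = 0)"
proof -
  define N where "N = (\<chi> p q. \<Sum>i\<in>UNIV. \<Sum>j\<in>UNIV. F i j p q * B $ i $ j)"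
  let ?I = "matrix_inv G"
  have op: "bivector_op G F B $ k $ l = 1/2 * (?I ** N ** transpose ?I) $ k $ l" for k l
  proof -
    have "(?I ** N ** transpose ?I) $ k $ l =
        (\<Sum>q\<in>UNIV. \<Sum>p\<in>UNIV. \<Sum>i\<in>UNIV. \<Sum>j\<in>UNIV. ?I $ k $ p * ?I $ l $ q * F i j p q * B $ i $ j)"
      by (simp add: matrix_matrix_mult_def transpose_def N_def sum_distrib_left sum_distrib_right mult_ac)
    also have "\<dots> = (\<Sum>q\<in>UNIV. \<Sum>i\<in>UNIV. \<Sum>j\<in>UNIV. \<Sum>p\<in>UNIV. ?I $ k $ p * ?I $ l $ q * F i j p q * B $ i $ j)"
      by (rule sum.cong[OF refl], subst sum.swap, rule sum.cong[OF refl], rule sum.swap)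
    also have "\<dots> = (\<Sum>i\<in>UNIV. \<Sum>j\<in>UNIV. \<Sum>q\<in>UNIV. \<Sum>p\<in>UNIV. ?I $ k $ p * ?I $ l $ q * F i j p q * B $ i $ j)"
      by (subst sum.swap, rule sum.cong[OF refl], rule sum.swap)
    also have "\<dots> = (\<Sum>i\<in>UNIV. \<Sum>j\<in>UNIV. \<Sum>p\<in>UNIV. \<Sum>q\<in>UNIV. ?I $ k $ p * ?I $ l $ q * F i j p q * B $ i $ j)"
      by (rule sum.cong[OF refl], rule sum.cong[OF refl], rule sum.swap)
    finally show ?thesis
      by (simp add: bivector_op_def raise_last2_def sum_distrib_right mult.assoc)
  qed
  have "N = G ** (?I ** N ** transpose ?I) ** transpose G"
  proof -
    have "G ** (?I ** N ** transpose ?I) ** transpose G = (G ** ?I) ** N ** transpose (G ** ?I)"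
      by (simp add: matrix_mul_assoc matrix_transpose_mul)
    then show ?thesis
      using matrix_inv_right[OF assms] by (simp add: transpose_mat)
  qed
  then have "?I ** N ** transpose ?I = 0 \<longleftrightarrow> N = 0"
    by (metis times0_left times0_right)
  then show ?thesis
    by (simp add: op N_def vec_eq_iff)
qed

section \<open>Curvature of Walker metrics\<close>

lemma forall_Plus: "(\<forall>s :: 'n + 'n. P s) \<longleftrightarrow> (\<forall>i. P (Inl i)) \<and> (\<forall>i. P (Inr i))"
  by (metis sum.exhaust)

text \<open>The metrics \<open>2 dx\<^sup>i \<circ> dx\<^bsub>i'\<^esub> + A\<^sub>i\<^sub>j dx\<^sup>i \<circ> dx\<^sup>j\<close>, for which the fibres \<open>x = const\<close> are null of half the
  dimension.  The set \<open>U\<close> is where \<open>A\<close> is symmetric and smooth.\<close>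

locale walker =
  fixes g :: "real^('n::finite + 'n) \<Rightarrow> real^('n + 'n)^('n + 'n)"
    and A :: "'n \<Rightarrow> 'n \<Rightarrow> real^('n + 'n) \<Rightarrow> real"
    and U :: "(real^('n + 'n)) set"
  assumes open_U: "open U"
    and g_LL: "\<And>z i j. g z $ Inl i $ Inl j = A i j z"
    and g_LR: "\<And>z i j. g z $ Inl i $ Inr j = (if i = j then 1 else 0)"
    and g_RL: "\<And>z i j. g z $ Inr i $ Inl j = (if i = j then 1 else 0)"
    and g_RR: "\<And>z i j. g z $ Inr i $ Inr j = 0"
    and A_sym: "\<And>z i j. z \<in> U \<Longrightarrow> A i j z = A j i z"
    and A_smooth: "\<And>i j. smooth_on U (A i j)"
begin

lemmas g_simps = g_LL g_LR g_RL g_RR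

lemma g_inverse: "g z ** (\<chi> s t. case s of
      Inl i \<Rightarrow> (case t of Inl j \<Rightarrow> 0 | Inr j \<Rightarrow> if i = j then 1 else 0)
    | Inr i \<Rightarrow> (case t of Inl j \<Rightarrow> if i = j then 1 else 0 | Inr j \<Rightarrow> - A i j z)) = mat 1"
  by (simp add: vec_eq_iff forall_Plus matrix_matrix_mult_def sum_UNIV_Plus g_simps mat_def sum_negf
      if_distrib[of "\<lambda>c. c * _"] if_distrib[of "\<lambda>c. _ * c"] cong: if_cong)

lemma g_invertible: "invertible (g z)"
  using g_inverse invertible_right_inverse by blast

lemma matrix_inv_g:
  "matrix_inv (g z) $ Inl i $ Inl j = 0"
  "matrix_inv (g z) $ Inl i $ Inr j = (if i = j then 1 else 0)"
  "matrix_inv (g z) $ Inr i $ Inl j = (if i = j then 1 else 0)"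
  "matrix_inv (g z) $ Inr i $ Inr j = - A i j z"
proof -
  let ?H = "(\<chi> s t. case s of
      Inl i \<Rightarrow> (case t of Inl j \<Rightarrow> 0 | Inr j \<Rightarrow> if i = j then 1 else 0)
    | Inr i \<Rightarrow> (case t of Inl j \<Rightarrow> if i = j then 1 else 0 | Inr j \<Rightarrow> - A i j z)) :: real^('n + 'n)^('n + 'n)"
  have "matrix_inv (g z) ** g z = mat 1"
    using matrix_inv_right[OF g_invertible] matrix_left_right_inverse by blast
  then have "matrix_inv (g z) = matrix_inv (g z) ** (g z ** ?H)"
    by (simp add: g_inverse)
  also have "\<dots> = ?H"
    using \<open>matrix_inv (g z) ** g z = mat 1\<close> by (simp only: matrix_mul_assoc matrix_mul_lid)
  finally have H: "matrix_inv (g z) = ?H" .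
  show "matrix_inv (g z) $ Inl i $ Inl j = 0"
    "matrix_inv (g z) $ Inl i $ Inr j = (if i = j then 1 else 0)"
    "matrix_inv (g z) $ Inr i $ Inl j = (if i = j then 1 else 0)"
    "matrix_inv (g z) $ Inr i $ Inr j = - A i j z"
    by (simp_all add: H)
qed

lemma g_sym: "z \<in> U \<Longrightarrow> g z $ s $ t = g z $ t $ s"
  using A_sym by (cases s; cases t) (auto simp: g_simps)

lemma A_differentiable: "z \<in> U \<Longrightarrow> A i j differentiable at z"
  using smooth_on_imp_differentiable[OF open_U A_smooth] .

lemma pd_A_differentiable: "z \<in> U \<Longrightarrow> pd s (A i j) differentiable at z"
  using smooth_on_imp_differentiable[OF open_U smooth_on_pd[OF A_smooth]] .

lemma pd_A_sym: "z \<in> U \<Longrightarrow> pd s (A i j) z = pd s (A j i) z"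
  by (rule pd_cong[OF open_U]) (auto intro: A_sym)

lemma pd_pd_A_sym: "z \<in> U \<Longrightarrow> pd s (pd t (A i j)) z = pd s (pd t (A j i)) z"
  by (rule pd_cong[OF open_U]) (auto intro: pd_A_sym)

lemma pd_pd_A_commute: "z \<in> U \<Longrightarrow> pd s (pd t (A i j)) z = pd t (pd s (A i j)) z"
  by (rule pd_commute[OF open_U A_smooth])

lemma christoffel1_g:
  "christoffel1 g z (Inl i) (Inl j) (Inl k) =
     1/2 * (pd (Inl i) (A j k) z + pd (Inl j) (A i k) z - pd (Inl k) (A i j) z)"
  "christoffel1 g z (Inl i) (Inl j) (Inr k) = - 1/2 * pd (Inr k) (A i j) z"
  "christoffel1 g z (Inl i) (Inr j) (Inl k) = 1/2 * pd (Inr j) (A i k) z"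
  "christoffel1 g z (Inr i) (Inl j) (Inl k) = 1/2 * pd (Inr i) (A j k) z"
  "christoffel1 g z (Inl i) (Inr j) (Inr k) = 0"
  "christoffel1 g z (Inr i) (Inl j) (Inr k) = 0"
  "christoffel1 g z (Inr i) (Inr j) s = 0"
proof -
  show "christoffel1 g z (Inr i) (Inr j) s = 0"
    by (cases s) (simp_all add: christoffel1_def g_simps pd_const)
qed (simp_all add: christoffel1_def g_simps pd_const)

lemma levi_civita_g:
  "levi_civita g z (Inl i) (Inl j) (Inl k) = - 1/2 * pd (Inr k) (A i j) z"
  "levi_civita g z (Inl i) (Inl j) (Inr k) =
     1/2 * (pd (Inl i) (A j k) z + pd (Inl j) (A i k) z - pd (Inl k) (A i j) z)
     + 1/2 * (\<Sum>m\<in>UNIV. A k m z * pd (Inr m) (A i j) z)"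
  "levi_civita g z (Inl i) (Inr j) (Inl k) = 0"
  "levi_civita g z (Inr i) (Inl j) (Inl k) = 0"
  "levi_civita g z (Inl i) (Inr j) (Inr k) = 1/2 * pd (Inr j) (A i k) z"
  "levi_civita g z (Inr i) (Inl j) (Inr k) = 1/2 * pd (Inr i) (A j k) z"
  "levi_civita g z (Inr i) (Inr j) s = 0"
proof -
  note simps = levi_civita_christoffel1 sum_UNIV_Plus christoffel1_g matrix_inv_g
    sum_distrib_left sum_negf if_distrib[of "\<lambda>c. c * _"] if_distrib[of "\<lambda>c. c / 2"]
  show "levi_civita g z (Inr i) (Inr j) s = 0"
    by (simp add: simps)
  show "levi_civita g z (Inl i) (Inl j) (Inl k) = - 1/2 * pd (Inr k) (A i j) z"
    "levi_civita g z (Inl i) (Inr j) (Inl k) = 0"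
    "levi_civita g z (Inr i) (Inl j) (Inl k) = 0"
    "levi_civita g z (Inl i) (Inr j) (Inr k) = 1/2 * pd (Inr j) (A i k) z"
    "levi_civita g z (Inr i) (Inl j) (Inr k) = 1/2 * pd (Inr i) (A j k) z"
    by (simp_all add: simps cong: if_cong)
  show "levi_civita g z (Inl i) (Inl j) (Inr k) =
     1/2 * (pd (Inl i) (A j k) z + pd (Inl j) (A i k) z - pd (Inl k) (A i j) z)
     + 1/2 * (\<Sum>m\<in>UNIV. A k m z * pd (Inr m) (A i j) z)"
    by (simp add: simps cong: if_cong)
qed

lemma levi_civita_g_differentiable:
  assumes "z \<in> U"
  shows "(\<lambda>y. levi_civita g y s t r) differentiable at z"
  using assms
  by (cases s; cases t; cases r; simp add: levi_civita_g A_differentiable pd_A_differentiable)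

lemma riemann_g:
  assumes "z \<in> U"
  shows "riemann g z s t u v =
     pd s (\<lambda>y. christoffel1 g y t u v) z - pd t (\<lambda>y. christoffel1 g y s u v) z
     - (\<Sum>m\<in>UNIV. levi_civita g z t u m * christoffel1 g z s v m)
     + (\<Sum>m\<in>UNIV. levi_civita g z s u m * christoffel1 g z t v m)"
proof (rule riemann_christoffel1[OF open_U assms])
  show "(\<lambda>y. g y $ i $ j) differentiable at z" for i j
    using A_differentiable[OF assms] by (cases i; cases j) (simp_all add: g_simps)
qed (simp_all add: g_invertible g_sym levi_civita_g_differentiable assms)

lemma pd_christoffel1_g:
  assumes "z \<in> U"
  shows "pd s (\<lambda>z. christoffel1 g z (Inl i) (Inl j) (Inl k)) z =
     1/2 * (pd s (pd (Inl i) (A j k)) z + pd s (pd (Inl j) (A i k)) z - pd s (pd (Inl k) (A i j)) z)"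
  "pd s (\<lambda>z. christoffel1 g z (Inl i) (Inl j) (Inr k)) z = - 1/2 * pd s (pd (Inr k) (A i j)) z"
  "pd s (\<lambda>z. christoffel1 g z (Inl i) (Inr j) (Inl k)) z = 1/2 * pd s (pd (Inr j) (A i k)) z"
  "pd s (\<lambda>z. christoffel1 g z (Inr i) (Inl j) (Inl k)) z = 1/2 * pd s (pd (Inr i) (A j k)) z"
  "pd s (\<lambda>z. christoffel1 g z (Inl i) (Inr j) (Inr k)) z = 0"
  "pd s (\<lambda>z. christoffel1 g z (Inr i) (Inl j) (Inr k)) z = 0"
  "pd s (\<lambda>z. christoffel1 g z (Inr i) (Inr j) t) z = 0"
  by (simp_all only: christoffel1_g pd_const pd_cmult pd_add pd_diff differentiable_add differentiable_diff
      pd_A_differentiable[OF assms])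

text \<open>Below, a prime stands for an index \<open>Inr i\<close>, as in \<open>x\<^bsub>i'\<^esub>\<close>.  No quadratic terms occur: the first-kind
  symbols \<open>[ij',m]\<close> vanish for primed \<open>m\<close>, and the inverse metric vanishes on pairs of unprimed indices.  This leaves second derivatives of \<open>A\<close>
  along the fibres.\<close>

lemma riemann_two_primes:
  assumes "z \<in> U"
  shows "riemann g z (Inr i) (Inr j) u v = 0"
    "riemann g z u v (Inr i) (Inr j) = 0"
    "riemann g z (Inl i) (Inr j) (Inl k) (Inr l) = 1/2 * pd (Inr j) (pd (Inr l) (A i k)) z"
    "riemann g z (Inl i) (Inr j) (Inr l) (Inl k) = - 1/2 * pd (Inr j) (pd (Inr l) (A i k)) z"
    "riemann g z (Inr j) (Inl i) (Inl k) (Inr l) = - 1/2 * pd (Inr j) (pd (Inr l) (A i k)) z"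
    "riemann g z (Inr j) (Inl i) (Inr l) (Inl k) = 1/2 * pd (Inr j) (pd (Inr l) (A i k)) z"
proof -
  note unfold1 = forall_Plus riemann_g[OF assms] pd_christoffel1_g[OF assms] sum_UNIV_Plus
  note unfold2 = christoffel1_g levi_civita_g
  have "\<forall>u v. riemann g z (Inr i) (Inr j) u v = 0 \<and> riemann g z u v (Inr i) (Inr j) = 0"
    by (simp only: unfold1) (simp add: unfold2 pd_pd_A_commute[OF assms, of "Inr j" "Inr i"] mult.commute)
  then show "riemann g z (Inr i) (Inr j) u v = 0" "riemann g z u v (Inr i) (Inr j) = 0"
    by blast+
  show "riemann g z (Inl i) (Inr j) (Inl k) (Inr l) = 1/2 * pd (Inr j) (pd (Inr l) (A i k)) z"
    "riemann g z (Inl i) (Inr j) (Inr l) (Inl k) = - 1/2 * pd (Inr j) (pd (Inr l) (A i k)) z"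
    "riemann g z (Inr j) (Inl i) (Inl k) (Inr l) = - 1/2 * pd (Inr j) (pd (Inr l) (A i k)) z"
    "riemann g z (Inr j) (Inl i) (Inr l) (Inl k) = 1/2 * pd (Inr j) (pd (Inr l) (A i k)) z"
    by ((simp only: unfold1)?, simp add: unfold2)+
qed

text \<open>The quadratic terms reduce to products of fibre derivatives of \<open>A\<close>, because the inverse metric pairs
  the symbol \<open>[kl,m']\<close> with \<open>[ij',m]\<close> only.  The common value \<open>C\<close> exhibits the pair symmetry of the
  curvature.\<close>

lemma riemann_one_prime:
  assumes "z \<in> U"
  defines "C \<equiv> \<lambda>k l i j. - 1/2 * (pd (Inl k) (pd (Inr j) (A l i)) z - pd (Inl l) (pd (Inr j) (A k i)) z)
     + 1/4 * (\<Sum>m\<in>UNIV. pd (Inr m) (A l i) z * pd (Inr j) (A k m) z - pd (Inr m) (A k i) z * pd (Inr j) (A l m) z)"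
  shows "riemann g z (Inl k) (Inl l) (Inl i) (Inr j) = C k l i j"
    "riemann g z (Inl k) (Inl l) (Inr j) (Inl i) = - C k l i j"
    "riemann g z (Inl i) (Inr j) (Inl k) (Inl l) = C k l i j"
    "riemann g z (Inr j) (Inl i) (Inl k) (Inl l) = - C k l i j"
proof -
  note unfold1 = riemann_g[OF assms(1)] pd_christoffel1_g[OF assms(1)] sum_UNIV_Plus
  note unfold2 = christoffel1_g levi_civita_g C_def sum_subtractf sum_distrib_left
    pd_pd_A_commute[OF assms(1), of "Inr j" "Inl _"]
  note sym = pd_A_sym[OF assms(1)] pd_pd_A_sym[OF assms(1)]
  show "riemann g z (Inl k) (Inl l) (Inl i) (Inr j) = C k l i j"
    "riemann g z (Inl k) (Inl l) (Inr j) (Inl i) = - C k l i j"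
    "riemann g z (Inl i) (Inr j) (Inl k) (Inl l) = C k l i j"
    "riemann g z (Inr j) (Inl i) (Inl k) (Inl l) = - C k l i j"
    using sym by ((simp only: unfold1)?, simp add: unfold2 sum_negf, simp add: field_simps flip: sum_divide_distrib)+
qed

lemma riemann_one_prime_flip:
  assumes "z \<in> U"
  shows "riemann g z (Inl k) (Inl l) (Inr j) (Inl i) = - riemann g z (Inl k) (Inl l) (Inl i) (Inr j)"
    "riemann g z (Inl i) (Inr j) (Inl k) (Inl l) = riemann g z (Inl k) (Inl l) (Inl i) (Inr j)"
    "riemann g z (Inr j) (Inl i) (Inl k) (Inl l) = riemann g z (Inl l) (Inl k) (Inl i) (Inr j)"
  by (simp_all add: riemann_one_prime[OF assms] sum_subtractf field_simps)

end

section \<open>Self-dual Weyl curvature of four-dimensional Walker metrics\<close>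

locale walker4 = walker g A U
  for g :: "real^(2 + 2) \<Rightarrow> real^(2 + 2)^(2 + 2)"
    and A :: "2 \<Rightarrow> 2 \<Rightarrow> real^(2 + 2) \<Rightarrow> real" and U :: "(real^(2 + 2)) set"
begin

abbreviation vol :: "real^(2 + 2) \<Rightarrow> (2 + 2) fourform" where
  "vol z \<equiv> cotangent_vol (g z)"

lemma alternating_vol: "alternating4 (vol z)"
  and self_dual_vertical: "\<lbrakk>vertical u; vertical v; u \<noteq> v; independent {u, v}\<rbrakk>
      \<Longrightarrow> self_dual (g z) (vol z) (wedge u v)"
proof -
  have "\<exists>!vol. volume_form (g z) vol \<and> (\<forall>u v. vertical u \<longrightarrow> vertical v \<longrightarrow> u \<noteq> v \<longrightarrow> independent {u, v} \<longrightarrow>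
        self_dual (g z) vol (wedge u v))"
    by (rule cotangent_vol_unique) (simp_all add: g_simps)
  from theI'[OF this, folded cotangent_vol_def] have *: "volume_form (g z) (vol z) \<and> (\<forall>u v. vertical u \<longrightarrow> vertical v \<longrightarrow> u \<noteq> v \<longrightarrow>
       independent {u, v} \<longrightarrow> self_dual (g z) (vol z) (wedge u v))"
    .
  from * show "alternating4 (vol z)"
    by (simp add: volume_form_def)
  from * show "\<lbrakk>vertical u; vertical v; u \<noteq> v; independent {u, v}\<rbrakk> \<Longrightarrow> self_dual (g z) (vol z) (wedge u v)"
    by blast
qed

lemma vol_swap:
  "vol z j i k l = - vol z i j k l" "vol z i k j l = - vol z i j k l" "vol z i j l k = - vol z i j k l"
  using alternating_vol unfolding alternating4_def by blast+

lemma vol_zero: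
  "vol z i i k l = 0" "vol z i j j l = 0" "vol z i j k k = 0"
  "vol z i j i l = 0" "vol z i j k i = 0" "vol z i j k j = 0"
proof -
  show 1: "vol z i i k l = 0" and 2: "vol z i j j l = 0" and "vol z i j k k = 0" for i j k l
    using vol_swap(1)[of z i i k l] vol_swap(2)[of z i j j l] vol_swap(3)[of z i j k k] by linarith+
  show 3: "vol z i j i l = 0" for i j l
    using vol_swap(2)[of z i j i l] 1 by simp
  show "vol z i j k i = 0"
    using vol_swap(3)[of z i j i k] 3 by simp
  show "vol z i j k j = 0"
    using vol_swap(3)[of z i j k j] 2 by simp
qed

lemma vol_sort:
  "vol z (Inr 2) (Inr 1) k l = - vol z (Inr 1) (Inr 2) k l"
  "vol z (Inl a) (Inr b) k l = - vol z (Inr b) (Inl a) k l"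
  "vol z (Inl 2) (Inl 1) k l = - vol z (Inl 1) (Inl 2) k l"
  "vol z i (Inr 2) (Inr 1) l = - vol z i (Inr 1) (Inr 2) l"
  "vol z i (Inl a) (Inr b) l = - vol z i (Inr b) (Inl a) l"
  "vol z i (Inl 2) (Inl 1) l = - vol z i (Inl 1) (Inl 2) l"
  "vol z i j (Inr 2) (Inr 1) = - vol z i j (Inr 1) (Inr 2)"
  "vol z i j (Inl a) (Inr b) = - vol z i j (Inr b) (Inl a)"
  "vol z i j (Inl 2) (Inl 1) = - vol z i j (Inl 1) (Inl 2)"
  by (rule vol_swap)+

lemma bivector_components:
  assumes "bivector B"
  shows "B $ s $ s = 0" "B $ Inl 2 $ Inl 1 = - B $ Inl 1 $ Inl 2"
    "B $ Inr 2 $ Inr 1 = - B $ Inr 1 $ Inr 2" "B $ Inr i $ Inl j = - B $ Inl j $ Inr i"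
proof -
  have *: "B $ t $ s = - B $ s $ t" for s t
  proof -
    have "transpose B $ s $ t = (- B) $ s $ t"
      using assms by (simp only: bivector_def)
    then show ?thesis by (simp add: transpose_def)
  qed
  show "B $ s $ s = 0" using *[of s s] by simp
  show "B $ Inl 2 $ Inl 1 = - B $ Inl 1 $ Inl 2" "B $ Inr 2 $ Inr 1 = - B $ Inr 1 $ Inr 2"
    "B $ Inr i $ Inl j = - B $ Inl j $ Inr i"
    by (rule *)+
qed

text \<open>The orientation enters here: it requires \<open>\<partial>\<^bsub>1'\<^esub> \<and> \<partial>\<^bsub>2'\<^esub>\<close> to be self-dual.\<close>

lemma vol_value: "vol z (Inr 1) (Inr 2) (Inl 1) (Inl 2) = 1"
proof -
  let ?u = "axis (Inr 1) (1::real) :: real^(2 + 2)" and ?v = "axis (Inr 2) (1::real) :: real^(2 + 2)"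
  have "vertical ?u" "vertical ?v"
    by (auto simp: vertical_def base_def vec_eq_iff axis_def)
  moreover have "?u \<noteq> ?v"
    by (simp add: axis_eq_axis)
  moreover have "independent {?u, ?v}"
    by (rule independent_mono[OF independent_Basis]) auto
  ultimately have "bivector_op (g z) (vol z) (wedge ?u ?v) $ Inr 1 $ Inr 2 = wedge ?u ?v $ Inr 1 $ Inr 2"
    using self_dual_vertical by (simp add: self_dual_def)
  then show ?thesis
    by (simp add: bivector_op_def raise_last2_def wedge_def axis_def sum_UNIV_Plus sum_2 matrix_inv_g
        vol_sort vol_zero)
qed

text \<open>With \<open>e\<^sub>i = \<partial>\<^sub>i - 1/2 A\<^sub>i\<^sub>j \<partial>\<^bsub>j'\<^esub>\<close>, these equations describe the span of \<open>\<partial>\<^bsub>1'\<^esub> \<and> \<partial>\<^bsub>2'\<^esub>\<close>,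
  \<open>\<partial>\<^sub>1 \<and> \<partial>\<^bsub>1'\<^esub> + \<partial>\<^sub>2 \<and> \<partial>\<^bsub>2'\<^esub>\<close> and \<open>e\<^sub>1 \<and> e\<^sub>2\<close>; the entry \<open>B\<^sup>1\<^sup>2\<close> is the coefficient of \<open>e\<^sub>1 \<and> e\<^sub>2\<close>.\<close>

lemma self_dual_iff:
  assumes "z \<in> U"
  shows "self_dual (g z) (vol z) B \<longleftrightarrow> bivector B \<and>
     B $ Inl 1 $ Inr 2 = - 1/2 * A 2 2 z * B $ Inl 1 $ Inl 2 \<and>
     B $ Inl 2 $ Inr 1 = 1/2 * A 1 1 z * B $ Inl 1 $ Inl 2 \<and>
     B $ Inl 1 $ Inr 1 - B $ Inl 2 $ Inr 2 = - A 1 2 z * B $ Inl 1 $ Inl 2"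
proof (cases "bivector B")
  case True
  note B = bivector_components[OF True]
  have A21: "A 2 1 z = A 1 2 z"
    by (rule A_sym[OF assms])
  have "bivector_op (g z) (vol z) B = B \<longleftrightarrow>
     B $ Inl 1 $ Inr 2 = - 1/2 * A 2 2 z * B $ Inl 1 $ Inl 2 \<and>
     B $ Inl 2 $ Inr 1 = 1/2 * A 1 1 z * B $ Inl 1 $ Inl 2 \<and>
     B $ Inl 1 $ Inr 1 - B $ Inl 2 $ Inr 2 = - A 1 2 z * B $ Inl 1 $ Inl 2"
    (is "?L \<longleftrightarrow> ?R")
    apply (simp only: vec_eq_iff forall_Plus forall_2)
    apply (simp add: bivector_op_def raise_last2_def sum_UNIV_Plus sum_2
        matrix_inv_g vol_sort vol_zero vol_value B A21)
    apply (rule iffI; elim conjE; intro conjI; (linarith | algebra))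
    done
  with True show ?thesis
    by (simp add: self_dual_def)
qed (simp add: self_dual_def)

lemma riemann_LLLL:
  assumes "z \<in> U"
  shows "riemann g z (Inl i) (Inl i) u v = 0"
    "riemann g z (Inl 2) (Inl 1) u v = - riemann g z (Inl 1) (Inl 2) u v"
    "riemann g z (Inl i) (Inl j) (Inl k) (Inl k) = 0"
    "riemann g z (Inl i) (Inl j) (Inl 2) (Inl 1) = - riemann g z (Inl i) (Inl j) (Inl 1) (Inl 2)"
proof -
  show 1: "riemann g z (Inl i) (Inl i) u v = 0" for i u v
    by (simp add: riemann_def curv_def)
  show 2: "riemann g z (Inl 2) (Inl 1) u v = - riemann g z (Inl 1) (Inl 2) u v" for u v
    by (simp add: riemann_def curv_def sum_subtractf algebra_simps flip: sum_negf)
  note unfold1 = riemann_g[OF assms] pd_christoffel1_g[OF assms] sum_UNIV_Plus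
  note sym = pd_A_sym[OF assms, of _ 2 1] pd_pd_A_sym[OF assms, of _ _ 2 1]
     A_sym[OF assms, of 2 1] pd_pd_A_commute[OF assms, of "Inl 2" "Inl 1"]
  have "riemann g z (Inl 1) (Inl 2) (Inl k) (Inl l) = - riemann g z (Inl 1) (Inl 2) (Inl l) (Inl k)" for k l
  proof -
    have "\<forall>k l :: 2. riemann g z (Inl 1) (Inl 2) (Inl k) (Inl l) + riemann g z (Inl 1) (Inl 2) (Inl l) (Inl k) = 0"
      by (simp only: unfold1 forall_2, simp add: christoffel1_g levi_civita_g sum_2 sym, simp add: field_simps)
    then show ?thesis by (simp add: eq_neg_iff_add_eq_0)
  qed
  then have *: "riemann g z (Inl i) (Inl j) (Inl k) (Inl l) = - riemann g z (Inl i) (Inl j) (Inl l) (Inl k)" for i j k l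
    using exhaust_2[of i] exhaust_2[of j] 1 2 by (metis minus_equation_iff neg_equal_0_iff_equal)
  show "riemann g z (Inl i) (Inl j) (Inl k) (Inl k) = 0"
    using *[of i j k k] by simp
  show "riemann g z (Inl i) (Inl j) (Inl 2) (Inl 1) = - riemann g z (Inl i) (Inl j) (Inl 1) (Inl 2)"
    by (rule *)
qed

lemma ricci_g:
  assumes "z \<in> U"
  shows "ricci (levi_civita g) z $ Inr i $ Inr j = 0"
    "ricci (levi_civita g) z $ Inl k $ Inr j = 1/2 * (\<Sum>i\<in>UNIV. pd (Inr i) (pd (Inr j) (A i k)) z)"
    "ricci (levi_civita g) z $ Inr j $ Inl k = 1/2 * (\<Sum>i\<in>UNIV. pd (Inr i) (pd (Inr j) (A i k)) z)"
    "ricci (levi_civita g) z $ Inl j $ Inl k =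
       (\<Sum>i\<in>UNIV. riemann g z (Inl i) (Inl j) (Inl k) (Inr i) + riemann g z (Inl i) (Inl k) (Inl j) (Inr i))
       + 1/2 * (\<Sum>i\<in>UNIV. \<Sum>l\<in>UNIV. A i l z * pd (Inr i) (pd (Inr l) (A j k)) z)"
  using pd_pd_A_sym[OF assms, of _ _ k 1] pd_pd_A_sym[OF assms, of _ _ k 2] A_sym[OF assms, of 2 1]
    pd_pd_A_commute[OF assms, of "Inr _" "Inr j"]
  by (simp_all add: ricci_riemann[OF g_invertible] sum_UNIV_Plus sum_2 matrix_inv_g
     riemann_two_primes[OF assms] riemann_one_prime_flip[OF assms])

text \<open>The value of the Weyl tensor on \<open>e\<^sub>1 \<and> e\<^sub>2\<close> and \<open>\<partial>\<^sub>1 \<and> \<partial>\<^sub>2\<close> when the scalar curvature and the Ricci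
  components with a prime are zero.\<close>

definition self_dual_block :: "real^(2 + 2) \<Rightarrow> real" where
  "self_dual_block z = riemann g z (Inl 1) (Inl 2) (Inl 1) (Inl 2)
      - 1/2 * (\<Sum>j\<in>UNIV. A 2 j z * riemann g z (Inl 1) (Inl 2) (Inl 1) (Inr j))
      + 1/2 * (\<Sum>j\<in>UNIV. A 1 j z * riemann g z (Inl 1) (Inl 2) (Inl 2) (Inr j))
      - 1/2 * ricci (levi_civita g) z $ Inl 1 $ Inl 2 * A 1 2 z
      + 1/4 * ricci (levi_civita g) z $ Inl 1 $ Inl 1 * A 2 2 z
      + 1/4 * ricci (levi_civita g) z $ Inl 2 $ Inl 2 * A 1 1 z"

text \<open>Put \<open>\<Omega> = \<partial>\<^sub>1 \<and> \<partial>\<^bsub>1'\<^esub> + \<partial>\<^sub>2 \<and> \<partial>\<^bsub>2'\<^esub>\<close>.  The hypothesis \<open>tr\<close> makes the scalar curvature and all Ricci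
  components with a prime vanish; then \<open>W\<^sup>+\<close> is zero on \<open>\<partial>\<^bsub>1'\<^esub> \<and> \<partial>\<^bsub>2'\<^esub>\<close> paired with anything and on
  \<open>(\<Omega>,\<Omega>)\<close>, and \<open>trC\<close> makes it zero on \<open>(\<Omega>, e\<^sub>1 \<and> e\<^sub>2)\<close>.  So \<open>W\<^sup>+\<close> kills the first two basis elements and sends
  \<open>e\<^sub>1 \<and> e\<^sub>2\<close> to a multiple of \<open>\<partial>\<^bsub>1'\<^esub> \<and> \<partial>\<^bsub>2'\<^esub>\<close>, which becomes \<open>dx\<^sup>1 \<and> dx\<^sup>2\<close> after lowering the indices.\<close>

lemma weyl_contraction:
  fixes B :: "real^(2 + 2)^(2 + 2)"
  assumes z: "z \<in> U"
    and tr: "\<And>j k. (\<Sum>i\<in>UNIV. pd (Inr i) (pd (Inr j) (A i k)) z) = 0"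
    and trC: "(\<Sum>i\<in>UNIV. riemann g z (Inl 1) (Inl 2) (Inl i) (Inr i)) = 0"
    and B: "self_dual (g z) (vol z) B"
  shows "(\<Sum>s\<in>UNIV. \<Sum>t\<in>UNIV. weyl g z s t u v * B $ s $ t) =
    2 * B $ Inl 1 $ Inl 2 * self_dual_block z *
      (if u = Inl 1 \<and> v = Inl 2 then 1 else if u = Inl 2 \<and> v = Inl 1 then - 1 else 0)"
proof -
  let ?K = "self_dual_block z"
  define R where "R = riemann g"
  define \<rho> where "\<rho> = ricci (levi_civita g)"
  have B': "B $ Inl 1 $ Inr 2 = - 1/2 * A 2 2 z * B $ Inl 1 $ Inl 2"
      "B $ Inl 2 $ Inr 1 = 1/2 * A 1 1 z * B $ Inl 1 $ Inl 2"
      "B $ Inl 1 $ Inr 1 = B $ Inl 2 $ Inr 2 - A 1 2 z * B $ Inl 1 $ Inl 2"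
    and Bs: "bivector B"
    using B by (simp_all add: self_dual_iff[OF z])
  define c where "c i j = R z (Inl 1) (Inl 2) (Inl i) (Inr j)" for i j
  have c22: "c 2 2 = - c 1 1"
    using trC by (simp add: sum_2 c_def R_def)
  have R1: "R z (Inl 1) (Inl 2) (Inl i) (Inr j) = c i j" "R z (Inl 2) (Inl 1) (Inl i) (Inr j) = - c i j"
      "R z (Inl 1) (Inl 1) (Inl i) (Inr j) = 0" "R z (Inl 2) (Inl 2) (Inl i) (Inr j) = 0" for i j
    using riemann_LLLL(1,2)[OF z] by (simp_all add: c_def R_def)
  define h where "h i j k l = pd (Inr i) (pd (Inr j) (A k l)) z" for i j k l
  have h: "h 2 1 k l = h 1 2 k l" "h i j 2 1 = h i j 1 2"
      "h 1 2 1 2 = - h 1 1 1 1" "h 2 2 2 2 = h 1 1 1 1" "h 1 2 2 2 = - h 1 1 1 2" "h 2 2 1 2 = - h 1 2 1 1" for i j k l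
  proof -
    show 1: "h 2 1 k l = h 1 2 k l" for k l
      using pd_pd_A_commute[OF z] by (simp add: h_def)
    show 2: "h i j 2 1 = h i j 1 2" for i j
      using pd_pd_A_sym[OF z] by (simp add: h_def)
    have t: "h 1 j 1 k + h 2 j 2 k = 0" for j k
      using tr[of j k] by (simp add: sum_2 h_def)
    show "h 1 2 1 2 = - h 1 1 1 1" "h 2 2 2 2 = h 1 1 1 1" "h 1 2 2 2 = - h 1 1 1 2" "h 2 2 1 2 = - h 1 2 1 1"
      using t[of 1 1] t[of 2 2] t[of 1 2] t[of 2 1] 1 2 by simp_all
  qed
  have A21: "A 2 1 z = A 1 2 z"
    by (rule A_sym[OF z])
  have ric: "\<rho> z $ Inr i $ Inr j = 0" "\<rho> z $ Inl i $ Inr j = 0" "\<rho> z $ Inr j $ Inl i = 0" for i j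
    using tr by (simp_all add: \<rho>_def ricci_g[OF z])
  have ricLL: "\<rho> z $ Inl j $ Inl k =
       (\<Sum>i\<in>UNIV. R z (Inl i) (Inl j) (Inl k) (Inr i) + R z (Inl i) (Inl k) (Inl j) (Inr i))
       + 1/2 * (\<Sum>i\<in>UNIV. \<Sum>l\<in>UNIV. A i l z * h i l j k)" for j k
    by (simp only: \<rho>_def R_def ricci_g[OF z] h_def)
  have ric1: "\<rho> z $ Inl 1 $ Inl 1 = - 2 * c 1 2 + 1/2 * (A 1 1 z * h 1 1 1 1 + 2 * A 1 2 z * h 1 2 1 1 + A 2 2 z * h 2 2 1 1)"
    "\<rho> z $ Inl 1 $ Inl 2 = 2 * c 1 1 + 1/2 * (A 1 1 z * h 1 1 1 2 - 2 * A 1 2 z * h 1 1 1 1 - A 2 2 z * h 1 2 1 1)"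
    "\<rho> z $ Inl 2 $ Inl 1 = 2 * c 1 1 + 1/2 * (A 1 1 z * h 1 1 1 2 - 2 * A 1 2 z * h 1 1 1 1 - A 2 2 z * h 1 2 1 1)"
    "\<rho> z $ Inl 2 $ Inl 2 = 2 * c 2 1 + 1/2 * (A 1 1 z * h 1 1 2 2 - 2 * A 1 2 z * h 1 1 1 2 + A 2 2 z * h 1 1 1 1)"
    by (simp_all add: ricLL sum_2 R1 c22 h A21)
  have scal: "scalar_curv g z = 0"
    by (simp add: scalar_curv_def sum_UNIV_Plus matrix_inv_g ric[unfolded \<rho>_def])
  have W: "weyl g z s t u v = R z s t u v
      - (\<rho> z $ t $ u * g z $ s $ v - \<rho> z $ s $ u * g z $ t $ v
         + \<rho> z $ s $ v * g z $ t $ u - \<rho> z $ t $ v * g z $ s $ u) / 2" for s t u v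
    by (simp add: weyl_def Let_def scal R_def \<rho>_def)
  note R2 = riemann_two_primes[OF z, folded R_def, folded h_def]
     riemann_one_prime_flip[OF z, folded R_def] riemann_LLLL[OF z, folded R_def]
  have "\<forall>u v. (\<Sum>s\<in>UNIV. \<Sum>t\<in>UNIV. weyl g z s t u v * B $ s $ t) =
    2 * B $ Inl 1 $ Inl 2 * ?K *
      (if u = Inl 1 \<and> v = Inl 2 then 1 else if u = Inl 2 \<and> v = Inl 1 then - 1 else 0)"
    apply (simp only: forall_Plus forall_2 sum_UNIV_Plus sum_2)
    apply (intro conjI)
    apply (simp_all add: W R2 R1 ric bivector_components[OF Bs] B' g_simps h A21 c22 sum_2
        self_dual_block_def[of z, folded R_def \<rho>_def])
    apply (simp_all add: ric1)
    apply (simp_all add: field_simps)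
    done
  then show ?thesis by blast
qed

lemma weyl_plus_zero_iff:
  assumes z: "z \<in> U"
    and tr: "\<And>j k. (\<Sum>i\<in>UNIV. pd (Inr i) (pd (Inr j) (A i k)) z) = 0"
    and trC: "(\<Sum>i\<in>UNIV. riemann g z (Inl 1) (Inl 2) (Inl i) (Inr i)) = 0"
  shows "(\<forall>B. self_dual (g z) (vol z) B \<longrightarrow> bivector_op (g z) (weyl g z) B = 0) \<longleftrightarrow> self_dual_block z = 0"
proof
  assume "self_dual_block z = 0"
  then show "\<forall>B. self_dual (g z) (vol z) B \<longrightarrow> bivector_op (g z) (weyl g z) B = 0"
    using weyl_contraction[OF z tr trC]
    by (simp add: bivector_op_eq_0_iff[OF g_invertible])
next
  assume W: "\<forall>B. self_dual (g z) (vol z) B \<longrightarrow> bivector_op (g z) (weyl g z) B = 0"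
  \<comment> \<open>The bivector \<open>E\<close> below is \<open>e\<^sub>1 \<and> e\<^sub>2\<close> up to a multiple of \<open>\<partial>\<^bsub>1'\<^esub> \<and> \<partial>\<^bsub>2'\<^esub>\<close>.\<close>
  define f :: "2 + 2 \<Rightarrow> 2 + 2 \<Rightarrow> real" where "f s t =
     (if s = Inl 1 \<and> t = Inl 2 then 1
      else if s = Inl 1 \<and> t = Inr 1 then - 1/2 * A 1 2 z
      else if s = Inl 1 \<and> t = Inr 2 then - 1/2 * A 2 2 z
      else if s = Inl 2 \<and> t = Inr 1 then 1/2 * A 1 1 z
      else if s = Inl 2 \<and> t = Inr 2 then 1/2 * A 1 2 z else 0)" for s t
  define E :: "real^(2 + 2)^(2 + 2)" where "E = (\<chi> s t. f s t - f t s)"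
  have sd: "self_dual (g z) (vol z) E"
    unfolding self_dual_iff[OF z]
    by (simp add: bivector_def E_def transpose_def vec_eq_iff) (simp add: f_def)
  have "E $ Inl 1 $ Inl 2 = 1"
    by (simp add: E_def f_def)
  moreover have "(\<Sum>s\<in>UNIV. \<Sum>t\<in>UNIV. weyl g z s t (Inl 1) (Inl 2) * E $ s $ t) = 0"
    using W sd unfolding bivector_op_eq_0_iff[OF g_invertible] by blast
  ultimately show "self_dual_block z = 0"
    using weyl_contraction[OF z tr trC sd, of "Inl 1" "Inl 2"] by simp
qed

end

section \<open>Curvature of a surface with a parallel nilpotent endomorphism\<close>

text \<open>In dimension two the curvature is determined by the Ricci tensor.\<close>

lemma curv_ricci:
  fixes \<Gamma> :: "2 christoffel"
  shows "curv \<Gamma> x 1 2 k 1 = ricci \<Gamma> x $ 2 $ k" "curv \<Gamma> x 1 2 k 2 = - ricci \<Gamma> x $ 1 $ k"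
  by (simp_all add: ricci_def curv_def sum_2)

text \<open>The data on the coordinate region of one chart.  That \<open>T\<close> has no zeros is where the connectedness of
  the surface enters.\<close>

locale parallel_surface =
  fixes X :: "(real^2) set" and \<Gamma> :: "2 christoffel" and T \<Phi> :: "real^2 \<Rightarrow> real^2^2"
  assumes open_X: "open X"
    and smooth_\<Gamma>: "\<And>i j k. smooth_on X (\<lambda>x. \<Gamma> x i j k)"
    and smooth_T: "\<And>i j. smooth_on X (\<lambda>x. T x $ i $ j)"
    and smooth_\<Phi>: "\<And>i j. smooth_on X (\<lambda>x. \<Phi> x $ i $ j)"
    and torsion: "\<And>x i j k. x \<in> X \<Longrightarrow> \<Gamma> x i j k = \<Gamma> x j i k"
    and parallel_T: "\<And>x i j k. x \<in> X \<Longrightarrow> cov11 \<Gamma> T x i j k = 0"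
    and nilpotent_T: "\<And>x. x \<in> X \<Longrightarrow> T x ** T x = 0"
    and T_nonzero: "\<And>x. x \<in> X \<Longrightarrow> T x \<noteq> 0"
    and parallel_\<Phi>: "\<And>x i j k. x \<in> X \<Longrightarrow> cov02 \<Gamma> \<Phi> x i j k = 0"
    and sym_\<Phi>: "\<And>x. x \<in> X \<Longrightarrow> transpose (\<Phi> x) = \<Phi> x"
    and sym_ricci: "\<And>x. x \<in> X \<Longrightarrow> transpose (ricci \<Gamma> x) = ricci \<Gamma> x"
begin

abbreviation "\<rho> \<equiv> ricci \<Gamma>"

lemmas smooth_rules = smooth_on_add[OF open_X] smooth_on_diff[OF open_X] smooth_on_mult[OF open_X]
  smooth_on_sum[OF open_X] smooth_on_minus[OF open_X] smooth_on_pd smooth_on_const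
  smooth_\<Gamma> smooth_T smooth_\<Phi>

lemma smooth_\<rho>: "smooth_on X (\<lambda>x. \<rho> x $ j $ k)"
  by (simp add: ricci_def curv_def smooth_rules)

lemma diff_rules:
  assumes "x \<in> X"
  shows "(\<lambda>x. \<Gamma> x i j k) differentiable at x" "(\<lambda>x. T x $ i $ j) differentiable at x"
    "(\<lambda>x. \<Phi> x $ i $ j) differentiable at x" "(\<lambda>x. \<rho> x $ i $ j) differentiable at x"
    "pd m (\<lambda>x. \<Gamma> x i j k) differentiable at x"
  using smooth_on_imp_differentiable[OF open_X _ assms] smooth_\<Gamma> smooth_T smooth_\<Phi> smooth_\<rho> smooth_on_pd
  by blast+

lemma \<Phi>_sym: "x \<in> X \<Longrightarrow> \<Phi> x $ i $ j = \<Phi> x $ j $ i"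
  using sym_\<Phi>[of x] by (simp add: vec_eq_iff transpose_def)

lemma \<rho>_sym: "x \<in> X \<Longrightarrow> \<rho> x $ i $ j = \<rho> x $ j $ i"
  using sym_ricci[of x] by (simp add: vec_eq_iff transpose_def)

lemma pd_\<Gamma>_sym: "x \<in> X \<Longrightarrow> pd a (\<lambda>x. \<Gamma> x i j k) x = pd a (\<lambda>x. \<Gamma> x j i k) x"
  by (rule pd_cong[OF open_X]) (auto intro: torsion)

lemma pd_T: "x \<in> X \<Longrightarrow> pd m (\<lambda>x. T x $ k $ j) x = (\<Sum>l\<in>UNIV. \<Gamma> x m j l * T x $ k $ l - \<Gamma> x m l k * T x $ l $ j)"
  using parallel_T[of x m j k] by (simp add: cov11_def sum_subtractf)

lemma pd_\<Phi>: "x \<in> X \<Longrightarrow> pd m (\<lambda>x. \<Phi> x $ i $ j) x = (\<Sum>l\<in>UNIV. \<Gamma> x m i l * \<Phi> x $ l $ j + \<Gamma> x m j l * \<Phi> x $ i $ l)"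
  using parallel_\<Phi>[of x m i j] by (simp add: cov02_def sum.distrib)

lemma pd_\<rho>: "pd i (\<lambda>x. \<rho> x $ j $ k) x = cov02 \<Gamma> \<rho> x i j k + (\<Sum>m\<in>UNIV. \<Gamma> x i j m * \<rho> x $ m $ k + \<Gamma> x i k m * \<rho> x $ j $ m)"
  by (simp add: cov02_def sum.distrib)

lemma cov02_\<rho>_sym: "x \<in> X \<Longrightarrow> cov02 \<Gamma> \<rho> x i j k = cov02 \<Gamma> \<rho> x i k j"
proof -
  assume x: "x \<in> X"
  have "pd i (\<lambda>x. \<rho> x $ j $ k) x = pd i (\<lambda>x. \<rho> x $ k $ j) x"
    by (rule pd_cong[OF open_X x]) (rule \<rho>_sym)
  then show ?thesis
    using \<rho>_sym[OF x] by (simp add: cov02_def)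
qed

lemma T_components:
  assumes "x \<in> X"
  shows "T x $ 2 $ 2 = - T x $ 1 $ 1" "T x $ 1 $ 1 * T x $ 1 $ 1 = - T x $ 1 $ 2 * T x $ 2 $ 1"
    "T x $ 1 $ 2 \<noteq> 0 \<or> T x $ 2 $ 1 \<noteq> 0"
proof -
  have sq: "T x $ i $ 1 * T x $ 1 $ j + T x $ i $ 2 * T x $ 2 $ j = 0" for i j
    using nilpotent_T[OF assms] by (simp add: vec_eq_iff matrix_matrix_mult_def sum_2)
  have ne: "\<not> (T x $ 1 $ 1 = 0 \<and> T x $ 1 $ 2 = 0 \<and> T x $ 2 $ 1 = 0 \<and> T x $ 2 $ 2 = 0)"
    using T_nonzero[OF assms] by (simp add: vec_eq_iff forall_2)
  show 1: "T x $ 1 $ 1 * T x $ 1 $ 1 = - T x $ 1 $ 2 * T x $ 2 $ 1"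
    using sq[of 1 1] by simp
  show 2: "T x $ 2 $ 2 = - T x $ 1 $ 1"
    using sq[of 1 1] sq[of 1 2] sq[of 2 1] sq[of 2 2] ne by algebra
  show "T x $ 1 $ 2 \<noteq> 0 \<or> T x $ 2 $ 1 \<noteq> 0"
    using 1 2 ne by auto
qed

text \<open>The vector \<open>v\<close> spans both the image and the kernel of \<open>T\<close>, so \<open>\<theta>\<close> has to annihilate \<open>v\<close>; in dimension
  two this determines \<open>\<theta>\<close> up to a factor.\<close>

lemma T_rank_one:
  assumes "x \<in> X"
  obtains c and v :: "2 \<Rightarrow> real" and \<theta> :: "2 \<Rightarrow> real" where "c \<noteq> 0" "v 1 \<noteq> 0 \<or> v 2 \<noteq> 0"
    "\<theta> 1 = v 2" "\<theta> 2 = - v 1" "\<And>k j. T x $ k $ j = c * v k * \<theta> j"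
proof (cases "T x $ 1 $ 2 = 0")
  case True
  then have 0: "T x $ 1 $ 1 = 0" "T x $ 2 $ 2 = 0" "T x $ 2 $ 1 \<noteq> 0"
    using T_components[OF assms] by auto
  have "\<forall>k j. T x $ k $ j = T x $ 2 $ 1 * (if k = 1 then 0 else 1) * (if j = 1 then 1 else 0)"
    using 0 True by (simp add: forall_2)
  then have eq: "T x $ k $ j = T x $ 2 $ 1 * (if k = 1 then 0 else 1) * (if j = 1 then 1 else 0)" for k j
    by blast
  show thesis
    by (rule that[OF _ _ _ _ eq]) (simp_all add: 0)
next
  case False
  \<comment> \<open>A nonzero column of \<open>T\<close> spans its image.\<close>
  define v where "v k = T x $ k $ 2" for k
  define \<theta> where "\<theta> j = (if j = 1 then v 2 else - v 1)" for j :: 2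
  show thesis
  proof (rule that[of "- 1 / v 1" v \<theta>])
    have "\<forall>k j. T x $ k $ j = - 1 / v 1 * v k * \<theta> j"
      using T_components[OF assms] False by (simp add: forall_2 v_def \<theta>_def field_simps)
    then show "T x $ k $ j = - 1 / v 1 * v k * \<theta> j" for k j by blast
  qed (use False in \<open>auto simp: v_def \<theta>_def\<close>)
qed

text \<open>The Ricci identity: parallelism expresses the first derivatives of \<open>T\<close> through \<open>\<Gamma>\<close> and \<open>T\<close>, and
  equating the two mixed second derivatives leaves the commutator of \<open>T\<close> with the curvature.\<close>

lemma curv_commutes_T:
  assumes x: "x \<in> X"
  shows "(\<Sum>m\<in>UNIV. curv \<Gamma> x 1 2 m k * T x $ m $ j) = (\<Sum>m\<in>UNIV. curv \<Gamma> x 1 2 j m * T x $ k $ m)"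
proof -
  have dd: "pd a (pd i (\<lambda>x. T x $ k $ j)) x = (\<Sum>l\<in>UNIV. pd a (\<lambda>x. \<Gamma> x i j l) x * T x $ k $ l + \<Gamma> x i j l * pd a (\<lambda>x. T x $ k $ l) x
      - pd a (\<lambda>x. \<Gamma> x i l k) x * T x $ l $ j - \<Gamma> x i l k * pd a (\<lambda>x. T x $ l $ j) x)" for a i k j
  proof -
    have "pd a (pd i (\<lambda>x. T x $ k $ j)) x = pd a (\<lambda>x. \<Sum>l\<in>UNIV. \<Gamma> x i j l * T x $ k $ l - \<Gamma> x i l k * T x $ l $ j) x"
      by (rule pd_cong[OF open_X x]) (rule pd_T)
    then show ?thesis
      by (simp add: pd_sum pd_diff pd_mult diff_rules[OF x] algebra_simps)
  qed
  have "pd 1 (pd 2 (\<lambda>x. T x $ k $ j)) x = pd 2 (pd 1 (\<lambda>x. T x $ k $ j)) x"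
    by (rule pd_commute[OF open_X smooth_T x])
  then show ?thesis
    unfolding dd pd_T[OF x] curv_def sum_2 by algebra
qed

text \<open>The Ricci identity for the parallel field \<open>\<Phi>\<close>.\<close>

lemma curv_annihilates_\<Phi>:
  assumes x: "x \<in> X"
  shows "(\<Sum>m\<in>UNIV. curv \<Gamma> x 1 2 i m * \<Phi> x $ m $ j + curv \<Gamma> x 1 2 j m * \<Phi> x $ i $ m) = 0"
proof -
  have dd: "pd a (pd b (\<lambda>x. \<Phi> x $ i $ j)) x = (\<Sum>l\<in>UNIV. pd a (\<lambda>x. \<Gamma> x b i l) x * \<Phi> x $ l $ j + \<Gamma> x b i l * pd a (\<lambda>x. \<Phi> x $ l $ j) x
      + pd a (\<lambda>x. \<Gamma> x b j l) x * \<Phi> x $ i $ l + \<Gamma> x b j l * pd a (\<lambda>x. \<Phi> x $ i $ l) x)" for a b i j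
  proof -
    have "pd a (pd b (\<lambda>x. \<Phi> x $ i $ j)) x = pd a (\<lambda>x. \<Sum>l\<in>UNIV. \<Gamma> x b i l * \<Phi> x $ l $ j + \<Gamma> x b j l * \<Phi> x $ i $ l) x"
      by (rule pd_cong[OF open_X x]) (rule pd_\<Phi>)
    then show ?thesis
      by (simp add: pd_sum pd_add pd_mult diff_rules[OF x] algebra_simps)
  qed
  have "pd 1 (pd 2 (\<lambda>x. \<Phi> x $ i $ j)) x = pd 2 (pd 1 (\<lambda>x. \<Phi> x $ i $ j)) x"
    by (rule pd_commute[OF open_X smooth_\<Phi> x])
  then show ?thesis
    unfolding dd pd_\<Phi>[OF x] curv_def sum_2 by algebra
qed

text \<open>The curvature operator commutes with \<open>T\<close> and is trace-free because \<open>\<rho>\<close> is symmetric; so it is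
  a multiple of \<open>T\<close>.\<close>

lemma \<rho>_T:
  assumes "x \<in> X"
  shows "(\<Sum>m\<in>UNIV. \<rho> x $ j $ m * T x $ m $ k) = 0"
proof -
  note T = T_components[OF assms]
  have "\<forall>k j. (\<Sum>m\<in>UNIV. curv \<Gamma> x 1 2 m k * T x $ m $ j) = (\<Sum>m\<in>UNIV. curv \<Gamma> x 1 2 j m * T x $ k $ m)"
    using curv_commutes_T[OF assms] by blast
  then have "\<forall>j k. (\<Sum>m\<in>UNIV. \<rho> x $ j $ m * T x $ m $ k) = 0"
    unfolding forall_2 sum_2 curv_ricci \<rho>_sym[OF assms, of 2 1] T(1)
    using T(2,3) by (elim conjE, intro conjI) algebra+
  then show ?thesis by blast
qed

text \<open>Differentiate \<open>\<rho>_T\<close>, using that \<open>T\<close> is parallel.\<close>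

lemma cov02_\<rho>_T:
  assumes x: "x \<in> X"
  shows "(\<Sum>m\<in>UNIV. cov02 \<Gamma> \<rho> x i j m * T x $ m $ k) = 0"
proof -
  have "pd i (\<lambda>x. \<Sum>m\<in>UNIV. \<rho> x $ j $ m * T x $ m $ k) x = pd i (\<lambda>x. 0) x"
    by (rule pd_cong[OF open_X x]) (rule \<rho>_T)
  then have "(\<Sum>m\<in>UNIV. pd i (\<lambda>x. \<rho> x $ j $ m) x * T x $ m $ k + \<rho> x $ j $ m * pd i (\<lambda>x. T x $ m $ k) x) = 0"
    by (simp add: pd_sum pd_mult differentiable_mult diff_rules[OF x] pd_const)
  then show ?thesis
    using \<rho>_T[OF x, of j 1] \<rho>_T[OF x, of j 2] \<rho>_T[OF x, of 1 k] \<rho>_T[OF x, of 2 k]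
    unfolding pd_\<rho> pd_T[OF x] sum_2 by algebra
qed

end

section \<open>The metric over a chart of the surface\<close>

context parallel_surface
begin

definition g :: "real^(2 + 2) \<Rightarrow> real^(2 + 2)^(2 + 2)" where
  "g z = sym_prod (iota_tensor T z) (iota_tensor T z) + riemann_extension \<Gamma> z + pullback02 \<Phi> z"

definition U :: "(real^(2 + 2)) set" where "U = {z. base z \<in> X}"

text \<open>The functions \<open>\<tau>\<close> are the components of \<open>\<iota>T\<close>, and \<open>- 2 \<gamma>\<close> is the base block of \<open>g\<^sub>D\<close>.\<close>

definition \<tau> :: "2 \<Rightarrow> real^(2 + 2) \<Rightarrow> real" where
  "\<tau> j z = (\<Sum>k\<in>UNIV. z $ Inr k * T (base z) $ k $ j)"

definition \<gamma> :: "2 \<Rightarrow> 2 \<Rightarrow> real^(2 + 2) \<Rightarrow> real" where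
  "\<gamma> i j z = (\<Sum>k\<in>UNIV. z $ Inr k * \<Gamma> (base z) i j k)"

definition A :: "2 \<Rightarrow> 2 \<Rightarrow> real^(2 + 2) \<Rightarrow> real" where
  "A i j z = \<tau> i z * \<tau> j z - 2 * \<gamma> i j z + \<Phi> (base z) $ i $ j"

lemma open_U: "open U"
  unfolding U_def by (rule open_base_vimage[OF open_X])

lemmas smooth_U_rules = smooth_on_add[OF open_U] smooth_on_diff[OF open_U] smooth_on_mult[OF open_U]
  smooth_on_sum[OF open_U] smooth_on_const smooth_on_component
  smooth_on_base[OF open_X smooth_\<Gamma>, folded U_def] smooth_on_base[OF open_X smooth_T, folded U_def]
  smooth_on_base[OF open_X smooth_\<Phi>, folded U_def]
  smooth_on_base[OF open_X smooth_on_pd[OF smooth_\<Gamma>], folded U_def]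

lemma smooth_\<tau>: "smooth_on U (\<tau> j)" and smooth_\<gamma>: "smooth_on U (\<gamma> i j)"
  by (simp_all add: \<tau>_def[abs_def] \<gamma>_def[abs_def] smooth_U_rules)

lemma smooth_A: "smooth_on U (A i j)"
  by (simp add: A_def[abs_def] smooth_U_rules smooth_\<tau> smooth_\<gamma>)

sublocale walker4 g A U
proof
  show "open U" by (rule open_U)
  fix z i j
  show "g z $ Inl i $ Inl j = A i j z"
    by (simp add: g_def sym_prod_def iota_tensor_def riemann_extension_def pullback02_def A_def \<tau>_def \<gamma>_def fibre_nth)
  show "g z $ Inl i $ Inr j = (if i = j then 1 else 0)" "g z $ Inr i $ Inl j = (if i = j then 1 else 0)"
    "g z $ Inr i $ Inr j = 0"
    by (simp_all add: g_def sym_prod_def iota_tensor_def riemann_extension_def pullback02_def)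
  show "A i j z = A j i z" if "z \<in> U"
    using that \<Phi>_sym torsion by (simp add: A_def \<gamma>_def U_def)
  show "smooth_on U (A i j)" by (rule smooth_A)
qed

text \<open>The prefixes \<open>d\<close> and \<open>dd\<close> mark first and second derivatives along the base, and \<open>fA\<close> is the derivative
  of \<open>A\<close> along the fibre.  Parallelism has been used to eliminate the derivatives of \<open>T\<close> and \<open>\<Phi>\<close>.\<close>

definition d\<tau> :: "2 \<Rightarrow> 2 \<Rightarrow> real^(2 + 2) \<Rightarrow> real" where
  "d\<tau> m j z = (\<Sum>l\<in>UNIV. \<Gamma> (base z) m j l * \<tau> l z - \<gamma> m l z * T (base z) $ l $ j)"

definition dT :: "2 \<Rightarrow> 2 \<Rightarrow> 2 \<Rightarrow> real^(2 + 2) \<Rightarrow> real" where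
  "dT m k j z = (\<Sum>l\<in>UNIV. \<Gamma> (base z) m j l * T (base z) $ k $ l - \<Gamma> (base z) m l k * T (base z) $ l $ j)"

definition d\<Phi> :: "2 \<Rightarrow> 2 \<Rightarrow> 2 \<Rightarrow> real^(2 + 2) \<Rightarrow> real" where
  "d\<Phi> m i j z = (\<Sum>l\<in>UNIV. \<Gamma> (base z) m i l * \<Phi> (base z) $ l $ j + \<Gamma> (base z) m j l * \<Phi> (base z) $ i $ l)"

definition d\<gamma> :: "2 \<Rightarrow> 2 \<Rightarrow> 2 \<Rightarrow> real^(2 + 2) \<Rightarrow> real" where
  "d\<gamma> m i j z = (\<Sum>k\<in>UNIV. z $ Inr k * pd m (\<lambda>x. \<Gamma> x i j k) (base z))"

definition dd\<tau> :: "2 \<Rightarrow> 2 \<Rightarrow> 2 \<Rightarrow> real^(2 + 2) \<Rightarrow> real" where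
  "dd\<tau> a m j z = (\<Sum>l\<in>UNIV. pd a (\<lambda>x. \<Gamma> x m j l) (base z) * \<tau> l z + \<Gamma> (base z) m j l * d\<tau> a l z
     - d\<gamma> a m l z * T (base z) $ l $ j - \<gamma> m l z * dT a l j z)"

definition dd\<Phi> :: "2 \<Rightarrow> 2 \<Rightarrow> 2 \<Rightarrow> 2 \<Rightarrow> real^(2 + 2) \<Rightarrow> real" where
  "dd\<Phi> a m i j z = (\<Sum>l\<in>UNIV. pd a (\<lambda>x. \<Gamma> x m i l) (base z) * \<Phi> (base z) $ l $ j + \<Gamma> (base z) m i l * d\<Phi> a l j z
     + pd a (\<lambda>x. \<Gamma> x m j l) (base z) * \<Phi> (base z) $ i $ l + \<Gamma> (base z) m j l * d\<Phi> a i l z)"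

definition dd\<gamma> :: "2 \<Rightarrow> 2 \<Rightarrow> 2 \<Rightarrow> 2 \<Rightarrow> real^(2 + 2) \<Rightarrow> real" where
  "dd\<gamma> a m i j z = (\<Sum>k\<in>UNIV. z $ Inr k * pd a (pd m (\<lambda>x. \<Gamma> x i j k)) (base z))"

definition dA :: "2 \<Rightarrow> 2 \<Rightarrow> 2 \<Rightarrow> real^(2 + 2) \<Rightarrow> real" where
  "dA m i j z = d\<tau> m i z * \<tau> j z + \<tau> i z * d\<tau> m j z - 2 * d\<gamma> m i j z + d\<Phi> m i j z"

definition fA :: "2 \<Rightarrow> 2 \<Rightarrow> 2 \<Rightarrow> real^(2 + 2) \<Rightarrow> real" where
  "fA m i j z = T (base z) $ m $ i * \<tau> j z + \<tau> i z * T (base z) $ m $ j - 2 * \<Gamma> (base z) i j m"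

definition ddA :: "2 \<Rightarrow> 2 \<Rightarrow> 2 \<Rightarrow> 2 \<Rightarrow> real^(2 + 2) \<Rightarrow> real" where
  "ddA a m i j z = dd\<tau> a m i z * \<tau> j z + d\<tau> m i z * d\<tau> a j z + d\<tau> a i z * d\<tau> m j z + \<tau> i z * dd\<tau> a m j z
     - 2 * dd\<gamma> a m i j z + dd\<Phi> a m i j z"

lemma diff_U:
  assumes "z \<in> U"
  shows "(\<lambda>z. \<Gamma> (base z) i j k) differentiable at z" "(\<lambda>z. T (base z) $ i $ j) differentiable at z"
    "(\<lambda>z. \<Phi> (base z) $ i $ j) differentiable at z" "(\<lambda>z. pd m (\<lambda>x. \<Gamma> x i j k) (base z)) differentiable at z"
    "\<tau> j differentiable at z" "\<gamma> i j differentiable at z" "(\<lambda>z. z $ r) differentiable at z"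
  by (rule smooth_on_imp_differentiable[OF open_U _ assms], intro smooth_U_rules smooth_\<tau> smooth_\<gamma>)+

lemma pd_U_base:
  assumes "z \<in> U"
  shows "pd (Inl m) (\<lambda>z. \<Gamma> (base z) i j k) z = pd m (\<lambda>x. \<Gamma> x i j k) (base z)"
    "pd (Inr m) (\<lambda>z. \<Gamma> (base z) i j k) z = 0"
    "pd (Inl m) (\<lambda>z. T (base z) $ k $ j) z = dT m k j z" "pd (Inr m) (\<lambda>z. T (base z) $ k $ j) z = 0"
    "pd (Inl m) (\<lambda>z. \<Phi> (base z) $ i $ j) z = d\<Phi> m i j z" "pd (Inr m) (\<lambda>z. \<Phi> (base z) $ i $ j) z = 0"
    "pd (Inl a) (\<lambda>z. pd m (\<lambda>x. \<Gamma> x i j k) (base z)) z = pd a (pd m (\<lambda>x. \<Gamma> x i j k)) (base z)"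
proof -
  have x: "base z \<in> X" using assms by (simp add: U_def)
  show "pd (Inl m) (\<lambda>z. \<Gamma> (base z) i j k) z = pd m (\<lambda>x. \<Gamma> x i j k) (base z)"
    "pd (Inr m) (\<lambda>z. \<Gamma> (base z) i j k) z = 0"
    "pd (Inl m) (\<lambda>z. T (base z) $ k $ j) z = dT m k j z" "pd (Inr m) (\<lambda>z. T (base z) $ k $ j) z = 0"
    "pd (Inl m) (\<lambda>z. \<Phi> (base z) $ i $ j) z = d\<Phi> m i j z" "pd (Inr m) (\<lambda>z. \<Phi> (base z) $ i $ j) z = 0"
    "pd (Inl a) (\<lambda>z. pd m (\<lambda>x. \<Gamma> x i j k) (base z)) z = pd a (pd m (\<lambda>x. \<Gamma> x i j k)) (base z)"
    using diff_rules[OF x]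
      pd_base[of "\<lambda>x. \<Gamma> x i j k"] pd_base[of "\<lambda>x. T x $ k $ j"] pd_base[of "\<lambda>x. \<Phi> x $ i $ j"]
      pd_base[of "pd m (\<lambda>x. \<Gamma> x i j k)"]
    by (simp_all add: pd_T[OF x] pd_\<Phi>[OF x] dT_def d\<Phi>_def)
qed

lemma pd_\<tau>:
  assumes z: "z \<in> U"
  shows "pd (Inl m) (\<tau> j) z = d\<tau> m j z" "pd (Inr m) (\<tau> j) z = T (base z) $ m $ j"
proof -
  have *: "pd s (\<tau> j) z = (\<Sum>k\<in>UNIV. pd s (\<lambda>z. z $ Inr k) z * T (base z) $ k $ j + z $ Inr k * pd s (\<lambda>z. T (base z) $ k $ j) z)" for s
    unfolding \<tau>_def[abs_def]
    by (subst pd_sum) (simp_all add: pd_mult differentiable_mult diff_U[OF z])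
  show "pd (Inl m) (\<tau> j) z = d\<tau> m j z"
    by (simp add: * pd_component pd_U_base[OF z] dT_def d\<tau>_def \<tau>_def \<gamma>_def sum_2 algebra_simps)
  show "pd (Inr m) (\<tau> j) z = T (base z) $ m $ j"
    using exhaust_2[of m] by (auto simp: * pd_component pd_U_base[OF z] sum_2)
qed

lemma pd_\<gamma>:
  assumes z: "z \<in> U"
  shows "pd (Inl m) (\<gamma> i j) z = d\<gamma> m i j z" "pd (Inr m) (\<gamma> i j) z = \<Gamma> (base z) i j m"
proof -
  have *: "pd s (\<gamma> i j) z = (\<Sum>k\<in>UNIV. pd s (\<lambda>z. z $ Inr k) z * \<Gamma> (base z) i j k + z $ Inr k * pd s (\<lambda>z. \<Gamma> (base z) i j k) z)" for s
    unfolding \<gamma>_def[abs_def]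
    by (subst pd_sum) (simp_all add: pd_mult differentiable_mult diff_U[OF z])
  show "pd (Inl m) (\<gamma> i j) z = d\<gamma> m i j z"
    by (simp add: * pd_component pd_U_base[OF z] d\<gamma>_def)
  show "pd (Inr m) (\<gamma> i j) z = \<Gamma> (base z) i j m"
    using exhaust_2[of m] by (auto simp: * pd_component pd_U_base[OF z] sum_2)
qed

lemma pd_A:
  assumes z: "z \<in> U"
  shows "pd (Inl m) (A i j) z = dA m i j z" "pd (Inr m) (A i j) z = fA m i j z"
  unfolding A_def[abs_def]
  by (simp_all add: pd_add pd_diff pd_mult pd_const diff_U[OF z] differentiable_mult differentiable_diff
      pd_\<tau>[OF z] pd_\<gamma>[OF z] pd_U_base[OF z] dA_def fA_def)

lemma pd_d\<tau>: "z \<in> U \<Longrightarrow> pd (Inl a) (d\<tau> m j) z = dd\<tau> a m j z"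
  and diff_d\<tau>: "z \<in> U \<Longrightarrow> d\<tau> m j differentiable at z"
  and pd_d\<gamma>: "z \<in> U \<Longrightarrow> pd (Inl a) (d\<gamma> m i j) z = dd\<gamma> a m i j z"
  and diff_d\<gamma>: "z \<in> U \<Longrightarrow> d\<gamma> m i j differentiable at z"
  and pd_d\<Phi>: "z \<in> U \<Longrightarrow> pd (Inl a) (d\<Phi> m i j) z = dd\<Phi> a m i j z"
  and diff_d\<Phi>: "z \<in> U \<Longrightarrow> d\<Phi> m i j differentiable at z"
proof -
  assume z: "z \<in> U"
  note rules = pd_sum pd_add pd_diff pd_mult diff_U[OF z] differentiable_mult differentiable_diff differentiable_add
      differentiable_sum pd_\<tau>[OF z] pd_\<gamma>[OF z] pd_U_base[OF z] pd_component
  show "pd (Inl a) (d\<tau> m j) z = dd\<tau> a m j z"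
    unfolding d\<tau>_def[abs_def] by (simp add: rules dd\<tau>_def d\<tau>_def algebra_simps)
  show "pd (Inl a) (d\<gamma> m i j) z = dd\<gamma> a m i j z"
    unfolding d\<gamma>_def[abs_def] by (simp add: rules dd\<gamma>_def)
  show "pd (Inl a) (d\<Phi> m i j) z = dd\<Phi> a m i j z"
    unfolding d\<Phi>_def[abs_def] by (simp add: rules dd\<Phi>_def d\<Phi>_def algebra_simps)
  show "d\<tau> m j differentiable at z" "d\<gamma> m i j differentiable at z" "d\<Phi> m i j differentiable at z"
    unfolding d\<tau>_def[abs_def] d\<gamma>_def[abs_def] d\<Phi>_def[abs_def] by (simp_all add: rules)
qed

lemma pd_pd_A:
  assumes z: "z \<in> U"
  shows "pd (Inl a) (pd (Inl m) (A i j)) z = ddA a m i j z"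
    "pd (Inl a) (pd (Inr m) (A i j)) z =
       dT a m i z * \<tau> j z + T (base z) $ m $ i * d\<tau> a j z + d\<tau> a i z * T (base z) $ m $ j + \<tau> i z * dT a m j z
       - 2 * pd a (\<lambda>x. \<Gamma> x i j m) (base z)"
    "pd (Inr a) (pd (Inr m) (A i j)) z = T (base z) $ m $ i * T (base z) $ a $ j + T (base z) $ a $ i * T (base z) $ m $ j"
proof -
  note rules = pd_add pd_diff pd_mult pd_const diff_U[OF z] differentiable_mult differentiable_diff differentiable_add
      pd_\<tau>[OF z] pd_U_base[OF z] pd_d\<tau>[OF z] pd_d\<gamma>[OF z] pd_d\<Phi>[OF z] diff_d\<tau>[OF z] diff_d\<gamma>[OF z] diff_d\<Phi>[OF z]
  have "pd s (pd (Inl m) (A i j)) z = pd s (dA m i j) z" "pd s (pd (Inr m) (A i j)) z = pd s (fA m i j) z" for s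
    by (rule pd_cong[OF open_U z], rule pd_A, assumption)+
  then show "pd (Inl a) (pd (Inl m) (A i j)) z = ddA a m i j z"
    "pd (Inl a) (pd (Inr m) (A i j)) z =
       dT a m i z * \<tau> j z + T (base z) $ m $ i * d\<tau> a j z + d\<tau> a i z * T (base z) $ m $ j + \<tau> i z * dT a m j z
       - 2 * pd a (\<lambda>x. \<Gamma> x i j m) (base z)"
    "pd (Inr a) (pd (Inr m) (A i j)) z = T (base z) $ m $ i * T (base z) $ a $ j + T (base z) $ a $ i * T (base z) $ m $ j"
    unfolding dA_def[abs_def] fA_def[abs_def] by (simp_all add: rules ddA_def)
qed

end

section \<open>The remaining entry of the self-dual Weyl curvature\<close>

lemma two_neq_one: "((2::2) = 1) = False"
  by simp

text \<open>The polynomial identity behind \<open>self_dual_block_eq\<close>.  The letters stand for values at a point of the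
  cotangent bundle: \<open>xi\<close> for the covector, \<open>G\<close> for \<open>\<Gamma>\<close>, \<open>gam\<close>, \<open>t\<close> and \<open>F\<close> for \<open>\<gamma>\<close>, \<open>\<tau>\<close> and \<open>\<Phi>\<close>, \<open>r\<close> for \<open>D\<rho>\<close>;
  the prefixes \<open>d\<close> and \<open>dd\<close> mark derivatives along the base, and \<open>fA\<close> is the derivative of \<open>A\<close> along the
  fibre.  The hypotheses express all of them through variables without relations, apart from those
  between \<open>N\<close> and \<open>F\<close>; that is why the right-hand side carries a last summand, which is zero because
  the curvature annihilates \<open>\<Phi>\<close>.\<close>

lemma self_dual_block_identity:
  fixes G :: "2 \<Rightarrow> 2 \<Rightarrow> 2 \<Rightarrow> real" and dG :: "2 \<Rightarrow> 2 \<Rightarrow> 2 \<Rightarrow> 2 \<Rightarrow> real"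
    and gam F \<rho> T A :: "2 \<Rightarrow> 2 \<Rightarrow> real" and dgam r dF dT dA fA ch :: "2 \<Rightarrow> 2 \<Rightarrow> 2 \<Rightarrow> real"
    and ddgam ddF ddA :: "2 \<Rightarrow> 2 \<Rightarrow> 2 \<Rightarrow> 2 \<Rightarrow> real"
    and \<theta> t xi :: "2 \<Rightarrow> real" and dt :: "2 \<Rightarrow> 2 \<Rightarrow> real" and ddt :: "2 \<Rightarrow> 2 \<Rightarrow> 2 \<Rightarrow> real" and v :: "2 \<Rightarrow> real" and H :: "2 \<Rightarrow> 2 \<Rightarrow> 2 \<Rightarrow> 2 \<Rightarrow> real" and C M :: "2 \<Rightarrow> 2 \<Rightarrow> real" and c N :: real
  assumes sym: "\<And>k. G 2 1 k = G 1 2 k" "F 2 1 = F 1 2" "\<And>a k. dG a 2 1 k = dG a 1 2 k"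
      "\<And>a. dgam a 2 1 = dgam a 1 2" "\<And>a. r a 2 1 = r a 1 2"
    and gam: "\<And>i j. gam i j = xi 1 * G i j 1 + xi 2 * G i j 2"
    and \<theta>: "\<theta> 1 = v 2" "\<theta> 2 = - v 1"
    and T: "\<And>k j. T k j = c * v k * \<theta> j"
    and t: "\<And>j. t j = c * (xi 1 * v 1 + xi 2 * v 2) * \<theta> j"
    and \<rho>: "\<And>j k. \<rho> j k = N * \<theta> j * \<theta> k"
    and dT: "\<And>m k j. dT m k j = (\<Sum>l\<in>UNIV. G m j l * T k l - G m l k * T l j)"
    and dt: "\<And>m j. dt m j = (\<Sum>l\<in>UNIV. G m j l * t l - gam m l * T l j)"
    and ddt: "\<And>a m j. ddt a m j = (\<Sum>l\<in>UNIV. dG a m j l * t l + G m j l * dt a l - dgam a m l * T l j - gam m l * dT a l j)"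
    and dF: "\<And>m i j. dF m i j = (\<Sum>l\<in>UNIV. G m i l * F l j + G m j l * F i l)"
    and ddF: "\<And>a m i j. ddF a m i j = (\<Sum>l\<in>UNIV. dG a m i l * F l j + G m i l * dF a l j + dG a m j l * F i l + G m j l * dF a i l)"
    and A: "\<And>i j. A i j = t i * t j - 2 * gam i j + F i j"
    and dA: "\<And>m i j. dA m i j = dt m i * t j + t i * dt m j - 2 * dgam m i j + dF m i j"
    and fA: "\<And>m i j. fA m i j = T m i * t j + t i * T m j - 2 * G i j m"
    and ddA: "\<And>a m i j. ddA a m i j = ddt a m i * t j + dt m i * dt a j + dt a i * dt m j + t i * ddt a m j - 2 * ddgam a m i j + ddF a m i j"
    and dG: "\<And>l. dG 1 1 2 l = dG 2 1 1 l - (\<Sum>m\<in>UNIV. G 2 1 m * G 1 m l - G 1 1 m * G 2 m l) + (if l = 1 then \<rho> 2 1 else - \<rho> 1 1)"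
        "\<And>l. dG 1 2 2 l = dG 2 1 2 l - (\<Sum>m\<in>UNIV. G 2 2 m * G 1 m l - G 1 2 m * G 2 m l) + (if l = 1 then \<rho> 2 2 else - \<rho> 1 2)"
    and dgam: "dgam 1 1 2 = dgam 2 1 1 - (\<Sum>m\<in>UNIV. G 2 1 m * gam 1 m - G 1 1 m * gam 2 m) + (xi 1 * \<rho> 2 1 - xi 2 * \<rho> 1 1)"
        "dgam 1 2 2 = dgam 2 1 2 - (\<Sum>m\<in>UNIV. G 2 2 m * gam 1 m - G 1 2 m * gam 2 m) + (xi 1 * \<rho> 2 2 - xi 2 * \<rho> 1 2)"
    and d\<rho>: "\<And>i j k. d\<rho> i j k = r i j k + (\<Sum>m\<in>UNIV. G i j m * \<rho> m k + G i k m * \<rho> j m)"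
    and ddgam: "ddgam 1 1 2 2 = 2 * ddgam 2 1 1 2 - ddgam 2 2 1 1
        - (\<Sum>m\<in>UNIV. dG 1 2 2 m * gam 1 m + G 2 2 m * dgam 1 1 m - dG 1 1 2 m * gam 2 m - G 1 2 m * dgam 1 2 m)
        + (\<Sum>m\<in>UNIV. dG 2 1 2 m * gam 1 m + G 1 2 m * dgam 2 1 m - dG 2 1 1 m * gam 2 m - G 1 1 m * dgam 2 2 m)
        + xi 1 * d\<rho> 1 2 2 - xi 2 * d\<rho> 1 1 2 - xi 1 * d\<rho> 2 2 1 + xi 2 * d\<rho> 2 1 1"
    and C: "\<And>i j. C i j = (if j = 1 then \<rho> 2 i else - \<rho> 1 i)
        + 1/2 * (\<Sum>m\<in>UNIV. gam 1 m * H m j 2 i - gam 2 m * H m j 1 i)"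
    and H: "\<And>i l j k. H i l j k = T i j * T l k + T l j * T i k"
    and M: "\<And>j k. M j k = 2 * \<rho> j k + (\<Sum>i\<in>UNIV. \<Sum>l\<in>UNIV. F i l * T i j * T l k)"
    and ch: "\<And>i j k. ch i j k = 1/2 * (dA i j k + dA j i k - dA k i j)"
  shows "1/2 * ddA 1 1 2 2 - (ddA 2 1 1 2 - 1/2 * ddA 2 2 1 1)
     - ((\<Sum>k\<in>UNIV. (- 1/2 * fA k 1 2) * ch 1 2 k) + (\<Sum>k\<in>UNIV. (ch 1 2 k + 1/2 * (\<Sum>m\<in>UNIV. A k m * fA m 1 2)) * (- 1/2 * fA k 1 2)))
     + ((\<Sum>k\<in>UNIV. (- 1/2 * fA k 1 1) * ch 2 2 k) + (\<Sum>k\<in>UNIV. (ch 1 1 k + 1/2 * (\<Sum>m\<in>UNIV. A k m * fA m 1 1)) * (- 1/2 * fA k 2 2)))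
     - 1/2 * (\<Sum>j\<in>UNIV. A 2 j * C 1 j) + 1/2 * (\<Sum>j\<in>UNIV. A 1 j * C 2 j)
     - 1/2 * M 1 2 * A 1 2 + 1/4 * M 1 1 * A 2 2 + 1/4 * M 2 2 * A 1 1
     = xi 2 * (r 1 1 2 - r 2 1 1) - xi 1 * (r 1 2 2 - r 2 1 2)
       + 1/4 * ((\<Sum>k\<in>UNIV. F 2 k * T k 1) - (\<Sum>k\<in>UNIV. F 1 k * T k 2))\<^sup>2
       + N * v 1 * (F 1 1 * v 1 + F 1 2 * v 2)"
  apply (simp only: ch ddA dA fA A sum_2 ddgam d\<rho> ddF dF ddt dt dT dgam dG sym gam C M H \<rho> t T \<theta>)
  apply (simp only: refl if_True if_False two_neq_one)
  apply algebra
  done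

text \<open>The rows of the symmetric matrix are orthogonal to \<open>v\<close>, hence multiples of \<open>(v2, - v1)\<close>.\<close>

lemma symmetric_rank_one:
  fixes a b d v1 v2 :: real
  assumes "a * v1 + b * v2 = 0" "b * v1 + d * v2 = 0" "v1 \<noteq> 0 \<or> v2 \<noteq> 0"
  obtains N where "a = N * v2 * v2" "b = - N * v1 * v2" "d = N * v1 * v1"
proof -
  have pos: "v1 * v1 + v2 * v2 \<noteq> 0"
    using assms(3) by (simp add: sum_squares_eq_zero_iff)
  define N where "N = (a + d) / (v1 * v1 + v2 * v2)"
  have N: "N * (v1 * v1 + v2 * v2) = a + d"
    using pos by (simp add: N_def)
  show thesis
  proof (rule that[of N])
    show "a = N * v2 * v2" "b = - N * v1 * v2" "d = N * v1 * v1"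
      using N pos assms(1,2) by algebra+
  qed
qed

context parallel_surface
begin

text \<open>A symmetric form that kills the image of \<open>T\<close> descends to the quotient by \<open>v\<close>, which is
  one-dimensional.  This applies to \<open>\<rho>\<close> and to each \<open>D\<^sub>i\<rho>\<close>.\<close>

lemma kills_T_imp_rank_one:
  fixes v \<theta> :: "2 \<Rightarrow> real"
  assumes x: "x \<in> X" and T: "c \<noteq> 0" "v 1 \<noteq> 0 \<or> v 2 \<noteq> 0" "\<theta> 1 = v 2" "\<theta> 2 = - v 1" "\<And>k j. T x $ k $ j = c * v k * \<theta> j"
    and sym: "B 2 1 = B 1 2" and BT: "\<And>j k. (\<Sum>m\<in>UNIV. B j m * T x $ m $ k) = 0"
  obtains N where "\<And>j k. B j k = N * \<theta> j * \<theta> k"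
proof -
  have "B j 1 * v 1 + B j 2 * v 2 = 0" for j
  proof -
    have "(B j 1 * v 1 + B j 2 * v 2) * (c * \<theta> k) = 0" for k
      using BT[of j k] unfolding sum_2 T(5) by algebra
    from this[of 1] this[of 2] show ?thesis
      using T(1,2) unfolding T(3,4) by (metis mult_eq_0_iff neg_equal_0_iff_equal)
  qed
  from this[of 1] this[of 2] sym have "B 1 1 * v 1 + B 1 2 * v 2 = 0" "B 1 2 * v 1 + B 2 2 * v 2 = 0"
    by simp_all
  then obtain N where N: "B 1 1 = N * v 2 * v 2" "B 1 2 = - N * v 1 * v 2" "B 2 2 = N * v 1 * v 1"
    using T(2) by (rule symmetric_rank_one)
  have "\<forall>j k. B j k = N * \<theta> j * \<theta> k"
    unfolding forall_2 T(3,4) using N sym by simp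
  then show thesis using that by blast
qed

text \<open>The definition of the curvature, solved for derivatives in the first coordinate direction.  The
  right-hand sides contain derivatives in the second direction only; substituting these equations
  leaves first derivatives of \<open>\<Gamma>\<close> that are independent of each other.\<close>

lemma pd_\<Gamma>_curv:
  assumes "x \<in> X"
  shows "pd 1 (\<lambda>x. \<Gamma> x 1 2 l) x = pd 2 (\<lambda>x. \<Gamma> x 1 1 l) x
       - (\<Sum>m\<in>UNIV. \<Gamma> x 2 1 m * \<Gamma> x 1 m l - \<Gamma> x 1 1 m * \<Gamma> x 2 m l) + (if l = 1 then \<rho> x $ 2 $ 1 else - \<rho> x $ 1 $ 1)"
    "pd 1 (\<lambda>x. \<Gamma> x 2 2 l) x = pd 2 (\<lambda>x. \<Gamma> x 1 2 l) x
       - (\<Sum>m\<in>UNIV. \<Gamma> x 2 2 m * \<Gamma> x 1 m l - \<Gamma> x 1 2 m * \<Gamma> x 2 m l) + (if l = 1 then \<rho> x $ 2 $ 2 else - \<rho> x $ 1 $ 2)"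
proof -
  have "curv \<Gamma> x 1 2 k l = (if l = 1 then \<rho> x $ 2 $ k else - \<rho> x $ 1 $ k)" for k
    using exhaust_2[of l] by (auto simp: curv_ricci)
  from this[of 1] this[of 2] show
    "pd 1 (\<lambda>x. \<Gamma> x 1 2 l) x = pd 2 (\<lambda>x. \<Gamma> x 1 1 l) x
       - (\<Sum>m\<in>UNIV. \<Gamma> x 2 1 m * \<Gamma> x 1 m l - \<Gamma> x 1 1 m * \<Gamma> x 2 m l) + (if l = 1 then \<rho> x $ 2 $ 1 else - \<rho> x $ 1 $ 1)"
    "pd 1 (\<lambda>x. \<Gamma> x 2 2 l) x = pd 2 (\<lambda>x. \<Gamma> x 1 2 l) x
       - (\<Sum>m\<in>UNIV. \<Gamma> x 2 2 m * \<Gamma> x 1 m l - \<Gamma> x 1 2 m * \<Gamma> x 2 m l) + (if l = 1 then \<rho> x $ 2 $ 2 else - \<rho> x $ 1 $ 2)"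
    unfolding curv_def pd_\<Gamma>_sym[OF assms, of _ 2 1] by linarith+
qed

text \<open>The component \<open>R\<^sub>1\<^sub>2\<^sub>1\<^sub>2\<close> of the metric contains second derivatives of \<open>\<Gamma>\<close>, but only in the combination
  \<open>\<partial>\<^sub>1\<partial>\<^sub>1\<Gamma>\<^sub>2\<^sub>2 - 2 \<partial>\<^sub>1\<partial>\<^sub>2\<Gamma>\<^sub>1\<^sub>2 + \<partial>\<^sub>2\<partial>\<^sub>2\<Gamma>\<^sub>1\<^sub>1\<close>, which is a derivative of the curvature up to first-order terms.\<close>

lemma pd_pd_\<Gamma>_curv:
  assumes x: "x \<in> X"
  shows "pd 1 (pd 1 (\<lambda>x. \<Gamma> x 2 2 l)) x = 2 * pd 2 (pd 1 (\<lambda>x. \<Gamma> x 1 2 l)) x - pd 2 (pd 2 (\<lambda>x. \<Gamma> x 1 1 l)) x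
     - (\<Sum>m\<in>UNIV. pd 1 (\<lambda>x. \<Gamma> x 2 2 m) x * \<Gamma> x 1 m l + \<Gamma> x 2 2 m * pd 1 (\<lambda>x. \<Gamma> x 1 m l) x
         - pd 1 (\<lambda>x. \<Gamma> x 1 2 m) x * \<Gamma> x 2 m l - \<Gamma> x 1 2 m * pd 1 (\<lambda>x. \<Gamma> x 2 m l) x)
     + (\<Sum>m\<in>UNIV. pd 2 (\<lambda>x. \<Gamma> x 1 2 m) x * \<Gamma> x 1 m l + \<Gamma> x 1 2 m * pd 2 (\<lambda>x. \<Gamma> x 1 m l) x
         - pd 2 (\<lambda>x. \<Gamma> x 1 1 m) x * \<Gamma> x 2 m l - \<Gamma> x 1 1 m * pd 2 (\<lambda>x. \<Gamma> x 2 m l) x)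
     + (if l = 1 then pd 1 (\<lambda>x. \<rho> x $ 2 $ 2) x - pd 2 (\<lambda>x. \<rho> x $ 2 $ 1) x
        else - pd 1 (\<lambda>x. \<rho> x $ 1 $ 2) x + pd 2 (\<lambda>x. \<rho> x $ 1 $ 1) x)"
proof -
  note rules = pd_sum pd_add pd_diff pd_mult pd_minus diff_rules[OF x]
    differentiable_mult differentiable_diff differentiable_add differentiable_sum
  have 1: "pd 1 (pd 1 (\<lambda>x. \<Gamma> x 2 2 l)) x = pd 1 (\<lambda>x. pd 2 (\<lambda>x. \<Gamma> x 1 2 l) x
       - (\<Sum>m\<in>UNIV. \<Gamma> x 2 2 m * \<Gamma> x 1 m l - \<Gamma> x 1 2 m * \<Gamma> x 2 m l) + (if l = 1 then \<rho> x $ 2 $ 2 else - \<rho> x $ 1 $ 2)) x"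
    by (rule pd_cong[OF open_X x], rule pd_\<Gamma>_curv)
  have 2: "pd 2 (pd 1 (\<lambda>x. \<Gamma> x 1 2 l)) x = pd 2 (\<lambda>x. pd 2 (\<lambda>x. \<Gamma> x 1 1 l) x
       - (\<Sum>m\<in>UNIV. \<Gamma> x 2 1 m * \<Gamma> x 1 m l - \<Gamma> x 1 1 m * \<Gamma> x 2 m l) + (if l = 1 then \<rho> x $ 2 $ 1 else - \<rho> x $ 1 $ 1)) x"
    by (rule pd_cong[OF open_X x], rule pd_\<Gamma>_curv)
  have 3: "pd 1 (pd 2 (\<lambda>x. \<Gamma> x 1 2 l)) x = pd 2 (pd 1 (\<lambda>x. \<Gamma> x 1 2 l)) x"
    by (rule pd_commute[OF open_X smooth_\<Gamma> x])
  show ?thesis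
    using 1 2 3 by (cases "l = 1") (simp_all add: rules sum_2 pd_\<Gamma>_sym[OF x, of _ 2 1] torsion[OF x, of 2 1])
qed

text \<open>This is the curvature of \<open>D\<close> with a correction, which appears because \<open>\<partial>\<^sub>i\<close> differs from the horizontal
  lift \<open>\<partial>\<^sub>i + \<gamma>\<^sub>i\<^sub>j \<partial>\<^bsub>j'\<^esub>\<close> of \<open>\<partial>\<^sub>i\<close>.\<close>

lemma riemann_one_prime_base:
  assumes z: "z \<in> U"
  defines "x \<equiv> base z"
  shows "riemann g z (Inl 1) (Inl 2) (Inl i) (Inr j) = (if j = 1 then \<rho> x $ 2 $ i else - \<rho> x $ 1 $ i)
     + 1/2 * (\<Sum>m\<in>UNIV. \<gamma> 1 m z * (T x $ m $ 2 * T x $ j $ i + T x $ j $ 2 * T x $ m $ i)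
                      - \<gamma> 2 m z * (T x $ m $ 1 * T x $ j $ i + T x $ j $ 1 * T x $ m $ i))"
proof -
  have x: "x \<in> X" using z by (simp add: x_def U_def)
  obtain c v \<theta> where T: "c \<noteq> 0" "v 1 \<noteq> 0 \<or> v 2 \<noteq> 0"
    "\<theta> 1 = v 2" "\<theta> 2 = - v 1" "\<And>k j. T x $ k $ j = c * v k * \<theta> j"
    by (rule T_rank_one[OF x]) blast
  have "\<forall>i j. riemann g z (Inl 1) (Inl 2) (Inl i) (Inr j) = (if j = 1 then \<rho> x $ 2 $ i else - \<rho> x $ 1 $ i)
     + 1/2 * (\<Sum>m\<in>UNIV. \<gamma> 1 m z * (T x $ m $ 2 * T x $ j $ i + T x $ j $ 2 * T x $ m $ i)
                      - \<gamma> 2 m z * (T x $ m $ 1 * T x $ j $ i + T x $ j $ 1 * T x $ m $ i))"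
    unfolding forall_2
    apply (simp only: riemann_one_prime[OF z] pd_pd_A[OF z] pd_A[OF z] fA_def d\<tau>_def dT_def \<tau>_def \<gamma>_def x_def[symmetric] sum_2
      pd_\<Gamma>_sym[OF x, of _ 2 1] torsion[OF x, of 2 1] pd_\<Gamma>_curv[OF x] refl if_True if_False two_neq_one T(3-5) simp_thms)
    apply (intro conjI; algebra)
    done
  then show ?thesis by blast
qed

text \<open>Both sums are built from \<open>T\<^sup>2\<close> and the trace of \<open>T\<close>, which vanish; the second one contains in addition
  the skew part of \<open>\<rho>\<close>.\<close>

lemma trace_conditions:
  assumes z: "z \<in> U"
  shows "(\<Sum>i\<in>UNIV. pd (Inr i) (pd (Inr j) (A i k)) z) = 0"
    "(\<Sum>i\<in>UNIV. riemann g z (Inl 1) (Inl 2) (Inl i) (Inr i)) = 0"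
proof -
  have x: "base z \<in> X" using z by (simp add: U_def)
  obtain c v \<theta> where T: "c \<noteq> 0" "v 1 \<noteq> 0 \<or> v 2 \<noteq> 0"
    "\<theta> 1 = v 2" "\<theta> 2 = - v 1" "\<And>k j. T (base z) $ k $ j = c * v k * \<theta> j"
    by (rule T_rank_one[OF x]) blast
  show "(\<Sum>i\<in>UNIV. pd (Inr i) (pd (Inr j) (A i k)) z) = 0"
    by (simp only: pd_pd_A[OF z] sum_2 T(3-5)) algebra
  show "(\<Sum>i\<in>UNIV. riemann g z (Inl 1) (Inl 2) (Inl i) (Inr i)) = 0"
    by (simp only: riemann_one_prime_base[OF z] sum_2 T(3-5) refl if_True if_False two_neq_one \<rho>_sym[OF x, of 2 1]) algebra
qed

lemma ricci_base:
  assumes z: "z \<in> U"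
  defines "x \<equiv> base z"
  shows "ricci (levi_civita g) z $ Inl j $ Inl k =
    2 * \<rho> x $ j $ k + (\<Sum>i\<in>UNIV. \<Sum>l\<in>UNIV. \<Phi> x $ i $ l * T x $ i $ j * T x $ l $ k)"
proof -
  have x: "x \<in> X" using z by (simp add: U_def x_def)
  obtain c v \<theta> where T: "c \<noteq> 0" "v 1 \<noteq> 0 \<or> v 2 \<noteq> 0"
    "\<theta> 1 = v 2" "\<theta> 2 = - v 1" "\<And>k j. T x $ k $ j = c * v k * \<theta> j"
    by (rule T_rank_one[OF x]) blast
  have "\<forall>j k. ricci (levi_civita g) z $ Inl j $ Inl k =
    2 * \<rho> x $ j $ k + (\<Sum>i\<in>UNIV. \<Sum>l\<in>UNIV. \<Phi> x $ i $ l * T x $ i $ j * T x $ l $ k)"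
    unfolding forall_2
    apply (simp only: ricci_g[OF z] sum_2 riemann_LLLL[OF z] riemann_one_prime_base[OF z] pd_pd_A[OF z]
      refl if_True if_False two_neq_one x_def[symmetric] A_def \<tau>_def \<gamma>_def T(3-5) \<rho>_sym[OF x, of 2 1] torsion[OF x, of 2 1] \<Phi>_sym[OF x, of 2 1])
    apply (intro conjI; algebra)
    done
  then show ?thesis by blast
qed

text \<open>On each fibre this is an affine function of the covector.  The linear part is the skew part of
  \<open>D\<rho>\<close> in its first two arguments, a derivative of the curvature contributed by the second derivatives
  of \<open>\<gamma>\<close>; the constant comes from the terms quadratic in \<open>\<Phi>\<close> and \<open>T\<close>.\<close>

lemma self_dual_block_eq:
  assumes z: "z \<in> U"
  defines "x \<equiv> base z" and "r \<equiv> cov02 \<Gamma> \<rho> (base z)"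
  shows "self_dual_block z = z $ Inr 2 * (r 1 1 2 - r 2 1 1) - z $ Inr 1 * (r 1 2 2 - r 2 1 2)
     + 1/4 * ((\<Sum>k\<in>UNIV. \<Phi> x $ 2 $ k * T x $ k $ 1) - (\<Sum>k\<in>UNIV. \<Phi> x $ 1 $ k * T x $ k $ 2))\<^sup>2"
proof -
  have x: "x \<in> X" using z by (simp add: U_def x_def)
  obtain c v \<theta> where T: "c \<noteq> 0" "v 1 \<noteq> 0 \<or> v 2 \<noteq> 0"
    "\<theta> 1 = v 2" "\<theta> 2 = - v 1" "\<And>k j. T x $ k $ j = c * v k * \<theta> j"
    by (rule T_rank_one[OF x]) blast
  obtain N where N: "\<And>j k. \<rho> x $ j $ k = N * \<theta> j * \<theta> k"
    by (rule kills_T_imp_rank_one[OF x T, of "\<lambda>j k. \<rho> x $ j $ k"]) (auto simp: \<rho>_sym[OF x, of 2 1] \<rho>_T[OF x])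
  note sym = pd_\<Gamma>_sym[OF x, of _ 2 1] torsion[OF x, of 2 1] \<Phi>_sym[OF x, of 2 1]
  have N\<Phi>: "N * v 1 * (\<Phi> x $ 1 $ 1 * v 1 + \<Phi> x $ 1 $ 2 * v 2) = 0"
  proof (cases "v 1 = 0")
    case False
    have "\<forall>i j. (\<Sum>m\<in>UNIV. curv \<Gamma> x 1 2 i m * \<Phi> x $ m $ j + curv \<Gamma> x 1 2 j m * \<Phi> x $ i $ m) = 0"
      using curv_annihilates_\<Phi>[OF x] by blast
    then show ?thesis
      unfolding forall_2 sum_2 curv_ricci N sym T(3,4) using False by algebra
  qed simp
  let ?H = "\<lambda>i l j k. T x $ i $ j * T x $ l $ k + T x $ l $ j * T x $ i $ k"
  let ?C = "\<lambda>i j. (if j = 1 then \<rho> x $ 2 $ i else - \<rho> x $ 1 $ i)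
        + 1/2 * (\<Sum>m\<in>UNIV. \<gamma> 1 m z * ?H m j 2 i - \<gamma> 2 m z * ?H m j 1 i)"
  let ?M = "\<lambda>j k. 2 * \<rho> x $ j $ k + (\<Sum>i\<in>UNIV. \<Sum>l\<in>UNIV. \<Phi> x $ i $ l * T x $ i $ j * T x $ l $ k)"
  let ?ch = "\<lambda>i j k. 1/2 * (dA i j k z + dA j i k z - dA k i j z)"
  have R: "riemann g z (Inl 1) (Inl 2) (Inl 1) (Inl 2) = 1/2 * ddA 1 1 2 2 z - (ddA 2 1 1 2 z - 1/2 * ddA 2 2 1 1 z)
     - ((\<Sum>k\<in>UNIV. (- 1/2 * fA k 1 2 z) * ?ch 1 2 k) + (\<Sum>k\<in>UNIV. (?ch 1 2 k + 1/2 * (\<Sum>m\<in>UNIV. A k m z * fA m 1 2 z)) * (- 1/2 * fA k 1 2 z)))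
     + ((\<Sum>k\<in>UNIV. (- 1/2 * fA k 1 1 z) * ?ch 2 2 k) + (\<Sum>k\<in>UNIV. (?ch 1 1 k + 1/2 * (\<Sum>m\<in>UNIV. A k m z * fA m 1 1 z)) * (- 1/2 * fA k 2 2 z)))"
    apply (simp only: riemann_g[OF z] pd_christoffel1_g[OF z] sum_UNIV_Plus)
    apply (simp only: christoffel1_g levi_civita_g pd_pd_A[OF z, symmetric] pd_A[OF z, symmetric] sum_2
       pd_A_sym[OF z, of _ 2 1] pd_pd_A_sym[OF z, of _ _ 2 1] A_sym[OF z, of 2 1]
       pd_pd_A_commute[OF z, of "Inl 1" "Inl 2"])
    apply algebra
    done
  have "self_dual_block z = z $ Inr 2 * (r 1 1 2 - r 2 1 1) - z $ Inr 1 * (r 1 2 2 - r 2 1 2)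
     + 1/4 * ((\<Sum>k\<in>UNIV. \<Phi> x $ 2 $ k * T x $ k $ 1) - (\<Sum>k\<in>UNIV. \<Phi> x $ 1 $ k * T x $ k $ 2))\<^sup>2
     + N * v 1 * (\<Phi> x $ 1 $ 1 * v 1 + \<Phi> x $ 1 $ 2 * v 2)"
    unfolding self_dual_block_def R riemann_one_prime_base[OF z, folded x_def] ricci_base[OF z, folded x_def]
  proof (rule self_dual_block_identity[where G = "\<Gamma> x" and dG = "\<lambda>a i j k. pd a (\<lambda>x. \<Gamma> x i j k) x"
      and gam = "\<lambda>i j. \<gamma> i j z" and F = "\<lambda>i j. \<Phi> x $ i $ j" and \<rho> = "\<lambda>i j. \<rho> x $ i $ j" and T = "\<lambda>k j. T x $ k $ j"
      and A = "\<lambda>i j. A i j z" and dgam = "\<lambda>a i j. d\<gamma> a i j z" and r = r and dF = "\<lambda>m i j. d\<Phi> m i j z"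
      and dT = "\<lambda>m k j. dT m k j z" and dA = "\<lambda>m i j. dA m i j z" and fA = "\<lambda>m i j. fA m i j z" and ch = ?ch
      and ddgam = "\<lambda>a m i j. dd\<gamma> a m i j z" and ddF = "\<lambda>a m i j. dd\<Phi> a m i j z" and ddA = "\<lambda>a m i j. ddA a m i j z"
      and \<theta> = \<theta> and t = "\<lambda>j. \<tau> j z" and xi = "\<lambda>k. z $ Inr k" and dt = "\<lambda>m j. d\<tau> m j z" and ddt = "\<lambda>a m j. dd\<tau> a m j z"
      and v = v and H = ?H and C = ?C and M = ?M and c = c and N = N and d\<rho> = "\<lambda>i j k. pd i (\<lambda>x. \<rho> x $ j $ k) x"])
    show "d\<gamma> 1 1 2 z = d\<gamma> 2 1 1 z - (\<Sum>m\<in>UNIV. \<Gamma> x 2 1 m * \<gamma> 1 m z - \<Gamma> x 1 1 m * \<gamma> 2 m z)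
        + (z $ Inr 1 * \<rho> x $ 2 $ 1 - z $ Inr 2 * \<rho> x $ 1 $ 1)"
      "d\<gamma> 1 2 2 z = d\<gamma> 2 1 2 z - (\<Sum>m\<in>UNIV. \<Gamma> x 2 2 m * \<gamma> 1 m z - \<Gamma> x 1 2 m * \<gamma> 2 m z)
        + (z $ Inr 1 * \<rho> x $ 2 $ 2 - z $ Inr 2 * \<rho> x $ 1 $ 2)"
      by (simp_all only: d\<gamma>_def \<gamma>_def x_def[symmetric] pd_\<Gamma>_curv[OF x] sum_2 refl if_True if_False two_neq_one) algebra+
    show "dd\<gamma> 1 1 2 2 z = 2 * dd\<gamma> 2 1 1 2 z - dd\<gamma> 2 2 1 1 z
        - (\<Sum>m\<in>UNIV. pd 1 (\<lambda>x. \<Gamma> x 2 2 m) x * \<gamma> 1 m z + \<Gamma> x 2 2 m * d\<gamma> 1 1 m z - pd 1 (\<lambda>x. \<Gamma> x 1 2 m) x * \<gamma> 2 m z - \<Gamma> x 1 2 m * d\<gamma> 1 2 m z)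
        + (\<Sum>m\<in>UNIV. pd 2 (\<lambda>x. \<Gamma> x 1 2 m) x * \<gamma> 1 m z + \<Gamma> x 1 2 m * d\<gamma> 2 1 m z - pd 2 (\<lambda>x. \<Gamma> x 1 1 m) x * \<gamma> 2 m z - \<Gamma> x 1 1 m * d\<gamma> 2 2 m z)
        + z $ Inr 1 * pd 1 (\<lambda>x. \<rho> x $ 2 $ 2) x - z $ Inr 2 * pd 1 (\<lambda>x. \<rho> x $ 1 $ 2) x - z $ Inr 1 * pd 2 (\<lambda>x. \<rho> x $ 2 $ 1) x + z $ Inr 2 * pd 2 (\<lambda>x. \<rho> x $ 1 $ 1) x"
      by (simp only: dd\<gamma>_def d\<gamma>_def \<gamma>_def x_def[symmetric] pd_pd_\<Gamma>_curv[OF x] sum_2 refl if_True if_False two_neq_one) algebra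
    show "\<tau> j z = c * (z $ Inr 1 * v 1 + z $ Inr 2 * v 2) * \<theta> j" for j
      by (simp add: \<tau>_def sum_2 T(5) algebra_simps flip: x_def)
    show "\<gamma> i j z = z $ Inr 1 * \<Gamma> x i j 1 + z $ Inr 2 * \<Gamma> x i j 2" for i j
      by (simp add: \<gamma>_def sum_2 flip: x_def)
    show "r a 2 1 = r a 1 2" for a
      using cov02_\<rho>_sym[OF x] by (simp add: r_def x_def)
    show "d\<gamma> a 2 1 z = d\<gamma> a 1 2 z" for a
      using sym by (simp add: d\<gamma>_def flip: x_def)
    show "pd i (\<lambda>x. \<rho> x $ j $ k) x = r i j k + (\<Sum>m\<in>UNIV. \<Gamma> x i j m * \<rho> x $ m $ k + \<Gamma> x i k m * \<rho> x $ j $ m)" for i j k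
      by (simp add: pd_\<rho> r_def x_def)
  qed (simp_all only: sym T(3-5) N pd_\<Gamma>_curv[OF x] dT_def d\<tau>_def dd\<tau>_def d\<Phi>_def dd\<Phi>_def A_def dA_def fA_def ddA_def x_def[symmetric])
  then show ?thesis
    using N\<Phi> by simp
qed

end

section \<open>Anti-self-duality and the Codazzi equation\<close>

context parallel_surface
begin

text \<open>As \<open>\<rho>\<close> is symmetric, this says that \<open>D\<rho>\<close> is totally symmetric.\<close>

definition codazzi_ricci :: "real^2 \<Rightarrow> bool" where
  "codazzi_ricci x \<longleftrightarrow> (\<forall>i j k. cov02 \<Gamma> \<rho> x i j k = cov02 \<Gamma> \<rho> x j i k)"

lemma codazzi_ricci_iff:
  assumes "x \<in> X"
  shows "codazzi_ricci x \<longleftrightarrow> cov02 \<Gamma> \<rho> x 1 1 2 = cov02 \<Gamma> \<rho> x 2 1 1 \<and> cov02 \<Gamma> \<rho> x 1 2 2 = cov02 \<Gamma> \<rho> x 2 1 2"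
  unfolding codazzi_ricci_def forall_2 using cov02_\<rho>_sym[OF assms, of _ 2 1] by auto

text \<open>For \<open>T = c v \<otimes> \<theta>\<close> both sides say that \<open>\<Phi>(v,v) = 0\<close>.\<close>

lemma hat2_zero_iff:
  assumes x: "x \<in> X"
  shows "(\<forall>Y Z. hat2 (\<Phi> x) (T x) Y Z = 0) \<longleftrightarrow>
    (\<Sum>k\<in>UNIV. \<Phi> x $ 2 $ k * T x $ k $ 1) = (\<Sum>k\<in>UNIV. \<Phi> x $ 1 $ k * T x $ k $ 2)"
    (is "?L \<longleftrightarrow> ?R")
proof -
  obtain c v \<theta> where T: "c \<noteq> 0" "v 1 \<noteq> 0 \<or> v 2 \<noteq> 0"
    "\<theta> 1 = v 2" "\<theta> 2 = - v 1" "\<And>k j. T x $ k $ j = c * v k * \<theta> j"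
    by (rule T_rank_one[OF x]) blast
  define q where "q = \<Phi> x $ 1 $ 1 * v 1 * v 1 + 2 * \<Phi> x $ 1 $ 2 * v 1 * v 2 + \<Phi> x $ 2 $ 2 * v 2 * v 2"
  have h: "hat2 (\<Phi> x) (T x) Y Z = c\<^sup>2 * (\<theta> 1 * Y $ 1 + \<theta> 2 * Y $ 2) * (\<theta> 1 * Z $ 1 + \<theta> 2 * Z $ 2) * q" for Y Z
    unfolding hat2_def inner_vec_def matrix_vector_mult_def q_def
    by (simp add: sum_2 T(5) \<Phi>_sym[OF x, of 2 1] power2_eq_square algebra_simps)
  have "?R \<longleftrightarrow> c * q = 0"
    unfolding sum_2 T(3-5) q_def \<Phi>_sym[OF x, of 2 1] by algebra
  also have "\<dots> \<longleftrightarrow> q = 0"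
    using T(1) by simp
  also have "\<dots> \<longleftrightarrow> ?L"
  proof
    assume ?L
    then have "hat2 (\<Phi> x) (T x) (\<chi> j. \<theta> j) (\<chi> j. \<theta> j) = 0"
      by blast
    then have "c\<^sup>2 * (v 1 * v 1 + v 2 * v 2)\<^sup>2 * q = 0"
      by (simp add: h T(3,4) power2_eq_square algebra_simps)
    moreover have "v 1 * v 1 + v 2 * v 2 \<noteq> 0"
      using T(2) by (simp add: sum_squares_eq_zero_iff)
    ultimately show "q = 0"
      using T(1) by (metis mult_eq_0_iff power_eq_0_iff)
  qed (simp add: h)
  finally show ?thesis by blast
qed

text \<open>An affine function on the fibre vanishes if and only if its linear part and its constant do.\<close>

lemma weyl_plus_zero_over_point_iff:
  assumes x: "x \<in> X"
  shows "(\<forall>z. base z = x \<longrightarrow> (\<forall>B. self_dual (g z) (vol z) B \<longrightarrow> bivector_op (g z) (weyl g z) B = 0)) \<longleftrightarrow>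
    codazzi_ricci x \<and> (\<forall>Y Z. hat2 (\<Phi> x) (T x) Y Z = 0)"
proof -
  define r where "r = cov02 \<Gamma> \<rho> x"
  define p where "p = (\<Sum>k\<in>UNIV. \<Phi> x $ 2 $ k * T x $ k $ 1) - (\<Sum>k\<in>UNIV. \<Phi> x $ 1 $ k * T x $ k $ 2)"
  have block: "(\<forall>B. self_dual (g z) (vol z) B \<longrightarrow> bivector_op (g z) (weyl g z) B = 0) \<longleftrightarrow>
      z $ Inr 2 * (r 1 1 2 - r 2 1 1) - z $ Inr 1 * (r 1 2 2 - r 2 1 2) + 1/4 * p\<^sup>2 = 0"
    if "base z = x" for z
  proof -
    have z: "z \<in> U" using that x by (simp add: U_def)
    show ?thesis
      unfolding weyl_plus_zero_iff[OF z trace_conditions[OF z]] self_dual_block_eq[OF z] that r_def p_def ..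
  qed
  have "(\<forall>z. base z = x \<longrightarrow> (\<forall>B. self_dual (g z) (vol z) B \<longrightarrow> bivector_op (g z) (weyl g z) B = 0)) \<longleftrightarrow>
     (\<forall>z. base z = x \<longrightarrow> z $ Inr 2 * (r 1 1 2 - r 2 1 1) - z $ Inr 1 * (r 1 2 2 - r 2 1 2) + 1/4 * p\<^sup>2 = 0)"
    using block by blast
  also have "\<dots> \<longleftrightarrow> r 1 1 2 = r 2 1 1 \<and> r 1 2 2 = r 2 1 2 \<and> p = 0"
  proof
    assume *: "\<forall>z. base z = x \<longrightarrow> z $ Inr 2 * (r 1 1 2 - r 2 1 1) - z $ Inr 1 * (r 1 2 2 - r 2 1 2) + 1/4 * p\<^sup>2 = 0"
    have "s * (r 1 1 2 - r 2 1 1) - t * (r 1 2 2 - r 2 1 2) + 1/4 * p\<^sup>2 = 0" for s t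
      using *[rule_format, of "induced x (\<chi> k. if k = 1 then t else s)"] by (simp add: induced_def base_def)
    from this[of 0 0] this[of 1 0] this[of 0 1] show "r 1 1 2 = r 2 1 1 \<and> r 1 2 2 = r 2 1 2 \<and> p = 0"
      by simp
  qed simp
  finally show ?thesis
    unfolding codazzi_ricci_iff[OF x] hat2_zero_iff[OF x] r_def p_def by simp
qed

text \<open>Here \<open>\<rho> = N \<theta> \<otimes> \<theta>\<close> and \<open>D\<^sub>i\<rho> = s\<^sub>i \<theta> \<otimes> \<theta>\<close>, so \<open>\<omega> = s/N\<close>.  The Codazzi equation is \<open>s \<and> \<theta> = 0\<close>, that is
  \<open>s(v) = 0\<close>.\<close>

lemma hat1_zero_iff:
  assumes x: "x \<in> X" and "\<rho> x \<noteq> 0"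
  shows "(\<forall>Y. hat1 (recurrence_form \<Gamma> x) (T x) Y = 0) \<longleftrightarrow> codazzi_ricci x"
proof -
  obtain c v \<theta> where T: "c \<noteq> 0" "v 1 \<noteq> 0 \<or> v 2 \<noteq> 0"
    "\<theta> 1 = v 2" "\<theta> 2 = - v 1" "\<And>k j. T x $ k $ j = c * v k * \<theta> j"
    by (rule T_rank_one[OF x]) blast
  obtain N where N: "\<And>j k. \<rho> x $ j $ k = N * \<theta> j * \<theta> k"
    by (rule kills_T_imp_rank_one[OF x T, of "\<lambda>j k. \<rho> x $ j $ k"]) (auto simp: \<rho>_sym[OF x, of 2 1] \<rho>_T[OF x])
  have "N \<noteq> 0"
    using assms(2) N by (auto simp: vec_eq_iff)
  have "\<exists>s. \<forall>j k. cov02 \<Gamma> \<rho> x i j k = s * \<theta> j * \<theta> k" for i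
    by (rule kills_T_imp_rank_one[OF x T, of "cov02 \<Gamma> \<rho> x i"]) (auto simp: cov02_\<rho>_sym[OF x, of i 2 1] cov02_\<rho>_T[OF x])
  then obtain s where s: "\<And>i j k. cov02 \<Gamma> \<rho> x i j k = s i * \<theta> j * \<theta> k"
    by metis
  obtain m where m: "\<theta> m \<noteq> 0"
    using T(2-4) by (metis neg_equal_0_iff_equal)
  define w :: "real^2" where "w = (\<chi> i. s i / N)"
  have "recurrence_form \<Gamma> x = w"
    unfolding recurrence_form_def
  proof (rule the_equality)
    show "\<forall>i j k. cov02 \<Gamma> \<rho> x i j k = w $ i * \<rho> x $ j $ k"
      using \<open>N \<noteq> 0\<close> by (simp add: s N w_def)
    fix w' assume "\<forall>i j k. cov02 \<Gamma> \<rho> x i j k = w' $ i * \<rho> x $ j $ k"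
    then have "s i * \<theta> m * \<theta> m = w' $ i * (N * \<theta> m * \<theta> m)" for i
      by (metis s N)
    then show "w' = w"
      using m \<open>N \<noteq> 0\<close> by (simp add: vec_eq_iff w_def field_simps)
  qed
  have hat: "hat1 w (T x) Y = c / N * (s 1 * v 1 + s 2 * v 2) * (\<theta> 1 * Y $ 1 + \<theta> 2 * Y $ 2)" for Y
    unfolding hat1_def inner_vec_def matrix_vector_mult_def using \<open>N \<noteq> 0\<close>
    by (simp add: sum_2 w_def T(5) field_simps)
  have "(\<forall>Y. hat1 w (T x) Y = 0) \<longleftrightarrow> s 1 * v 1 + s 2 * v 2 = 0"
  proof
    assume "\<forall>Y. hat1 w (T x) Y = 0"
    then have "hat1 w (T x) (axis m 1) = 0" by blast
    then show "s 1 * v 1 + s 2 * v 2 = 0"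
      using T(1) \<open>N \<noteq> 0\<close> m exhaust_2[of m] by (auto simp: hat axis_def)
  qed (simp add: hat)
  also have "\<dots> \<longleftrightarrow> codazzi_ricci x"
    unfolding codazzi_ricci_iff[OF x] s T(3,4)
  proof
    assume "s 1 * (v 2) * (- v 1) = s 2 * v 2 * v 2 \<and> s 1 * (- v 1) * (- v 1) = s 2 * v 2 * (- v 1)"
    then have "(s 1 * v 1 + s 2 * v 2) * v 2 = 0" "(s 1 * v 1 + s 2 * v 2) * v 1 = 0"
      by algebra+
    then show "s 1 * v 1 + s 2 * v 2 = 0"
      using T(2) by auto
  qed algebra
  finally show ?thesis
    using \<open>recurrence_form \<Gamma> x = w\<close> by simp
qed

text \<open>The set where the Codazzi equation fails is open.  By assumption \<open>\<rho>\<close> is zero on it, and then so is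
  \<open>D\<rho>\<close>.\<close>

lemma codazzi_ricci_extends:
  assumes "\<And>x. \<lbrakk>x \<in> X; \<rho> x \<noteq> 0\<rbrakk> \<Longrightarrow> codazzi_ricci x" and x: "x \<in> X"
  shows "codazzi_ricci x"
  unfolding codazzi_ricci_def
proof (intro allI, rule ccontr)
  fix i j k
  define f where "f y = cov02 \<Gamma> \<rho> y i j k - cov02 \<Gamma> \<rho> y j i k" for y
  assume "cov02 \<Gamma> \<rho> x i j k \<noteq> cov02 \<Gamma> \<rho> x j i k"
  then have "f x \<noteq> 0" by (simp add: f_def)
  have "smooth_on X f"
    unfolding f_def[abs_def] cov02_def by (simp add: smooth_rules smooth_\<rho>)
  then have "open (X \<inter> f -` (- {0}))"
    by (intro continuous_open_preimage smooth_on_imp_continuous_on open_X) auto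
  moreover have "\<rho> y = 0" if "y \<in> X \<inter> f -` (- {0})" for y
    using that assms(1)[of y] by (auto simp: f_def codazzi_ricci_def)
  moreover have "x \<in> X \<inter> f -` (- {0})"
    using x \<open>f x \<noteq> 0\<close> by simp
  ultimately have "\<rho> x = 0" and "pd a (\<lambda>y. \<rho> y $ b $ d) x = pd a (\<lambda>y. 0) x" for a b d
    using pd_cong[of "X \<inter> f -` (- {0})" x "\<lambda>y. \<rho> y $ b $ d" "\<lambda>y. 0" a] by (blast, simp)
  then have "f x = 0"
    by (simp add: f_def cov02_def pd_const)
  with \<open>f x \<noteq> 0\<close> show False ..
qed

end

section \<open>A parallel tensor field that does not vanish identically vanishes nowhere\<close>

text \<open>Gronwall's argument: the sum of the squares of the \<open>f i\<close> grows at most exponentially.\<close>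

lemma linear_ode_zero:
  fixes f D :: "'a::finite \<Rightarrow> real \<Rightarrow> real"
  assumes deriv: "\<And>i t. 0 \<le> t \<Longrightarrow> t \<le> 1 \<Longrightarrow> (f i has_real_derivative D i t) (at t)"
    and bound: "\<And>i t. 0 \<le> t \<Longrightarrow> t \<le> 1 \<Longrightarrow> \<bar>D i t\<bar> \<le> K * (\<Sum>j\<in>UNIV. \<bar>f j t\<bar>)"
    and zero: "\<And>i. f i 0 = 0"
  shows "f i 1 = 0"
proof -
  \<comment> \<open>The factor \<open>CARD('a)\<close> is the constant in the Cauchy-Schwarz inequality below.\<close>
  define L where "L = 2 * \<bar>K\<bar> * real CARD('a)"
  define h where "h t = exp (- L * t) * (\<Sum>i\<in>UNIV. (f i t)\<^sup>2)" for t
  have "h 1 \<le> h 0"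
  proof (rule DERIV_nonpos_imp_nonincreasing[of 0 1 h])
    fix t :: real assume t: "0 \<le> t" "t \<le> 1"
    let ?S = "\<Sum>j\<in>UNIV. \<bar>f j t\<bar>"
    have "(\<Sum>i\<in>UNIV. 2 * f i t * D i t) \<le> (\<Sum>i\<in>UNIV. 2 * \<bar>f i t\<bar> * (\<bar>K\<bar> * ?S))"
    proof (rule sum_mono)
      fix i
      have S: "0 \<le> ?S" by (rule sum_nonneg) simp
      have "2 * f i t * D i t \<le> 2 * \<bar>f i t\<bar> * \<bar>D i t\<bar>"
        by (metis abs_ge_self abs_mult abs_numeral)
      also have "\<dots> \<le> 2 * \<bar>f i t\<bar> * (\<bar>K\<bar> * ?S)"
        using bound[OF t, of i] mult_right_mono[OF abs_ge_self[of K] S]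
        by (intro mult_left_mono) auto
      finally show "2 * f i t * D i t \<le> 2 * \<bar>f i t\<bar> * (\<bar>K\<bar> * ?S)" .
    qed
    also have "\<dots> = 2 * \<bar>K\<bar> * ?S\<^sup>2"
      by (simp add: power2_eq_square sum_distrib_left sum_distrib_right mult_ac)
    also have "\<dots> \<le> 2 * \<bar>K\<bar> * (real CARD('a) * (\<Sum>j\<in>UNIV. \<bar>f j t\<bar>\<^sup>2))"
      using sum_squared_le_sum_of_squares[of "\<lambda>j. \<bar>f j t\<bar>" UNIV] by (intro mult_left_mono) (auto simp: mult.commute)
    finally have "(\<Sum>i\<in>UNIV. 2 * f i t * D i t) - L * (\<Sum>i\<in>UNIV. (f i t)\<^sup>2) \<le> 0"
      by (simp add: L_def)
    moreover have "(h has_real_derivative exp (- L * t) *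
        ((\<Sum>i\<in>UNIV. 2 * f i t * D i t) - L * (\<Sum>i\<in>UNIV. (f i t)\<^sup>2))) (at t)"
      unfolding h_def
      by (auto intro!: derivative_eq_intros deriv t simp: algebra_simps sum_distrib_left sum_subtractf)
    ultimately show "\<exists>y. (h has_real_derivative y) (at t) \<and> y \<le> 0"
      by (intro exI conjI) (auto simp: mult_nonneg_nonpos)
  qed simp
  also have "h 0 = 0"
    by (simp add: h_def zero)
  finally have "(\<Sum>i\<in>UNIV. (f i 1)\<^sup>2) \<le> 0"
    by (simp add: h_def mult_le_0_iff not_le)
  then have "(\<Sum>i\<in>UNIV. (f i 1)\<^sup>2) = 0"
    by (intro antisym sum_nonneg) auto
  then show ?thesis
    by (simp add: sum_nonneg_eq_0_iff)
qed

text \<open>Along a segment that starts at a zero of \<open>T\<close>, parallelism is a linear differential equation for the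
  entries of \<open>T\<close>, whose coefficients are bounded on a compact ball.\<close>

lemma parallel11_zero_set_open:
  fixes \<Gamma> :: "'n::finite christoffel" and T :: "real^'n \<Rightarrow> real^'n^'n"
  assumes X: "open X" and \<Gamma>: "\<And>i j k. continuous_on X (\<lambda>x. \<Gamma> x i j k)"
    and T: "\<And>x k j. x \<in> X \<Longrightarrow> (\<lambda>x. T x $ k $ j) differentiable at x"
    and par: "\<And>x i j k. x \<in> X \<Longrightarrow> cov11 \<Gamma> T x i j k = 0"
  shows "open {x \<in> X. T x = 0}"
proof (subst open_contains_ball, intro ballI)
  fix x assume "x \<in> {x \<in> X. T x = 0}"
  then have x: "x \<in> X" "T x = 0" by auto
  obtain e where e: "e > 0" "cball x e \<subseteq> X"
    using X x(1) open_contains_cball by blast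
  have "\<exists>B. \<forall>y\<in>cball x e. \<bar>\<Gamma> y i j k\<bar> \<le> B" for i j k
  proof -
    have "compact ((\<lambda>y. \<Gamma> y i j k) ` cball x e)"
      by (intro compact_continuous_image continuous_on_subset[OF \<Gamma> e(2)] compact_cball)
    then show ?thesis
      using compact_imp_bounded bounded_iff by (metis imageI real_norm_def)
  qed
  then obtain B0 where B0: "\<And>i j k y. y \<in> cball x e \<Longrightarrow> \<bar>\<Gamma> y i j k\<bar> \<le> B0 i j k"
    by metis
  define B where "B = (\<Sum>i\<in>UNIV. \<Sum>j\<in>UNIV. \<Sum>k\<in>UNIV. \<bar>B0 i j k\<bar>)"
  have B: "\<bar>\<Gamma> y i j k\<bar> \<le> B" if "y \<in> cball x e" for i j k y
  proof -
    have "\<bar>\<Gamma> y i j k\<bar> \<le> \<bar>B0 i j k\<bar>"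
      using B0[OF that, of i j k] by linarith
    also have "\<dots> \<le> (\<Sum>k\<in>UNIV. \<bar>B0 i j k\<bar>)"
      by (rule member_le_sum) auto
    also have "\<dots> \<le> (\<Sum>j\<in>UNIV. \<Sum>k\<in>UNIV. \<bar>B0 i j k\<bar>)"
      by (rule member_le_sum[of j UNIV "\<lambda>j. \<Sum>k\<in>UNIV. \<bar>B0 i j k\<bar>"]) (auto intro: sum_nonneg)
    also have "\<dots> \<le> B"
      unfolding B_def by (rule member_le_sum[of i UNIV "\<lambda>i. \<Sum>j\<in>UNIV. \<Sum>k\<in>UNIV. \<bar>B0 i j k\<bar>"]) (auto intro!: sum_nonneg)
    finally show ?thesis .
  qed
  have "T y = 0" if y: "y \<in> ball x e" for y
  proof -
    define d where "d = y - x"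
    have seg: "x + t *\<^sub>R d \<in> cball x e" if "0 \<le> t" "t \<le> 1" for t
    proof -
      have "dist x (x + t *\<^sub>R d) = t * dist x y"
        using that by (simp add: dist_norm d_def norm_minus_commute)
      also have "\<dots> \<le> 1 * dist x y"
        using that by (intro mult_right_mono) auto
      finally show ?thesis using y by simp
    qed
    define f where "f p t = T (x + t *\<^sub>R d) $ fst p $ snd p" for p :: "'n \<times> 'n" and t
    define D where "D p t = (\<Sum>m\<in>UNIV. d $ m * pd m (\<lambda>x. T x $ fst p $ snd p) (x + t *\<^sub>R d))" for p :: "'n \<times> 'n" and t
    define K where "K = (\<Sum>m\<in>(UNIV::'n set). \<bar>d $ m\<bar> * (\<Sum>l\<in>(UNIV::'n set). 2 * B))"
    have zero: "f p 1 = 0" for p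
    proof (rule linear_ode_zero[of f D K])
      fix p :: "'n \<times> 'n" and t :: real assume t: "0 \<le> t" "t \<le> 1"
      let ?y = "x + t *\<^sub>R d"
      have X: "?y \<in> X" using seg[OF t] e by blast
      show "(f p has_real_derivative D p t) (at t)"
        unfolding f_def D_def by (rule has_real_derivative_segment[OF T[OF X]])
      let ?S = "\<Sum>q\<in>UNIV. \<bar>f q t\<bar>"
      have S: "\<bar>T ?y $ a $ b\<bar> \<le> ?S" for a b
        using member_le_sum[of "(a, b)" UNIV "\<lambda>q. \<bar>f q t\<bar>"] by (simp add: f_def)
      obtain k j where p: "p = (k, j)" by (cases p)
      have pdT: "pd m (\<lambda>x. T x $ k $ j) ?y = (\<Sum>l\<in>UNIV. \<Gamma> ?y m j l * T ?y $ k $ l - \<Gamma> ?y m l k * T ?y $ l $ j)" for m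
        using par[OF X, of m j k] by (simp add: cov11_def sum_subtractf)
      have "\<bar>pd m (\<lambda>x. T x $ k $ j) ?y\<bar> \<le> (\<Sum>l\<in>(UNIV::'n set). 2 * B * ?S)" for m
        unfolding pdT
      proof (rule order_trans[OF sum_abs sum_mono])
        fix l
        have B0: "0 \<le> B" using B[OF seg[OF t], of m j l] by linarith
        have "\<bar>\<Gamma> ?y m j l * T ?y $ k $ l\<bar> \<le> B * ?S" "\<bar>\<Gamma> ?y m l k * T ?y $ l $ j\<bar> \<le> B * ?S"
          unfolding abs_mult by (intro mult_mono B seg t S B0 abs_ge_zero)+
        then show "\<bar>\<Gamma> ?y m j l * T ?y $ k $ l - \<Gamma> ?y m l k * T ?y $ l $ j\<bar> \<le> 2 * B * ?S"
          by linarith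
      qed
      then have "\<bar>D p t\<bar> \<le> (\<Sum>m\<in>UNIV. \<bar>d $ m\<bar> * (\<Sum>l\<in>(UNIV::'n set). 2 * B * ?S))"
        unfolding D_def p fst_conv snd_conv
        by (intro order_trans[OF sum_abs sum_mono]) (simp only: abs_mult mult_left_mono abs_ge_zero)
      also have "\<dots> = K * ?S"
        by (simp add: K_def sum_distrib_right mult.assoc)
      finally show "\<bar>D p t\<bar> \<le> K * ?S" .
    qed (use x in \<open>simp add: f_def\<close>)
    show "T y = 0"
      using zero[of "(_, _)"] by (simp add: f_def d_def vec_eq_iff)
  qed
  then show "\<exists>e>0. ball x e \<subseteq> {x \<in> X. T x = 0}"
    using e ball_subset_cball by blast
qed

lemma Jac_inverse:
  fixes S :: "('i, 'p, 'n::finite) atlas"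
  assumes S: "smooth_atlas S" and ab: "a \<in> charts S" "b \<in> charts S" and p: "p \<in> chart_dom S a" "p \<in> chart_dom S b"
  shows "Jac S b a (coord S b p) ** Jac S a b (coord S a p) = mat 1"
proof -
  have op: "open (overlap S c d)" and inj: "inj_on (coord S c) (chart_dom S c)"
    and sm: "\<And>k. smooth_on (overlap S c d) (\<lambda>x. transition S c d x $ k)"
    if "c \<in> charts S" "d \<in> charts S" for c d
    using S that by (auto simp: smooth_atlas_def)
  have tr: "transition S c d (coord S c q) = coord S d q"
    if "c \<in> charts S" "q \<in> chart_dom S c" for c d q
    using inj[OF that(1) that(1)] that(2) by (simp add: transition_def)
  have der: "(transition S c d has_derivative (\<lambda>h. Jac S c d (coord S c p) *v h)) (at (coord S c p))"
    if cd: "c \<in> charts S" "d \<in> charts S" and p: "p \<in> chart_dom S c" "p \<in> chart_dom S d" for c d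
  proof -
    have mem: "coord S c p \<in> overlap S c d"
      using p by (auto simp: overlap_def)
    have "(\<lambda>x. transition S c d x $ k) differentiable (at (coord S c p))" for k
      by (rule smooth_on_imp_differentiable[OF op[OF cd] sm[OF cd] mem])
    then have "transition S c d differentiable (at (coord S c p))"
      by (subst differentiable_componentwise_within) (auto simp: Basis_vec_def inner_axis)
    then show ?thesis
      by (simp add: Jac_def jacobian_works)
  qed
  have "(transition S b a has_derivative (\<lambda>h. Jac S b a (coord S b p) *v h)) (at (transition S a b (coord S a p)))"
    using der[OF ab(2,1) p(2,1)] tr[OF ab(1) p(1)] by simp
  note D = has_derivative_compose[OF der[OF ab p] this]
  have "((\<lambda>x. x) has_derivative (\<lambda>h. Jac S b a (coord S b p) *v (Jac S a b (coord S a p) *v h))) (at (coord S a p))"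
  proof (rule has_derivative_transform_within_open[OF D op[OF ab]])
    show "coord S a p \<in> overlap S a b"
      using p by (auto simp: overlap_def)
    show "transition S b a (transition S a b x) = x" if "x \<in> overlap S a b" for x
      using that tr ab by (auto simp: overlap_def)
  qed
  then have "(\<lambda>h. Jac S b a (coord S b p) *v (Jac S a b (coord S a p) *v h)) = (\<lambda>h. h)"
    using has_derivative_ident has_derivative_unique by blast
  then show ?thesis
    by (metis matrix_eq matrix_vector_mul_assoc matrix_vector_mul_lid)
qed

lemma openin_atlas_pointwise:
  fixes S :: "('i, 'p, 'n::finite) atlas"
  assumes S: "smooth_atlas S" and W: "W \<subseteq> points S"
    and P: "\<And>a p. a \<in> charts S \<Longrightarrow> p \<in> chart_dom S a \<Longrightarrow> p \<in> W \<longleftrightarrow> P a (coord S a p)"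
    and op: "\<And>a. a \<in> charts S \<Longrightarrow> open {x \<in> region S a. P a x}"
  shows "openin (atlas_topology S) W"
  unfolding openin_atlas_topology[OF S]
proof (intro conjI W ballI)
  fix a assume a: "a \<in> charts S"
  then have "coord S a ` (W \<inter> chart_dom S a) = {x \<in> region S a. P a x}"
    using P by (auto simp: region_def)
  then show "open (coord S a ` (W \<inter> chart_dom S a))"
    using op[OF a] by simp
qed

text \<open>The zero set of \<open>T\<close> is open by uniqueness for linear differential equations and closed by continuity.
  Whether \<open>T\<close> vanishes at a point does not depend on the chart since the Jacobians are invertible.\<close>

lemma parallel11_nowhere_zero:
  fixes S :: "('i, 'p, 'n::finite) atlas"
  assumes S: "smooth_atlas S" "connected_space (atlas_topology S)"
    and conn: "affine_connection S \<Gamma>" and T: "tensor11_field S T" "parallel11 S \<Gamma> T"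
    and nz: "b \<in> charts S" "y \<in> region S b" "T b y \<noteq> 0"
    and ax: "a \<in> charts S" "x \<in> region S a"
  shows "T a x \<noteq> 0"
proof
  assume Tx: "T a x = 0"
  have open_region: "open (region S c)" if "c \<in> charts S" for c
    using S(1) that by (simp add: smooth_atlas_def)
  have smT: "smooth_on (region S c) (\<lambda>x. T c x $ k $ j)" if "c \<in> charts S" for c k j
    using T(1) that by (simp add: tensor11_field_def)
  have indep: "T d (coord S d p) = 0"
    if "c \<in> charts S" "d \<in> charts S" "p \<in> chart_dom S c" "p \<in> chart_dom S d" "T c (coord S c p) = 0" for c d p
  proof -
    have "coord S c p \<in> overlap S c d" "transition S c d (coord S c p) = coord S d p"
      using S(1) that by (auto simp: overlap_def transition_def smooth_atlas_def)
    then have "T d (coord S d p) ** Jac S c d (coord S c p) = Jac S c d (coord S c p) ** T c (coord S c p)"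
      using T(1) that(1,2) unfolding tensor11_field_def by metis
    then have "T d (coord S d p) ** Jac S c d (coord S c p) = 0"
      using that(5) by simp
    then have "T d (coord S d p) ** (Jac S c d (coord S c p) ** Jac S d c (coord S d p)) = 0"
      by (simp add: matrix_mul_assoc)
    then show ?thesis
      by (simp add: Jac_inverse[OF S(1) that(2,1,4,3)])
  qed
  define Z where "Z = {p \<in> points S. \<forall>c\<in>charts S. p \<in> chart_dom S c \<longrightarrow> T c (coord S c p) = 0}"
  have Z: "p \<in> Z \<longleftrightarrow> T c (coord S c p) = 0" if "c \<in> charts S" "p \<in> chart_dom S c" for c p
  proof
    assume "T c (coord S c p) = 0"
    then have "\<forall>d\<in>charts S. p \<in> chart_dom S d \<longrightarrow> T d (coord S d p) = 0"
      using indep[OF that(1) _ that(2)] by blast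
    then show "p \<in> Z"
      using that unfolding Z_def points_def by blast
  next
    assume "p \<in> Z"
    then show "T c (coord S c p) = 0"
      using that unfolding Z_def by blast
  qed
  have "openin (atlas_topology S) Z"
  proof (rule openin_atlas_pointwise[OF S(1), where P = "\<lambda>c x. T c x = 0"])
    show "open {x \<in> region S c. T c x = 0}" if c: "c \<in> charts S" for c
    proof (rule parallel11_zero_set_open[OF open_region[OF c], where \<Gamma> = "\<Gamma> c"])
      show "continuous_on (region S c) (\<lambda>x. \<Gamma> c x i j k)" for i j k
        using conn c by (auto simp: affine_connection_def intro: smooth_on_imp_continuous_on)
      show "(\<lambda>x. T c x $ k $ j) differentiable at x" if "x \<in> region S c" for x k j
        by (rule smooth_on_imp_differentiable[OF open_region[OF c] smT[OF c] that])
      show "cov11 (\<Gamma> c) (T c) x i j k = 0" if "x \<in> region S c" for x i j k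
        using T(2) c that by (simp add: parallel11_def)
    qed
    show "Z \<subseteq> points S"
      by (auto simp: Z_def)
  qed (rule Z)
  moreover have "openin (atlas_topology S) (points S - Z)"
  proof (rule openin_atlas_pointwise[OF S(1), where P = "\<lambda>c x. T c x \<noteq> 0"])
    show "open {x \<in> region S c. T c x \<noteq> 0}" if c: "c \<in> charts S" for c
    proof -
      have "continuous_on (region S c) (\<lambda>x. \<chi> k j. T c x $ k $ j)"
        by (intro continuous_on_vec_lambda smooth_on_imp_continuous_on smT c)
      then have "continuous_on (region S c) (T c)"
        by simp
      then have "open (region S c \<inter> T c -` (- {0}))"
        by (intro continuous_open_preimage open_region[OF c]) auto
      moreover have "region S c \<inter> T c -` (- {0}) = {x \<in> region S c. T c x \<noteq> 0}" by auto
      ultimately show ?thesis by simp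
    qed
    show "p \<in> points S - Z \<longleftrightarrow> T c (coord S c p) \<noteq> 0" if "c \<in> charts S" "p \<in> chart_dom S c" for c p
      using Z[OF that] that by (auto simp: points_def)
  qed auto
  moreover have "topspace (atlas_topology S) \<subseteq> Z \<union> (points S - Z)"
    using openin_topspace[of "atlas_topology S"] unfolding openin_atlas_topology[OF S(1)] by blast
  moreover have "Z \<noteq> {}" "points S - Z \<noteq> {}"
  proof -
    obtain p where "p \<in> chart_dom S a" "x = coord S a p" using ax by (auto simp: region_def)
    then show "Z \<noteq> {}" using Z[OF ax(1)] Tx by auto
    obtain q where "q \<in> chart_dom S b" "y = coord S b q" using nz by (auto simp: region_def)
    then show "points S - Z \<noteq> {}" using Z[OF nz(1)] nz by (auto simp: points_def)
  qed
  ultimately show False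
    using S(2) unfolding connected_space_def by blast
qed

section \<open>Anti-self-dual modified Riemannian extensions\<close>

theorem proposition5p2:
  fixes S :: "('i, 'p, 2) atlas"
    and \<Gamma> :: "'i \<Rightarrow> 2 christoffel"
    and T \<Phi> :: "'i \<Rightarrow> real^2 \<Rightarrow> real^2^2"
  assumes "affine_surface S \<Gamma>"
    and "tensor11_field S T" "nilpotent11 S T" "parallel11 S \<Gamma> T"
    and "tensor02_field S \<Phi>" "symmetric02 S \<Phi>" "parallel02 S \<Gamma> \<Phi>"
    and "symmetric02 S (\<lambda>a. ricci (\<Gamma> a))"
  shows "anti_self_dual (cotangent_bundle S) (modified_riemann_extension \<Gamma> \<Phi> T)
       (\<lambda>a z. cotangent_vol (modified_riemann_extension \<Gamma> \<Phi> T a z)) \<longleftrightarrow>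
     (\<forall>a\<in>charts S. \<forall>x\<in>region S a. ricci (\<Gamma> a) x \<noteq> 0 \<longrightarrow>
        (\<forall>X. hat1 (recurrence_form (\<Gamma> a) x) (T a x) X = 0)) \<and>
     (\<forall>a\<in>charts S. \<forall>x\<in>region S a. \<forall>X Y. hat2 (\<Phi> a x) (T a x) X Y = 0)"
proof -
  have S: "smooth_atlas S" "connected_space (atlas_topology S)" "affine_connection S \<Gamma>" "torsion_free S \<Gamma>"
    using assms(1) by (simp_all add: affine_surface_def smooth_manifold_def)
  obtain b y where nz: "b \<in> charts S" "y \<in> region S b" "T b y \<noteq> 0"
    using assms(3) by (auto simp: nilpotent11_def)
  have loc: "parallel_surface (region S a) (\<Gamma> a) (T a) (\<Phi> a)" if a: "a \<in> charts S" for a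
  proof
    show "open (region S a)"
      using S(1) a by (simp add: smooth_atlas_def)
    show "T a x \<noteq> 0" if "x \<in> region S a" for x
      by (rule parallel11_nowhere_zero[OF S(1-3) assms(2,4) nz a that])
  qed (use a S assms in \<open>simp_all add: affine_connection_def torsion_free_def tensor11_field_def tensor02_field_def
      nilpotent11_def parallel11_def parallel02_def symmetric02_def\<close>)
  have metric: "modified_riemann_extension \<Gamma> \<Phi> T a = parallel_surface.g (\<Gamma> a) (T a) (\<Phi> a)" if "a \<in> charts S" for a
    by (simp add: fun_eq_iff modified_riemann_extension_def parallel_surface.g_def[OF loc[OF that]])
  have "anti_self_dual (cotangent_bundle S) (modified_riemann_extension \<Gamma> \<Phi> T)
       (\<lambda>a z. cotangent_vol (modified_riemann_extension \<Gamma> \<Phi> T a z)) \<longleftrightarrow>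
     (\<forall>a\<in>charts S. \<forall>x\<in>region S a. \<forall>z. base z = x \<longrightarrow> (\<forall>B.
        self_dual (parallel_surface.g (\<Gamma> a) (T a) (\<Phi> a) z) (cotangent_vol (parallel_surface.g (\<Gamma> a) (T a) (\<Phi> a) z)) B \<longrightarrow>
        bivector_op (parallel_surface.g (\<Gamma> a) (T a) (\<Phi> a) z) (weyl (parallel_surface.g (\<Gamma> a) (T a) (\<Phi> a)) z) B = 0))"
    unfolding anti_self_dual_def
    by (auto simp: cotangent_bundle_def[of S, THEN arg_cong[of _ _ charts], simplified] region_cotangent_bundle[OF S(1)] metric)
  also have "\<dots> \<longleftrightarrow> (\<forall>a\<in>charts S. \<forall>x\<in>region S a.
     parallel_surface.codazzi_ricci (\<Gamma> a) x \<and> (\<forall>X Y. hat2 (\<Phi> a x) (T a x) X Y = 0))"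
    using parallel_surface.weyl_plus_zero_over_point_iff[OF loc] by simp
  also have "\<dots> \<longleftrightarrow> (\<forall>a\<in>charts S. \<forall>x\<in>region S a. ricci (\<Gamma> a) x \<noteq> 0 \<longrightarrow> parallel_surface.codazzi_ricci (\<Gamma> a) x)
     \<and> (\<forall>a\<in>charts S. \<forall>x\<in>region S a. \<forall>X Y. hat2 (\<Phi> a x) (T a x) X Y = 0)"
    using parallel_surface.codazzi_ricci_extends[OF loc] by blast
  also have "\<dots> \<longleftrightarrow> (\<forall>a\<in>charts S. \<forall>x\<in>region S a. ricci (\<Gamma> a) x \<noteq> 0 \<longrightarrow>
        (\<forall>X. hat1 (recurrence_form (\<Gamma> a) x) (T a x) X = 0)) \<and>
     (\<forall>a\<in>charts S. \<forall>x\<in>region S a. \<forall>X Y. hat2 (\<Phi> a x) (T a x) X Y = 0)"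
    using parallel_surface.hat1_zero_iff[OF loc] by simp
  finally show ?thesis .
qed

end
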